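(* Let $k>1$ and $K\in C^1(\mathbb H^2)$ be given. Assume that the function $F^K_k:\mathbb H^2\to\mathbb R$, $F^K_k(z)=\int_{D^{\mathbb H}_{\rho_k}(z)}K\,dV_{\mathbb H}$, has a stable critical point in an open set $A\Subset\mathbb H^2$. Then for every $\varepsilon\in\mathbb R$ close enough to $0$ there exists an embedded $(k+\varepsilon K)$-loop $u^\varepsilon\in C^2(\mathbb S^1,\mathbb H^2)$. Moreover (for this family $u^\varepsilon$), any sequence $\varepsilon_h\to0$ has a subsequence $\varepsilon_{h_j}$ such that $u^{\varepsilon_{h_j}}\to\omega_{z_0}$ in $C^2(\mathbb S^1,\mathbb H^2)$ as $j\to\infty$, where $z_0\in\overline A$ is a critical point for $F^K_k$. In particular, if a point $z_0\in A$ is the unique critical point for $F^K_k$ in $\overline A$, then $u^\varepsilon\to\omega_{z_0}$ in $C^2(\mathbb S^1,\mathbb H^2)$ as $\varepsilon\to0$.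
   Context: $\mathbb H^2=\{z=(z_1,z_2)\in\mathbb R^2: z_2>0\}$ is the Poincaré half-plane with metric $g_{lj}(z)=z_2^{-2}\delta_{lj}$ and volume form $dV_{\mathbb H}=z_2^{-2}dz$. $C^2(\mathbb S^1,\mathbb H^2)$ is regarded as an open subset of the Banach space $C^2(\mathbb S^1,\mathbb R^2)$, $\mathbb S^1\subset\mathbb C$ the unit circle; for a function $f$ on $\mathbb S^1$, $f'(x)$ denotes the derivative in direction $ix$ (i.e. $\frac{d}{d\theta}$ with $x=e^{i\theta}$). For $w\in\mathbb R^2$, $iw=(-w_2,w_1)$. A loop is a curve $u\in C^2(\mathbb S^1,\mathbb H^2)$ with $u'\neq0$ everywhere; it is embedded if it is injective. For $H:\mathbb H^2\to\mathbb R$, an $H$-loop is a loop $u$ whose hyperbolic geodesic curvature $\frac{\langle\nabla^{\mathbb H}_{u'}u',iu'\rangle_g}{|u'|_g^3}$ equals $H(u)$ at each point, where $\nabla^{\mathbb H}_{u'}u'=u''-u_2^{-1}\Gamma(u')$ and $\Gamma(w)=(2w_1w_2,\,w_2^2-w_1^2)$. $\rho_k=\operatorname{artanh}\frac1k$, $R_k=\sinh\rho_k=(k^2-1)^{-1/2}$, and $D^{\mathbb H}_{\rho}(z)$ is the hyperbolic disk of radius $\rho$ centered at $z$. The reference loop is $\omega(x)=\frac{1}{k-x_2}\big(x_1,\frac1{R_k}\big)$, $x=x_1+ix_2\in\mathbb S^1$, and $\omega_z=z_1e_1+z_2\omega$ for $z\in\mathbb H^2$, with $e_1=(1,0)$ ($\omega_z$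 parameterizes $\partial D^{\mathbb H}_{\rho_k}(z)$). $A\Subset\mathbb H^2$ means that $\overline A$ is a compact subset of $\mathbb H^2$. A function $X\in C^1(\mathbb H^2)$ has a stable critical point in the open set $A\Subset\mathbb H^2$ if there exists $r>0$ such that any $G\in C^1(\overline A)$ with $\|G-X\|_{C^1(\overline A)}<r$ has a critical point in $A$. *)

theory Defs
  imports "HOL-Analysis.Analysis"
begin

text \<open>The plane $R^2$ is the type \<^typ>\<open>complex\<close>, regarded as a real Euclidean space with
  coordinates \<^const>\<open>Re\<close> and \<^const>\<open>Im\<close>; the rotation $iw = (-w_2, w_1)$ is multiplication
  by \<^term>\<open>\<i>\<close>.\<close>

definition H2 :: "complex set" where
  "H2 = {z. Im z > 0}"

abbreviation S1 :: "complex set" where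
  "S1 \<equiv> sphere 0 1"


subsection \<open>Twice continuously differentiable maps on the circle\<close>

text \<open>For \<open>x = cis \<theta>\<close> this is the derivative in \<open>\<theta>\<close>. It depends only on
  the values of \<open>u\<close> on the circle through \<open>x\<close> centred at the origin.\<close>

definition circ_deriv :: "(complex \<Rightarrow> complex) \<Rightarrow> complex \<Rightarrow> complex" where
  "circ_deriv u x = vector_derivative (\<lambda>t. u (x * cis t)) (at 0)"

definition circ_differentiable :: "(complex \<Rightarrow> complex) \<Rightarrow> bool" where
  "circ_differentiable u \<longleftrightarrow> (\<forall>x\<in>S1. (\<lambda>t. u (x * cis t)) differentiable (at (0::real)))"

definition C2_circle :: "(complex \<Rightarrow> complex) \<Rightarrow> bool" where
  "C2_circle u \<longleftrightarrow> circ_differentiable u \<and> circ_differentiable (circ_deriv u) \<and>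
     continuous_on S1 (circ_deriv (circ_deriv u))"

definition C2_norm :: "(complex \<Rightarrow> complex) \<Rightarrow> real" where
  "C2_norm u = (SUP x\<in>S1. norm (u x)) + (SUP x\<in>S1. norm (circ_deriv u x))
     + (SUP x\<in>S1. norm (circ_deriv (circ_deriv u) x))"

definition C2_tendsto :: "('i \<Rightarrow> complex \<Rightarrow> complex) \<Rightarrow> (complex \<Rightarrow> complex) \<Rightarrow> 'i filter \<Rightarrow> bool" where
  "C2_tendsto u v F \<longleftrightarrow> ((\<lambda>i. C2_norm (\<lambda>x. u i x - v x)) \<longlongrightarrow> 0) F"


subsection \<open>Loops of prescribed hyperbolic geodesic curvature\<close>

definition hyp_inner :: "complex \<Rightarrow> complex \<Rightarrow> complex \<Rightarrow> real" where
  "hyp_inner z v w = (v \<bullet> w) / (Im z)\<^sup>2"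

definition hyp_norm :: "complex \<Rightarrow> complex \<Rightarrow> real" where
  "hyp_norm z v = sqrt (hyp_inner z v v)"

definition Gam :: "complex \<Rightarrow> complex" where
  "Gam w = Complex (2 * Re w * Im w) ((Im w)\<^sup>2 - (Re w)\<^sup>2)"

text \<open>The covariant derivative of \<open>u'\<close> along \<open>u\<close> for the Levi-Civita connection of
  \<^const>\<open>hyp_inner\<close>.\<close>

definition hyp_accel :: "(complex \<Rightarrow> complex) \<Rightarrow> complex \<Rightarrow> complex" where
  "hyp_accel u x = circ_deriv (circ_deriv u) x - (1 / Im (u x)) *\<^sub>R Gam (circ_deriv u x)"

definition geodesic_curvature :: "(complex \<Rightarrow> complex) \<Rightarrow> complex \<Rightarrow> real" where
  "geodesic_curvature u x =
     hyp_inner (u x) (hyp_accel u x) (\<i> * circ_deriv u x) / (hyp_norm (u x) (circ_deriv u x)) ^ 3"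

definition is_loop :: "(complex \<Rightarrow> complex) \<Rightarrow> bool" where
  "is_loop u \<longleftrightarrow> C2_circle u \<and> u ` S1 \<subseteq> H2 \<and> (\<forall>x\<in>S1. circ_deriv u x \<noteq> 0)"

definition embedded :: "(complex \<Rightarrow> complex) \<Rightarrow> bool" where
  "embedded u \<longleftrightarrow> inj_on u S1"

definition is_H_loop :: "(complex \<Rightarrow> real) \<Rightarrow> (complex \<Rightarrow> complex) \<Rightarrow> bool" where
  "is_H_loop H u \<longleftrightarrow> is_loop u \<and> (\<forall>x\<in>S1. geodesic_curvature u x = H (u x))"


subsection \<open>Hyperbolic disks and the reference loops\<close>

definition hyp_dist :: "complex \<Rightarrow> complex \<Rightarrow> real" where
  "hyp_dist z w = arcosh (1 + (dist z w)\<^sup>2 / (2 * Im z * Im w))"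

definition hyp_disk :: "real \<Rightarrow> complex \<Rightarrow> complex set" where
  "hyp_disk r z = {w \<in> H2. hyp_dist z w < r}"

definition rho :: "real \<Rightarrow> real" where
  "rho k = artanh (1 / k)"

definition R :: "real \<Rightarrow> real" where
  "R k = sinh (rho k)"

definition omega :: "real \<Rightarrow> complex \<Rightarrow> complex" where
  "omega k x = (1 / (k - Im x)) *\<^sub>R Complex (Re x) (1 / R k)"

definition omega_at :: "real \<Rightarrow> complex \<Rightarrow> complex \<Rightarrow> complex" where
  "omega_at k z x = Re z *\<^sub>R 1 + Im z *\<^sub>R omega k x"

text \<open>The integral of \<open>K\<close> with respect to the hyperbolic volume $w_2^{-2} dw$.\<close>

definition F :: "(complex \<Rightarrow> real) \<Rightarrow> real \<Rightarrow> complex \<Rightarrow> real" where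
  "F K k z = (LINT w:hyp_disk (rho k) z|lborel. K w / (Im w)\<^sup>2)"


subsection \<open>Stable critical points\<close>

definition C1_on :: "complex set \<Rightarrow> (complex \<Rightarrow> real) \<Rightarrow> bool" where
  "C1_on U f \<longleftrightarrow> (\<exists>g. (\<forall>z\<in>U. GDERIV f z :> g z) \<and> continuous_on U g)"

text \<open>\<open>C\<^sup>1\<close> up to the boundary: \<open>f\<close> is differentiable in the open set \<open>A\<close>, and \<open>f\<close> and its
  gradient are continuous up to the closure. The gradient on the boundary is the continuous
  extension \<open>g\<close>; no differentiability of \<open>f\<close> at boundary points is required.\<close>

definition C1_closure :: "complex set \<Rightarrow> (complex \<Rightarrow> real) \<Rightarrow> bool" where
  "C1_closure A f \<longleftrightarrow> continuous_on (closure A) f \<and>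
     (\<exists>g. (\<forall>z\<in>A. GDERIV f z :> g z) \<and> continuous_on (closure A) g)"

definition grad :: "(complex \<Rightarrow> real) \<Rightarrow> complex \<Rightarrow> complex" where
  "grad f z = (THE g. GDERIV f z :> g)"

text \<open>By continuity, the supremum of the gradient over \<open>A\<close> is that of its extension over the
  closure.\<close>

definition C1_norm :: "complex set \<Rightarrow> (complex \<Rightarrow> real) \<Rightarrow> real" where
  "C1_norm A f = (SUP z\<in>closure A. \<bar>f z\<bar>) + (SUP z\<in>A. norm (grad f z))"

definition critical_point :: "(complex \<Rightarrow> real) \<Rightarrow> complex \<Rightarrow> bool" where
  "critical_point f z \<longleftrightarrow> GDERIV f z :> 0"

definition compactly_in_H2 :: "complex set \<Rightarrow> bool" where
  "compactly_in_H2 A \<longleftrightarrow> compact (closure A) \<and> closure A \<subseteq> H2"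

text \<open>Taking \<open>G = X\<close> shows that \<open>A\<close> is nonempty. This is stated explicitly because the real
  supremum over the empty set, and hence \<^term>\<open>C1_norm {}\<close>, is unspecified.\<close>

definition has_stable_critical_point :: "(complex \<Rightarrow> real) \<Rightarrow> complex set \<Rightarrow> bool" where
  "has_stable_critical_point X A \<longleftrightarrow> A \<noteq> {} \<and>
     (\<exists>r>0. \<forall>G. C1_closure A G \<and> C1_norm A (\<lambda>z. G z - X z) < r \<longrightarrow>
        (\<exists>z\<in>A. critical_point G z))"

end

theory Submission
  imports Defs
begin

text \<open>Write a curve near the reference loops as \<open>u x = omega_at k (v x) x\<close>. Up to reparametrisation
  the loops of curvature \<open>k + \<epsilon> K\<close> are the closed solutions of a first-order equation
  \<open>v' = \<epsilon> \<Phi>\<close>, which says that \<open>u\<close> has at \<open>x\<close> the tangent direction of \<^const>\<open>omega\<close> and the speed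
  dictated by the curvature. After adding a multiplier \<open>\<gamma> \<sigma>\<close> with constant \<open>\<gamma>\<close>, the equation has for every
  mean value \<open>p\<close> a closed solution near the constant \<open>p\<close>, by contraction. The action
  (weighted area minus length, divided by \<open>\<epsilon>\<close>) of this solution is a function of \<open>p\<close> whose gradient is
  \<open>\<gamma>\<close> up to a rotation and a constant factor: as the mean is a linear constraint, this is the envelope
  theorem and needs only Lipschitz dependence of the solution on \<open>p\<close>. By Green's formula these
  gradients converge uniformly to that of \<open>F K k\<close> as \<open>\<epsilon> \<rightarrow> 0\<close>, so stability yields a zero of \<open>\<gamma>\<close> in
  \<open>A\<close>. Since \<open>u'\<close> and \<open>u''\<close> are continuous functions of \<open>(\<epsilon>, x, u)\<close>, the \<open>C\<^sup>2\<close> convergence follows from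
  convergence of the mean values.\<close>

subsection \<open>Derivatives along the circle and the reference loops\<close>

text \<open>Stability is a statement about perturbed functions and says nothing about vector fields
  near the gradient of \<open>F K k\<close>. The action is there to exhibit \<open>\<gamma>\<close>
  as a gradient, and this dictates the weight \<open>\<sigma>\<close>. In the coordinate
  \<open>v\<close> the first variation pairs a displacement \<open>h\<close> with \<open>v'\<close>
  through the area form, with density proportional to \<open>den / (Im v)\<^sup>2\<close>. Only a
  multiplier scaled by the inverse density enters with a constant coefficient, and then the integral
  of \<open>h\<close>, which the mean condition prescribes, is all that matters.

  Prescribing the tangent direction removes the freedom of reparametrisation and lowers the order by
  one. With \<open>K\<close> merely C^1 the field is still Lipschitz on compact sets, so a
  contraction replaces the inversion of a linearised operator, and u'' is obtained by
  differentiating the equation once. At \<epsilon> = 0 every constant \<open>p\<close> is a solution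
  (the loop \<open>omega_at k p\<close>), while closing up imposes two real conditions; hence a
  multiplier with values in the plane.\<close>

lemma has_vector_derivative_Complex:
  assumes "(f has_real_derivative f') net" "(g has_real_derivative g') net"
  shows "((\<lambda>t. Complex (f t) (g t)) has_vector_derivative Complex f' g') net"
proof -
  have "((\<lambda>t. f t *\<^sub>R 1 + g t *\<^sub>R \<i>) has_vector_derivative (f' *\<^sub>R 1 + g' *\<^sub>R \<i>)) net"
    using assms unfolding has_real_derivative_iff_has_vector_derivative
    by (intro has_vector_derivative_add
        bounded_linear.has_vector_derivative[OF bounded_linear_scaleR_left])
  moreover have "a *\<^sub>R 1 + b *\<^sub>R \<i> = Complex a b" for a b
    by (simp add: complex_eq_iff)
  ultimately show ?thesis by simp
qed

lemma has_real_derivative_Re: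
  "(f has_vector_derivative f') net \<Longrightarrow> ((\<lambda>t. Re (f t)) has_real_derivative Re f') net"
  unfolding has_real_derivative_iff_has_vector_derivative
  by (rule bounded_linear.has_vector_derivative[OF bounded_linear_Re])

lemma has_real_derivative_Im:
  "(f has_vector_derivative f') net \<Longrightarrow> ((\<lambda>t. Im (f t)) has_real_derivative Im f') net"
  unfolding has_real_derivative_iff_has_vector_derivative
  by (rule bounded_linear.has_vector_derivative[OF bounded_linear_Im])

lemma GDERIV_chain_curve:
  assumes "GDERIV f (c t) :> g" "(c has_vector_derivative c') (at t within T)"
  shows "((\<lambda>s. f (c s)) has_real_derivative (c' \<bullet> g)) (at t within T)"
proof -
  have 1: "(f has_derivative (\<lambda>h. h \<bullet> g)) (at (c t))"
    using assms(1) by (simp add: gderiv_def)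
  have 2: "(f has_derivative (\<lambda>h. h \<bullet> g)) (at (c t) within c ` T)"
    using 1 has_derivative_at_withinI by blast
  have 3: "((f \<circ> c) has_derivative ((\<lambda>h. h \<bullet> g) \<circ> (\<lambda>h. h *\<^sub>R c'))) (at t within T)"
    using diff_chain_within[OF _ 2] assms(2) by (auto simp: has_vector_derivative_def)
  then show ?thesis
    by (simp add: o_def has_field_derivative_def mult.commute[of _ "c' \<bullet> g"])
qed

lemma circle_flow_deriv: "((\<lambda>t. x * cis t) has_vector_derivative \<i> * x) (at 0)"
  unfolding has_vector_derivative_def
  by (auto intro!: derivative_eq_intros simp: algebra_simps scaleR_conv_of_real)

lemma Re_circle_flow_deriv: "((\<lambda>t. Re (x * cis t)) has_real_derivative - Im x) (at 0)"
  using has_real_derivative_Re[OF circle_flow_deriv[of x]] by simp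

lemma Im_circle_flow_deriv: "((\<lambda>t. Im (x * cis t)) has_real_derivative Re x) (at 0)"
  using has_real_derivative_Im[OF circle_flow_deriv[of x]] by simp

lemma circle_mult_cis: "x \<in> S1 \<Longrightarrow> x * cis t \<in> S1"
  by (simp add: norm_mult)

lemma circle_coords:
  assumes "x \<in> S1" shows "(Re x)\<^sup>2 + (Im x)\<^sup>2 = 1" "Im x \<le> 1" "-1 \<le> Im x"
proof -
  show 1: "(Re x)\<^sup>2 + (Im x)\<^sup>2 = 1" using assms by (simp add: cmod_def)
  have "\<bar>Im x\<bar> \<le> 1" using abs_Im_le_cmod[of x] assms by simp
  then show "Im x \<le> 1" "-1 \<le> Im x" by auto
qed

lemma circ_deriv_eq:
  "((\<lambda>t. u (x * cis t)) has_vector_derivative u') (at 0) \<Longrightarrow> circ_deriv u x = u'"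
  unfolding circ_deriv_def by (rule vector_derivative_at)

lemma R_identities: assumes "k > 1" shows "R k > 0" "cosh (rho k) = k * R k" "(R k)\<^sup>2 * (k\<^sup>2 - 1) = 1"
proof -
  have th: "tanh (rho k) = 1 / k"
  proof -
    have "exp (- 2 * rho k) = (1 - 1 / k) / (1 + 1 / k)"
    proof -
      define a where "a = 1 / k"
      have a: "0 < a" "a < 1" using assms by (auto simp: a_def)
      have "exp (- 2 * artanh a) = exp (- ln ((1 + a) / (1 - a)))"
        by (simp add: artanh_def)
      also have "\<dots> = (1 - a) / (1 + a)"
        using a by (subst exp_minus, subst exp_ln) auto
      finally show ?thesis by (simp add: rho_def a_def)
    qed
    also have "\<dots> = (k - 1) / (k + 1)" using assms by (simp add: divide_simps)
    finally have e: "exp (- 2 * rho k) = (k - 1) / (k + 1)" .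
    have "1 - (k - 1) / (k + 1) = 2 / (k + 1)" "1 + (k - 1) / (k + 1) = 2 * k / (k + 1)"
      using assms by (simp_all add: divide_simps)
    then have "tanh (rho k) = (2 / (k + 1)) / (2 * k / (k + 1))"
      unfolding tanh_real_altdef e by (simp only:)
    also have "\<dots> = 1 / k"
    proof -
      have *: "2 / d / (2 * k / d) = 1 / k" if "d \<noteq> 0" for d
        using that by simp
      have "k + 1 \<noteq> 0" using assms by simp
      from *[OF this] show ?thesis .
    qed
    finally show ?thesis .
  qed
  then have 1: "cosh (rho k) = k * R k" unfolding R_def tanh_def using assms
    by (simp add: field_simps)
  then show "cosh (rho k) = k * R k" .
  have "cosh (rho k) > 0" by simp
  then show "R k > 0" using 1 assms by (simp add: zero_less_mult_iff)
  have "(cosh (rho k))\<^sup>2 = (R k)\<^sup>2 + 1" unfolding R_def by (rule cosh_square_eq)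
  then show "(R k)\<^sup>2 * (k\<^sup>2 - 1) = 1" using 1 by (simp add: algebra_simps power_mult_distrib)
qed

text \<open>The real part has been simplified with
  \<open>(Re x)\<^sup>2 + (Im x)\<^sup>2 = 1\<close>, so this is the derivative of
  \<open>omega k\<close> only on the circle.\<close>

definition omega_dot :: "real \<Rightarrow> complex \<Rightarrow> complex" where
  "omega_dot k x = Complex ((1 - k * Im x) / (k - Im x)\<^sup>2) (Re x / (R k * (k - Im x)\<^sup>2))"

definition omega_ddot :: "real \<Rightarrow> complex \<Rightarrow> complex" where
  "omega_ddot k x = Complex
     (- k * Re x / (k - Im x)\<^sup>2 + 2 * Re x * (1 - k * Im x) / (k - Im x) ^ 3)
     (- Im x / (R k * (k - Im x)\<^sup>2) + 2 * (Re x)\<^sup>2 / (R k * (k - Im x) ^ 3))"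

text \<open>If \<open>u' = l *\<^sub>R omega_dot k x\<close>, the curvature is
  \<open>Im z / (R k * l) + (1 - k * Im x) / (k - Im x)\<close>, without any derivative of
  \<open>l\<close>. Equating this to \<open>k + \<epsilon> * K z\<close> and using
  \<open>(R k)\<^sup>2 * (k\<^sup>2 - 1) = 1\<close> gives the formula.\<close>

definition speed :: "real \<Rightarrow> (complex \<Rightarrow> real) \<Rightarrow> real \<Rightarrow> complex \<Rightarrow> complex \<Rightarrow> real" where
  "speed k K \<epsilon> x z = Im z * R k * (k - Im x) / (1 + \<epsilon> * (R k)\<^sup>2 * (k - Im x) * K z)"

text \<open>The first-order form of the curvature equation: the tangent direction at \<open>x\<close> is that of
  \<^const>\<open>omega\<close>, and the curvature then determines the speed.\<close>

definition loop_ode :: "real \<Rightarrow> (complex \<Rightarrow> real) \<Rightarrow> real \<Rightarrow> (complex \<Rightarrow> complex) \<Rightarrow> bool" where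
  "loop_ode k K \<epsilon> u \<longleftrightarrow> (\<forall>x\<in>S1. u x \<in> H2 \<and> 0 < 1 + \<epsilon> * (R k)\<^sup>2 * (k - Im x) * K (u x) \<and>
     ((\<lambda>t. u (x * cis t)) has_vector_derivative speed k K \<epsilon> x (u x) *\<^sub>R omega_dot k x) (at 0))"

lemma omega_eq: "omega k x = Complex (Re x / (k - Im x)) (1 / (R k * (k - Im x)))"
  by (simp add: omega_def complex_eq_iff)

lemma omega_circle_deriv:
  assumes "k > 1" "x \<in> S1"
  shows "((\<lambda>t. omega k (x * cis t)) has_vector_derivative omega_dot k x) (at 0)"
proof -
  have R: "R k > 0" and x: "k - Im x \<noteq> 0" "(Re x)\<^sup>2 = 1 - (Im x)\<^sup>2"
    using R_identities[OF assms(1)] circle_coords[OF assms(2)] assms(1) by auto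
  have 1: "((\<lambda>t. a t / (k - b t)) has_real_derivative (a' * (k - b 0) + a 0 * b') / (k - b 0)\<^sup>2) (at 0)"
    and 2: "((\<lambda>t. 1 / (r * (k - b t))) has_real_derivative b' / (r * (k - b 0)\<^sup>2)) (at 0)"
    if "(a has_real_derivative a') (at 0)" "(b has_real_derivative b') (at 0)" "k - b 0 \<noteq> 0" "r \<noteq> 0"
    for a b :: "real \<Rightarrow> real" and a' b' r
    using that(3,4) by (auto intro!: derivative_eq_intros that(1,2) simp: power2_eq_square)
  have nz: "k - Im (x * cis 0) \<noteq> 0" "R k \<noteq> 0" using R x by auto
  have "(- Im x * (k - Im x) + Re x * Re x) / (k - Im x)\<^sup>2 = (1 - k * Im x) / (k - Im x)\<^sup>2"
    using x(2) by (simp add: algebra_simps power2_eq_square)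
  then show ?thesis unfolding omega_eq omega_dot_def
    using has_vector_derivative_Complex[OF 1[OF Re_circle_flow_deriv[of x] Im_circle_flow_deriv[of x] nz]
        2[OF Re_circle_flow_deriv[of x] Im_circle_flow_deriv[of x] nz]] x(1)
    by simp
qed

lemma omega_dot_circle_deriv:
  assumes "k > 1" "x \<in> S1"
  shows "((\<lambda>t. omega_dot k (x * cis t)) has_vector_derivative omega_ddot k x) (at 0)"
proof -
  have R: "R k > 0" and x: "k - Im x \<noteq> 0"
    using R_identities[OF assms(1)] circle_coords[OF assms(2)] assms(1) by auto
  have 1: "((\<lambda>t. (1 - k * b t) / (k - b t)\<^sup>2) has_real_derivative
       - k * b' / (k - b 0)\<^sup>2 + 2 * b' * (1 - k * b 0) / (k - b 0) ^ 3) (at 0)"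
    and 2: "((\<lambda>t. a t / (r * (k - b t)\<^sup>2)) has_real_derivative
       a' / (r * (k - b 0)\<^sup>2) + 2 * (a 0 * b') / (r * (k - b 0) ^ 3)) (at 0)"
    if "(a has_real_derivative a') (at 0)" "(b has_real_derivative b') (at 0)" "k - b 0 \<noteq> 0" "r \<noteq> 0"
    for a b :: "real \<Rightarrow> real" and a' b' r
  proof -
    have e1: "(- (k * b') * d\<^sup>2 - (1 - k * b0) * (2 * d * - b')) / (d\<^sup>2 * d\<^sup>2) =
       - k * b' / d\<^sup>2 + 2 * b' * (1 - k * b0) / d ^ 3" if "d \<noteq> 0" for d b0
      using that by (simp add: divide_simps power2_eq_square power3_eq_cube) (simp add: algebra_simps)
    have e2: "(a' * (r * d\<^sup>2) - a0 * (r * (2 * d * - b'))) / (r * d\<^sup>2 * (r * d\<^sup>2)) =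
       a' / (r * d\<^sup>2) + 2 * (a0 * b') / (r * d ^ 3)" if "d \<noteq> 0" for d a0
      using that \<open>r \<noteq> 0\<close> by (simp add: divide_simps power2_eq_square power3_eq_cube) (simp add: algebra_simps)
    have sq: "((\<lambda>t. (k - b t)\<^sup>2) has_real_derivative 2 * (k - b 0) * - b') (at 0)"
      by (auto intro!: derivative_eq_intros that(2))
    have num: "((\<lambda>t. 1 - k * b t) has_real_derivative - (k * b')) (at 0)"
      by (auto intro!: derivative_eq_intros that(2))
    show "((\<lambda>t. (1 - k * b t) / (k - b t)\<^sup>2) has_real_derivative
       - k * b' / (k - b 0)\<^sup>2 + 2 * b' * (1 - k * b 0) / (k - b 0) ^ 3) (at 0)"
      using DERIV_divide[OF num sq] that(3) unfolding e1[OF that(3)] by simp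
    show "((\<lambda>t. a t / (r * (k - b t)\<^sup>2)) has_real_derivative
       a' / (r * (k - b 0)\<^sup>2) + 2 * (a 0 * b') / (r * (k - b 0) ^ 3)) (at 0)"
      using DERIV_divide[OF that(1) DERIV_cmult[OF sq, of r]] that(3,4) unfolding e2[OF that(3)] by simp
  qed
  have nz: "k - Im (x * cis 0) \<noteq> 0" "R k \<noteq> 0" using R x by auto
  show ?thesis unfolding omega_dot_def omega_ddot_def
    using has_vector_derivative_Complex[OF 1[OF Re_circle_flow_deriv[of x] Im_circle_flow_deriv[of x] nz]
        2[OF Re_circle_flow_deriv[of x] Im_circle_flow_deriv[of x] nz]]
    by (simp add: power2_eq_square)
qed

text \<open>Since \<open>Im (omega k x) = 1 / (R k * (k - Im x))\<close>, the reference loop has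
  constant hyperbolic speed \<open>R k\<close>. The identity rests on
  \<open>1 / (R k)\<^sup>2 = k\<^sup>2 - 1\<close>.\<close>

lemma norm_omega_dot:
  assumes "k > 1" "x \<in> S1"
  shows "norm (omega_dot k x) = 1 / (k - Im x)"
proof -
  have R: "(R k)\<^sup>2 * (k\<^sup>2 - 1) = 1" "R k > 0" and x: "k - Im x > 0" "(Re x)\<^sup>2 = 1 - (Im x)\<^sup>2"
    using R_identities[OF assms(1)] circle_coords[OF assms(2)] assms(1) by auto
  have R2: "1 / (R k)\<^sup>2 = k\<^sup>2 - 1" using R by (simp add: field_simps)
  have "(1 - k * Im x)\<^sup>2 + (Re x)\<^sup>2 * (1 / (R k)\<^sup>2) = (k - Im x)\<^sup>2"
    unfolding R2 x by (simp add: algebra_simps power2_eq_square)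
  then have "((1 - k * Im x) / (k - Im x)\<^sup>2)\<^sup>2 + (Re x / (R k * (k - Im x)\<^sup>2))\<^sup>2 = (1 / (k - Im x))\<^sup>2"
    using x(1) R(2) by (simp add: power_divide power_mult_distrib field_simps)
  then show ?thesis unfolding omega_dot_def cmod_def using x(1) by simp
qed


section \<open>Second derivative and geodesic curvature of solutions\<close>

definition speed_dot ::
  "real \<Rightarrow> (complex \<Rightarrow> real) \<Rightarrow> (complex \<Rightarrow> complex) \<Rightarrow> real \<Rightarrow> complex \<Rightarrow> complex \<Rightarrow> real" where
  "speed_dot k K gK \<epsilon> x z =
    (let z' = speed k K \<epsilon> x z *\<^sub>R omega_dot k x; D = k - Im x; m = 1 + \<epsilon> * (R k)\<^sup>2 * D * K z in
     ((Im z' * R k * D - Im z * R k * Re x) * m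
       - Im z * R k * D * (\<epsilon> * (R k)\<^sup>2 * (D * (z' \<bullet> gK z) - Re x * K z))) / m\<^sup>2)"

definition loop_accel ::
  "real \<Rightarrow> (complex \<Rightarrow> real) \<Rightarrow> (complex \<Rightarrow> complex) \<Rightarrow> real \<Rightarrow> complex \<Rightarrow> complex \<Rightarrow> complex" where
  "loop_accel k K gK \<epsilon> x z =
     speed_dot k K gK \<epsilon> x z *\<^sub>R omega_dot k x + speed k K \<epsilon> x z *\<^sub>R omega_ddot k x"

lemma loop_ode_second_derivative:
  assumes "k > 1" and K: "\<And>z. z \<in> H2 \<Longrightarrow> GDERIV K z :> gK z"
    and u: "loop_ode k K \<epsilon> u" and x: "x \<in> S1"
  shows "((\<lambda>t. speed k K \<epsilon> (x * cis t) (u (x * cis t)) *\<^sub>R omega_dot k (x * cis t))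
    has_vector_derivative loop_accel k K gK \<epsilon> x (u x)) (at 0)"
proof -
  let ?u' = "speed k K \<epsilon> x (u x) *\<^sub>R omega_dot k x"
  have ux: "u x \<in> H2" and pos: "0 < 1 + \<epsilon> * (R k)\<^sup>2 * (k - Im x) * K (u x)"
    and du: "((\<lambda>t. u (x * cis t)) has_vector_derivative ?u') (at 0)"
    using u x by (auto simp: loop_ode_def)
  have dK: "((\<lambda>t. K (u (x * cis t))) has_real_derivative (?u' \<bullet> gK (u x))) (at 0)"
    by (rule GDERIV_chain_curve[OF _ du]) (use K ux in simp)
  have quot: "((\<lambda>t. a t * r * (k - b t) / (1 + \<epsilon> * r\<^sup>2 * (k - b t) * c t)) has_real_derivative
      ((a' * r * (k - b 0) - a 0 * r * b') * (1 + \<epsilon> * r\<^sup>2 * (k - b 0) * c 0)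
       - a 0 * r * (k - b 0) * (\<epsilon> * r\<^sup>2 * ((k - b 0) * c' - b' * c 0)))
       / (1 + \<epsilon> * r\<^sup>2 * (k - b 0) * c 0)\<^sup>2) (at 0)"
    if "(a has_real_derivative a') (at 0)" "(b has_real_derivative b') (at 0)"
      "(c has_real_derivative c') (at 0)" "1 + \<epsilon> * r\<^sup>2 * (k - b 0) * c 0 \<noteq> 0"
    for a b c :: "real \<Rightarrow> real" and a' b' c' r
    using that(4)
    by (auto intro!: derivative_eq_intros that(1,2,3) simp: power2_eq_square algebra_simps)
  have "((\<lambda>t. speed k K \<epsilon> (x * cis t) (u (x * cis t))) has_real_derivative
     speed_dot k K gK \<epsilon> x (u x)) (at 0)"
    unfolding speed_def[of _ _ _ "_ * cis _"]
    using quot[OF has_real_derivative_Im[OF du] Im_circle_flow_deriv dK, of "R k"] pos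
    by (simp add: speed_dot_def Let_def)
  from has_vector_derivative_scaleR[OF this omega_dot_circle_deriv[OF assms(1) x]]
  show ?thesis by (simp add: loop_accel_def algebra_simps)
qed

lemma loop_ode_circ_deriv:
  assumes "loop_ode k K \<epsilon> u" "x \<in> S1"
  shows "circ_deriv u x = speed k K \<epsilon> x (u x) *\<^sub>R omega_dot k x"
  using assms by (intro circ_deriv_eq) (auto simp: loop_ode_def)

lemma loop_ode_circ_deriv2:
  assumes "k > 1" and K: "\<And>z. z \<in> H2 \<Longrightarrow> GDERIV K z :> gK z"
    and u: "loop_ode k K \<epsilon> u" and x: "x \<in> S1"
  shows "((\<lambda>t. circ_deriv u (x * cis t)) has_vector_derivative loop_accel k K gK \<epsilon> x (u x)) (at 0)"
proof -
  have "circ_deriv u (x * cis t) = speed k K \<epsilon> (x * cis t) (u (x * cis t)) *\<^sub>R omega_dot k (x * cis t)" for t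
    by (rule loop_ode_circ_deriv[OF u circle_mult_cis[OF x]])
  then show ?thesis
    using loop_ode_second_derivative[OF assms] by simp
qed

text \<open>The only second-order quantity that the curvature sees: the other term of u'' is a
  multiple of \<open>omega_dot k x\<close> and hence orthogonal to
  \<open>\<i> * omega_dot k x\<close>.\<close>

lemma inner_omega_ddot:
  assumes "k > 1" "x \<in> S1"
  shows "omega_ddot k x \<bullet> (\<i> * omega_dot k x) = 1 / (R k * (k - Im x) ^ 3)"
proof -
  have R: "R k > 0" and D: "k - Im x > 0"
    using R_identities[OF assms(1)] circle_coords[OF assms(2)] assms(1) by auto
  define c s where "c = Re x" and "s = Im x"
  have c: "c * c = 1 - s * s"
    using circle_coords[OF assms(2)] by (simp add: c_def s_def power2_eq_square)
  have "(- k * c / d\<^sup>2 + 2 * c * (1 - k * s) / d ^ 3) * - (c / (r * d\<^sup>2)) +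
      (- s / (r * d\<^sup>2) + 2 * c\<^sup>2 / (r * d ^ 3)) * ((1 - k * s) / d\<^sup>2)
     = (k * (c * c) - s * (1 - k * s)) / (r * d^4)" if "d > 0" "r > 0" for d r
    using that by (simp add: field_simps power2_eq_square power3_eq_cube eval_nat_numeral)
  from this[OF D R] have "(- k * c / (k - s)\<^sup>2 + 2 * c * (1 - k * s) / (k - s) ^ 3) * - (c / (R k * (k - s)\<^sup>2)) +
      (- s / (R k * (k - s)\<^sup>2) + 2 * c\<^sup>2 / (R k * (k - s) ^ 3)) * ((1 - k * s) / (k - s)\<^sup>2)
     = (k * (c * c) - s * (1 - k * s)) / (R k * (k - s)^4)" by (simp add: s_def)
  also have "k * (c * c) - s * (1 - k * s) = k - s" unfolding c by (simp add: algebra_simps)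
  finally show ?thesis
    using R D unfolding s_def[symmetric] by (simp add: inner_complex_def omega_ddot_def omega_dot_def c_def s_def
       eval_nat_numeral)
qed

lemma loop_ode_curvature:
  assumes "k > 1" and K: "\<And>z. z \<in> H2 \<Longrightarrow> GDERIV K z :> gK z"
    and u: "loop_ode k K \<epsilon> u" and x: "x \<in> S1"
  shows "geodesic_curvature u x = k + \<epsilon> * K (u x)"
proof -
  define D l y w p where "D = k - Im x" and "l = speed k K \<epsilon> x (u x)" and "y = Im (u x)"
    and "w = omega_dot k x" and "p = omega_ddot k x"
  define l' m where "l' = speed_dot k K gK \<epsilon> x (u x)" and "m = 1 + \<epsilon> * (R k)\<^sup>2 * D * K (u x)"
  have R: "R k > 0" "(R k)\<^sup>2 * (k\<^sup>2 - 1) = 1" and D: "D > 0"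
    using R_identities[OF assms(1)] circle_coords[OF x] assms(1) by (auto simp: D_def)
  have y: "y > 0" and m: "m > 0" using u x by (auto simp: loop_ode_def y_def H2_def D_def m_def)
  have l: "l = y * R k * D / m" by (simp add: l_def speed_def m_def y_def D_def)
  then have lpos: "l > 0" using y m R D by simp
  have d1: "circ_deriv u x = l *\<^sub>R w" unfolding l_def w_def by (rule loop_ode_circ_deriv[OF u x])
  have d2: "circ_deriv (circ_deriv u) x = l' *\<^sub>R w + l *\<^sub>R p"
    using circ_deriv_eq[OF loop_ode_circ_deriv2[OF assms]]
    by (simp add: loop_accel_def l_def l'_def w_def p_def)
  have nw: "norm w = 1 / D" unfolding w_def D_def by (rule norm_omega_dot[OF assms(1) x])
  then have ww: "w \<bullet> w = 1 / D\<^sup>2" by (simp add: dot_square_norm power_divide)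
  have pw: "p \<bullet> (\<i> * w) = 1 / (R k * D ^ 3)"
    unfolding p_def w_def D_def by (rule inner_omega_ddot[OF assms(1) x])
  \<comment> \<open>\<open>Gam\<close> is quadratic and
    \<open>Gam w \<bullet> (\<i> * w) = - Re w * (w \<bullet> w)\<close> for every \<open>w\<close>,
    so the connection contributes a multiple of \<open>Re w\<close>.\<close>
  have Gw: "Gam (l *\<^sub>R w) \<bullet> (\<i> * w) = - l\<^sup>2 * Re w / D\<^sup>2"
  proof -
    have "Gam (l *\<^sub>R w) \<bullet> (\<i> * w) = - l\<^sup>2 * Re w * (w \<bullet> w)"
      by (simp add: Gam_def inner_complex_def power2_eq_square algebra_simps)
    then show ?thesis using ww by simp
  qed
  \<comment> \<open>This removes \<open>l'\<close>, and with it the gradient of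
    \<open>K\<close>.\<close>
  have iw: "w \<bullet> (\<i> * w) = 0" by (simp add: inner_complex_def)
  have "hyp_accel u x \<bullet> (\<i> * (l *\<^sub>R w)) = l * (hyp_accel u x \<bullet> (\<i> * w))" by simp
  also have "hyp_accel u x \<bullet> (\<i> * w) = l / (R k * D ^ 3) + l\<^sup>2 * Re w / (y * D\<^sup>2)"
    unfolding hyp_accel_def d1 d2 y_def[symmetric]
    by (simp add: inner_add_left inner_diff_left iw pw Gw field_simps)
  finally have num: "hyp_inner (u x) (hyp_accel u x) (\<i> * circ_deriv u x) =
     l * (l / (R k * D ^ 3) + l\<^sup>2 * Re w / (y * D\<^sup>2)) / y\<^sup>2"
    unfolding hyp_inner_def y_def[symmetric] d1 by simp
  have den: "hyp_norm (u x) (circ_deriv u x) = l / (D * y)"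
  proof -
    have "hyp_inner (u x) (l *\<^sub>R w) (l *\<^sub>R w) = (l / (D * y))\<^sup>2"
      unfolding hyp_inner_def y_def[symmetric] by (simp add: ww power2_eq_square)
    then show ?thesis unfolding hyp_norm_def d1 using lpos D y by simp
  qed
  have "geodesic_curvature u x = y / (R k * l) + D * Re w"
    unfolding geodesic_curvature_def num den using lpos D y R(1)
    by (simp add: field_simps power2_eq_square power3_eq_cube)
  also have "y / (R k * l) = m / ((R k)\<^sup>2 * D)"
    unfolding l using y m R D by (simp add: power2_eq_square)
  also have "\<dots> = (k\<^sup>2 - 1) / D + \<epsilon> * K (u x)"
  proof -
    have "1 / (R k)\<^sup>2 = k\<^sup>2 - 1" using R by (simp add: field_simps)
    moreover have "m / ((R k)\<^sup>2 * D) = (1 / (R k)\<^sup>2) / D + \<epsilon> * K (u x)"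
      using R(1) D by (simp add: m_def field_simps)
    ultimately show ?thesis by simp
  qed
  also have "D * Re w = (1 - k * Im x) / D"
    using D by (simp add: w_def omega_dot_def D_def power2_eq_square)
  also have "(k\<^sup>2 - 1) / D + \<epsilon> * K (u x) + (1 - k * Im x) / D = k + \<epsilon> * K (u x)"
    using D by (simp add: field_simps) (simp add: D_def power2_eq_square algebra_simps)
  finally show ?thesis .
qed

subsection \<open>Curvature, embeddedness and convergence of solutions\<close>

text \<open>In the applications \<open>P\<close> is an open set or \<open>ode_domain k K\<close>,
  which is not compact, so a uniform modulus is available only near \<open>C\<close>. Offending
  pairs \<open>(c, p)\<close> would accumulate at a point of \<open>C\<close>, where
  \<open>g\<close> is continuous.\<close>

lemma continuous_on_uniform_nhd:
  fixes g :: "'a::metric_space \<Rightarrow> 'b::metric_space"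
  assumes g: "continuous_on P g" and C: "compact C" "C \<subseteq> P" and "\<eta> > 0"
  shows "\<exists>\<delta>>0. \<forall>c\<in>C. \<forall>p\<in>P. dist p c < \<delta> \<longrightarrow> dist (g p) (g c) < \<eta>"
proof (rule ccontr)
  assume neg: "\<not> ?thesis"
  have "\<exists>c p. c \<in> C \<and> p \<in> P \<and> dist p c < inverse (real (Suc n)) \<and> \<eta> \<le> dist (g p) (g c)" for n
  proof -
    have "inverse (real (Suc n)) > 0" by simp
    then show ?thesis using neg by (meson not_less)
  qed
  then obtain c p where c: "\<And>n. c n \<in> C" and p: "\<And>n. p n \<in> P"
    and d: "\<And>n. dist (p n) (c n) < inverse (real (Suc n))" and far: "\<And>n. \<eta> \<le> dist (g (p n)) (g (c n))"
    by metis
  obtain l r where l: "l \<in> C" and r: "strict_mono r" and lim: "(c \<circ> r) \<longlonglongrightarrow> l"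
    using C(1) c unfolding compact_def by metis
  have "(\<lambda>n. dist (p (r n)) (c (r n))) \<longlonglongrightarrow> 0"
  proof (rule Lim_null_comparison)
    show "\<forall>\<^sub>F n in sequentially. norm (dist (p (r n)) (c (r n))) \<le> inverse (real (Suc (r n)))"
      using d less_imp_le by (intro always_eventually allI) auto
    show "(\<lambda>n. inverse (real (Suc (r n)))) \<longlonglongrightarrow> 0"
      using LIMSEQ_subseq_LIMSEQ[OF LIMSEQ_inverse_real_of_nat r] by (simp add: o_def)
  qed
  moreover have "(\<lambda>n. dist (c (r n)) l) \<longlonglongrightarrow> 0"
    using lim tendsto_dist_iff[of "c \<circ> r" l] by (simp add: o_def)
  ultimately have z: "(\<lambda>n. dist (p (r n)) (c (r n)) + dist (c (r n)) l) \<longlonglongrightarrow> 0"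
    by (rule tendsto_add_zero)
  have "(\<lambda>n. dist (p (r n)) l) \<longlonglongrightarrow> 0"
    by (rule Lim_null_comparison[OF _ z]) (simp add: dist_triangle)
  then have pl: "(\<lambda>n. p (r n)) \<longlonglongrightarrow> l"
    using tendsto_dist_iff[of "\<lambda>n. p (r n)" l] by simp
  have "(\<lambda>n. g (p (r n))) \<longlonglongrightarrow> g l"
    by (rule continuous_on_tendsto_compose[OF g pl]) (use l C(2) p in auto)
  moreover have "(\<lambda>n. g (c (r n))) \<longlonglongrightarrow> g l"
  proof (rule continuous_on_tendsto_compose[OF g lim[unfolded o_def]])
    show "l \<in> P" using l C(2) by blast
    have "c n \<in> P" for n using c C(2) by blast
    then show "\<forall>\<^sub>F n in sequentially. c (r n) \<in> P" by simp
  qed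
  ultimately have "(\<lambda>n. dist (g (p (r n))) (g (c (r n)))) \<longlonglongrightarrow> dist (g l) (g l)"
    by (rule tendsto_dist)
  then have "\<eta> \<le> dist (g l) (g l)"
    using far by (intro LIMSEQ_le_const) auto
  then show False using \<open>\<eta> > 0\<close> by simp
qed

lemma GDERIV_imp_continuous_on:
  "(\<And>z. z \<in> U \<Longrightarrow> GDERIV f z :> g z) \<Longrightarrow> continuous_on U f"
  unfolding gderiv_def by (meson continuous_at_imp_continuous_on has_derivative_continuous)

text \<open>Points \<open>y\<close> of the circle near \<open>x\<close> are
  \<open>x * cis (Arg (y / x))\<close>, and \<open>Arg\<close> is continuous at 1; so the behaviour
  of \<open>u (x * cis t)\<close> at \<open>t = 0\<close> controls \<open>u\<close> along the
  circle.\<close>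

lemma circ_differentiable_continuous_on:
  assumes "\<And>x. x \<in> S1 \<Longrightarrow> ((\<lambda>t. u (x * cis t)) has_vector_derivative u' x) (at 0)"
  shows "continuous_on S1 u"
proof (unfold continuous_on_def, intro ballI)
  fix x :: complex assume x: "x \<in> S1"
  then have x0: "x \<noteq> 0" by auto
  have c: "isCont (\<lambda>t. u (x * cis t)) 0"
    by (rule has_vector_derivative_continuous[OF assms[OF x]])
  have "((\<lambda>y. y / x) \<longlongrightarrow> 1) (at x within S1)"
    using x0 by (auto intro!: tendsto_eq_intros)
  moreover have "isCont Arg 1" by (rule continuous_at_Arg) simp
  ultimately have "((\<lambda>y. Arg (y / x)) \<longlongrightarrow> Arg 1) (at x within S1)"
    by (rule isCont_tendsto_compose[rotated])
  then have "((\<lambda>y. Arg (y / x)) \<longlongrightarrow> 0) (at x within S1)" by simp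
  from isCont_tendsto_compose[OF c this]
  have "((\<lambda>y. u (x * cis (Arg (y / x)))) \<longlongrightarrow> u x) (at x within S1)" by simp
  moreover have "\<forall>\<^sub>F y in at x within S1. u (x * cis (Arg (y / x))) = u y"
  proof -
    have "u (x * cis (Arg (y / x))) = u y" if y: "y \<in> S1" for y
    proof -
      have n: "norm (y / x) = 1" using x y by (simp add: norm_divide)
      then have "y / x \<noteq> 0" by (metis norm_zero zero_neq_one)
      then have "cis (Arg (y / x)) = y / x" using n by (simp add: cis_Arg sgn_div_norm)
      then show ?thesis using x0 by simp
    qed
    then show ?thesis by (simp add: eventually_at_filter)
  qed
  ultimately show "(u \<longlongrightarrow> u x) (at x within S1)"
    by (rule Lim_transform_eventually)
qed

lemma circle_deriv_imp_line_deriv: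
  assumes "((\<lambda>t. u (cis \<theta> * cis t)) has_vector_derivative u') (at 0)"
  shows "((\<lambda>s. u (cis s)) has_vector_derivative u') (at \<theta>)"
proof -
  have 1: "((\<lambda>s. s - \<theta>) has_vector_derivative 1) (at \<theta>)"
    by (auto intro!: derivative_eq_intros)
  have "((\<lambda>t. u (cis \<theta> * cis t)) has_vector_derivative u') (at (\<theta> - \<theta>))" using assms by simp
  from vector_diff_chain_at[OF 1 this]
  show ?thesis by (simp add: o_def cis_mult)
qed

definition ode_domain :: "real \<Rightarrow> (complex \<Rightarrow> real) \<Rightarrow> (real \<times> complex \<times> complex) set" where
  "ode_domain k K = {(\<epsilon>, x, z). x \<in> S1 \<and> z \<in> H2 \<and> 0 < 1 + \<epsilon> * (R k)\<^sup>2 * (k - Im x) * K z}"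

lemma continuous_on_ode:
  assumes k: "k > 1" and K: "\<And>z. z \<in> H2 \<Longrightarrow> GDERIV K z :> gK z" and gK: "continuous_on H2 gK"
  shows "continuous_on (ode_domain k K) (\<lambda>(\<epsilon>, x, z). speed k K \<epsilon> x z *\<^sub>R omega_dot k x)"
    and "continuous_on (ode_domain k K) (\<lambda>(\<epsilon>, x, z). loop_accel k K gK \<epsilon> x z)"
proof -
  let ?P = "ode_domain k K"
  have cK: "continuous_on ?P (\<lambda>p. K (snd (snd p)))"
    by (rule continuous_on_compose2[OF GDERIV_imp_continuous_on[OF K]])
       (auto intro!: continuous_intros simp: ode_domain_def)
  have cgK: "continuous_on ?P (\<lambda>p. gK (snd (snd p)))"
    by (rule continuous_on_compose2[OF gK])
       (auto intro!: continuous_intros simp: ode_domain_def)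
  have nz: "1 + fst p * (R k)\<^sup>2 * (k - Im (fst (snd p))) * K (snd (snd p)) \<noteq> 0" if "p \<in> ?P" for p
    using that by (auto simp: ode_domain_def)
  have nz2: "k - Im (fst (snd p)) \<noteq> 0" "R k \<noteq> 0" if "p \<in> ?P" for p
    using that k circle_coords[of "fst (snd p)"] R_identities[OF k] by (auto simp: ode_domain_def)
  have sp: "continuous_on ?P (\<lambda>p. speed k K (fst p) (fst (snd p)) (snd (snd p)))"
    unfolding speed_def by (intro continuous_intros cK ballI) (use nz in auto)
  have od: "continuous_on ?P (\<lambda>p. omega_dot k (fst (snd p)))"
    unfolding omega_dot_def by (intro continuous_intros ballI) (use nz2 in auto)
  have odd: "continuous_on ?P (\<lambda>p. omega_ddot k (fst (snd p)))"
    unfolding omega_ddot_def by (intro continuous_intros ballI) (use nz2 in auto)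
  have sd: "continuous_on ?P (\<lambda>p. speed_dot k K gK (fst p) (fst (snd p)) (snd (snd p)))"
    unfolding speed_dot_def Let_def by (intro continuous_intros sp od cK cgK ballI) (use nz in auto)
  show "continuous_on ?P (\<lambda>(\<epsilon>, x, z). speed k K \<epsilon> x z *\<^sub>R omega_dot k x)"
    unfolding case_prod_unfold by (intro continuous_intros sp od)
  show "continuous_on ?P (\<lambda>(\<epsilon>, x, z). loop_accel k K gK \<epsilon> x z)"
    unfolding case_prod_unfold loop_accel_def by (intro continuous_intros sp od odd sd)
qed

lemma loop_ode_continuous_on:
  "loop_ode k K \<epsilon> u \<Longrightarrow> continuous_on S1 u"
  by (rule circ_differentiable_continuous_on) (auto simp: loop_ode_def)

lemma loop_ode_speed_pos:
  assumes k: "k > 1" and u: "loop_ode k K \<epsilon> u" and x: "x \<in> S1"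
  shows "speed k K \<epsilon> x (u x) > 0"
proof -
  have "0 < Im (u x)" "0 < 1 + \<epsilon> * (R k)\<^sup>2 * (k - Im x) * K (u x)"
    using u x by (auto simp: loop_ode_def H2_def)
  moreover have "0 < R k" "0 < k - Im x" using k circle_coords[OF x] R_identities(1)[OF k] by auto
  ultimately show ?thesis by (simp add: speed_def)
qed

lemma loop_ode_is_H_loop:
  assumes k: "k > 1" and K: "\<And>z. z \<in> H2 \<Longrightarrow> GDERIV K z :> gK z" and gK: "continuous_on H2 gK"
    and u: "loop_ode k K \<epsilon> u"
  shows "is_H_loop (\<lambda>z. k + \<epsilon> * K z) u"
proof -
  have "circ_differentiable u"
    using u unfolding circ_differentiable_def loop_ode_def by (auto intro: differentiableI_vector)
  moreover have "circ_differentiable (circ_deriv u)"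
    using loop_ode_circ_deriv2[OF k K u] unfolding circ_differentiable_def
    by (metis differentiableI_vector)
  moreover have "continuous_on S1 (circ_deriv (circ_deriv u))"
  proof -
    have "continuous_on S1 (\<lambda>x. (\<lambda>(\<epsilon>, x, z). loop_accel k K gK \<epsilon> x z) (\<epsilon>, x, u x))"
      by (rule continuous_on_compose2[OF continuous_on_ode(2)[OF k K gK]])
         (use u in \<open>auto intro!: continuous_intros loop_ode_continuous_on[OF u]
            simp: ode_domain_def loop_ode_def\<close>)
    moreover have "circ_deriv (circ_deriv u) x = loop_accel k K gK \<epsilon> x (u x)" if "x \<in> S1" for x
      using circ_deriv_eq[OF loop_ode_circ_deriv2[OF k K u that]] .
    ultimately show ?thesis by (subst continuous_on_cong[OF refl]) auto
  qed
  moreover have "circ_deriv u x \<noteq> 0" if x: "x \<in> S1" for x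
  proof -
    have "speed k K \<epsilon> x (u x) > 0" by (rule loop_ode_speed_pos[OF k u x])
    moreover have "norm (omega_dot k x) \<noteq> 0"
      using norm_omega_dot[OF k x] circle_coords[OF x] k by simp
    ultimately show ?thesis unfolding loop_ode_circ_deriv[OF u x] by auto
  qed
  moreover have "u ` S1 \<subseteq> H2" using u by (auto simp: loop_ode_def)
  ultimately show ?thesis
    using loop_ode_curvature[OF k K u] by (auto simp: is_H_loop_def is_loop_def C2_circle_def)
qed

section \<open>Embeddedness\<close>

lemma cos_less_cos_arc:
  assumes "0 < d" "d < pi" "d < t" "t < 2 * pi - d"
  shows "cos t < cos d"
proof (cases "t \<le> pi")
  case True then show ?thesis using assms cos_monotone_0_pi[of d t] by auto
next
  case False
  have "cos t = cos (2 * pi - t)" by simp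
  then show ?thesis using assms False cos_monotone_0_pi[of d "2 * pi - t"] by auto
qed

lemma circle_eq_cis:
  assumes "x \<in> S1" shows "x = cis (Arg2pi x)"
proof -
  have "cis (Arg2pi x) = of_real (norm x) * exp (\<i> * of_real (Arg2pi x))"
    using assms by (simp add: cis_conv_exp)
  also have "\<dots> = x" by (rule Arg2pi_eq[symmetric])
  finally show ?thesis ..
qed

text \<open>The component of \<open>u'\<close> in the direction \<open>(- sin m / k, R cos m)\<close> is a positive multiple of
  \<open>cos (\<theta> - m) - sin m / k\<close>. When \<open>m\<close> is the midpoint of the two parameters of a double point,
  this has a constant sign on one of the two arcs they bound.\<close>

lemma loop_ode_embedded:
  assumes k: "k > 1" and u: "loop_ode k K \<epsilon> u"
  shows "embedded u"
proof -
  have main: False if ab: "0 \<le> a" "a < b" "b < 2 * pi" and eq: "u (cis a) = u (cis b)" for a b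
  proof -
    define m d where "m = (a + b) / 2" and "d = (b - a) / 2"
    define n where "n = Complex (- sin m / k) (R k * cos m)"
    define l where "l = (\<lambda>s. cos (s - m) - sin m / k)"
    define q where "q = (\<lambda>s. speed k K \<epsilon> (cis s) (u (cis s)) / (k - sin s)\<^sup>2)"
    have q: "q s > 0" for s
    proof -
      have "sin s \<noteq> k" using k sin_le_one[of s] by linarith
      then show ?thesis
        using loop_ode_speed_pos[OF k u, of "cis s"] unfolding q_def by simp
    qed
    have deriv: "((\<lambda>s. u (cis s) \<bullet> n) has_real_derivative q s * l s) (at s)" for s
    proof -
      have "((\<lambda>s. u (cis s)) has_vector_derivative
          speed k K \<epsilon> (cis s) (u (cis s)) *\<^sub>R omega_dot k (cis s)) (at s)"
        by (rule circle_deriv_imp_line_deriv) (use u in \<open>auto simp: loop_ode_def\<close>)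
      then have "((\<lambda>s. u (cis s) \<bullet> n) has_real_derivative
          (speed k K \<epsilon> (cis s) (u (cis s)) *\<^sub>R omega_dot k (cis s)) \<bullet> n) (at s)"
        unfolding has_real_derivative_iff_has_vector_derivative
        by (rule bounded_linear.has_vector_derivative[OF bounded_linear_inner_left])
      moreover have "omega_dot k (cis s) \<bullet> n = l s / (k - sin s)\<^sup>2"
      proof -
        have "(1 - k * sin s) * (- sin m / k) + cos s / R k * (R k * cos m) = l s"
        proof -
          have "(1 - k * sin s) * (- sin m / k) = - (sin m / k) + sin s * sin m"
            using k by (simp add: field_simps)
          moreover have "cos s / R k * (R k * cos m) = cos s * cos m"
            using R_identities(1)[OF k] by simp
          ultimately show ?thesis by (simp add: l_def cos_diff)
        qed
        moreover have "omega_dot k (cis s) \<bullet> n =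
            ((1 - k * sin s) * (- sin m / k) + cos s / R k * (R k * cos m)) / (k - sin s)\<^sup>2"
          by (simp only: omega_dot_def n_def inner_complex_def complex.sel cis.sel add_divide_distrib) simp
        ultimately show ?thesis by simp
      qed
      ultimately show ?thesis by (simp add: q_def)
    qed
    have cont: "continuous_on T (\<lambda>s. u (cis s) \<bullet> n)" for T
      using deriv by (intro continuous_at_imp_continuous_on ballI DERIV_isCont)
    have d: "0 < d" "d < pi" "a = m - d" "b = m + d" using ab by (auto simp: m_def d_def field_simps)
    \<comment> \<open>\<open>cos d\<close> is the value of \<open>cos (s - m)\<close> at both
      parameters. If the threshold \<open>sin m / k\<close> is at most \<open>cos d\<close>, then
      \<open>l > 0\<close> on the arc from \<open>a\<close> to \<open>b\<close>; otherwise
      \<open>l < 0\<close> on the complementary arc from \<open>b\<close> to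
      \<open>a + 2 * pi\<close>. Either way strict monotonicity contradicts the double
      point.\<close>
    show False
    proof (cases "cos d \<ge> sin m / k")
      case True
      have "u (cis a) \<bullet> n < u (cis b) \<bullet> n"
      proof (rule DERIV_pos_imp_increasing_open[OF ab(2)])
        fix s assume s: "a < s" "s < b"
        have "cos \<bar>s - m\<bar> > cos d"
          using s d by (intro cos_monotone_0_pi) auto
        then have "l s > 0" using True by (simp add: l_def)
        then show "\<exists>y. ((\<lambda>s. u (cis s) \<bullet> n) has_real_derivative y) (at s) \<and> 0 < y"
          using deriv[of s] mult_pos_pos[OF q[of s]] by blast
      qed (rule cont)
      then show False using eq by simp
    next
      case False
      have "u (cis (a + 2 * pi)) \<bullet> n < u (cis b) \<bullet> n"
      proof (rule DERIV_neg_imp_decreasing_open[where f = "\<lambda>s. u (cis s) \<bullet> n" and a = b and b = "a + 2 * pi"])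
        show "b < a + 2 * pi" using ab by simp
        fix s assume s: "b < s" "s < a + 2 * pi"
        have "cos (s - m) < cos d"
          using s d by (intro cos_less_cos_arc) auto
        then have "l s < 0" using False by (simp add: l_def)
        then show "\<exists>y. ((\<lambda>s. u (cis s) \<bullet> n) has_real_derivative y) (at s) \<and> y < 0"
          using deriv[of s] mult_pos_neg[OF q[of s]] by blast
      qed (rule cont)
      moreover have "cis (a + 2 * pi) = cis a" by (simp add: complex_eq_iff)
      ultimately show False using eq by simp
    qed
  qed
  show ?thesis unfolding embedded_def
  proof (rule inj_onI, rule ccontr)
    fix x y assume xy: "x \<in> S1" "y \<in> S1" "u x = u y" "x \<noteq> y"
    define a b where "a = Arg2pi x" and "b = Arg2pi y"
    have x: "x = cis a" "y = cis b"
      using circle_eq_cis[OF xy(1)] circle_eq_cis[OF xy(2)] by (simp_all only: a_def b_def)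
    have r: "0 \<le> a" "a < 2 * pi" "0 \<le> b" "b < 2 * pi"
      using Arg2pi_ge_0 Arg2pi_lt_2pi by (auto simp: a_def b_def)
    have eq: "u (cis a) = u (cis b)" using x xy(3) by metis
    have "a \<noteq> b" using x xy(4) by metis
    then consider "a < b" | "b < a" by linarith
    then show False
    proof cases
      case 1
      show False by (rule main[OF r(1) 1 r(4) eq])
    next
      case 2
      show False by (rule main[OF r(3) 2 r(2) eq[symmetric]])
    qed
  qed
qed


section \<open>C^2 convergence to a reference loop\<close>

lemma omega_at_circle_deriv:
  assumes "k > 1" "x \<in> S1"
  shows "((\<lambda>t. omega_at k z (x * cis t)) has_vector_derivative Im z *\<^sub>R omega_dot k x) (at 0)"
proof -
  have "((\<lambda>t. Re z *\<^sub>R 1 + Im z *\<^sub>R omega k (x * cis t)) has_vector_derivative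
      0 + Im z *\<^sub>R omega_dot k x) (at 0)"
    by (intro has_vector_derivative_add has_vector_derivative_const
        bounded_linear.has_vector_derivative[OF bounded_linear_scaleR_right] omega_circle_deriv assms)
  then show ?thesis unfolding omega_at_def by simp
qed

lemma Im_omega_at: "Im (omega_at k z x) = Im z / (R k * (k - Im x))"
  by (simp add: omega_at_def omega_eq)

lemma omega_at_in_H2:
  assumes "k > 1" "z \<in> H2" "x \<in> S1" shows "omega_at k z x \<in> H2"
  using assms(2) R_identities(1)[OF assms(1)] circle_coords[OF assms(3)] assms(1)
  by (simp add: H2_def Im_omega_at)

lemma loop_ode_omega_at:
  assumes "k > 1" "z \<in> H2"
  shows "loop_ode k K 0 (omega_at k z)"
proof -
  have "speed k K 0 x (omega_at k z x) = Im z" if "x \<in> S1" for x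
    using R_identities(1)[OF assms(1)] circle_coords[OF that] assms(1)
    by (simp add: speed_def Im_omega_at)
  then show ?thesis
    using omega_at_circle_deriv[OF assms(1)] omega_at_in_H2[OF assms] by (simp add: loop_ode_def)
qed

lemma SUP_S1_bounds:
  assumes "\<And>x. x \<in> S1 \<Longrightarrow> 0 \<le> f x" "\<And>x. x \<in> S1 \<Longrightarrow> f x \<le> (b::real)"
  shows "0 \<le> (SUP x\<in>S1. f x)" "(SUP x\<in>S1. f x) \<le> b"
proof -
  have 1: "(1::complex) \<in> S1" by simp
  have "bdd_above (f ` S1)" using assms(2) by (rule bdd_aboveI2)
  from cSUP_upper[OF 1 this] assms(1)[OF 1] show "0 \<le> (SUP x\<in>S1. f x)" by linarith
  show "(SUP x\<in>S1. f x) \<le> b" by (rule cSUP_least) (use 1 assms(2) in blast)+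
qed

lemma loop_ode_C2_tendsto:
  assumes k: "k > 1" and K: "\<And>z. z \<in> H2 \<Longrightarrow> GDERIV K z :> gK z" and gK: "continuous_on H2 gK"
    and z: "z \<in> H2" and e: "e \<longlonglongrightarrow> 0"
    and u: "\<forall>\<^sub>F j in sequentially. loop_ode k K (e j) (u j)"
    and conv: "\<And>\<eta>. \<eta> > 0 \<Longrightarrow> \<forall>\<^sub>F j in sequentially. \<forall>x\<in>S1. dist (u j x) (omega_at k z x) < \<eta>"
  shows "C2_tendsto u (omega_at k z) sequentially"
  unfolding C2_tendsto_def
proof (rule tendstoI)
  fix \<eta> :: real assume \<eta>: "\<eta> > 0"
  let ?w = "omega_at k z" and ?P = "ode_domain k K"
  let ?g1 = "\<lambda>(\<epsilon>, x, z). speed k K \<epsilon> x z *\<^sub>R omega_dot k x"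
  let ?g2 = "\<lambda>(\<epsilon>, x, z). loop_accel k K gK \<epsilon> x z"
  \<comment> \<open>The graph of the limit loop at parameter 0, a compact subset of
    \<open>ode_domain k K\<close>; the moduli of continuity below are uniform near it.\<close>
  let ?C = "(\<lambda>x. (0::real, x, ?w x)) ` S1"
  note w = loop_ode_omega_at[OF k z, of K]
  have C: "compact ?C"
    by (intro compact_continuous_image continuous_intros loop_ode_continuous_on[OF w]) simp
  have CP: "?C \<subseteq> ?P" using w by (auto simp: ode_domain_def loop_ode_def)
  have \<eta>4: "\<eta> / 4 > 0" using \<eta> by simp
  obtain d1 where d1: "d1 > 0" "\<And>c p. c \<in> ?C \<Longrightarrow> p \<in> ?P \<Longrightarrow> dist p c < d1 \<Longrightarrow> dist (?g1 p) (?g1 c) < \<eta> / 4"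
    using continuous_on_uniform_nhd[OF continuous_on_ode(1)[OF k K gK] C CP \<eta>4] by blast
  obtain d2 where d2: "d2 > 0" "\<And>c p. c \<in> ?C \<Longrightarrow> p \<in> ?P \<Longrightarrow> dist p c < d2 \<Longrightarrow> dist (?g2 p) (?g2 c) < \<eta> / 4"
    using continuous_on_uniform_nhd[OF continuous_on_ode(2)[OF k K gK] C CP \<eta>4] by blast
  \<comment> \<open>Both \<open>\<bar>e j\<bar>\<close> and the distance of the loops will be below
    \<open>d\<close>, whence the doubled \<open>d\<close>; three errors of at most
    \<open>\<eta> / 4\<close> add up to less than \<open>\<eta>\<close>.\<close>
  define d where "d = min (min d1 d2) \<eta> / 4"
  have d: "0 < d" "d + d < d1" "d + d < d2" "d \<le> \<eta> / 4" using d1(1) d2(1) \<eta> by (auto simp: d_def)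
  have "\<forall>\<^sub>F j in sequentially. \<bar>e j\<bar> < d"
    using tendstoD[OF e d(1)] by (simp add: dist_real_def)
  with u conv[OF d(1)]
  show "\<forall>\<^sub>F j in sequentially. dist (C2_norm (\<lambda>x. u j x - ?w x)) 0 < \<eta>"
  proof eventually_elim
    case (elim j)
    note uj = elim(1)
    have near: "dist (e j, x, u j x) (0, x, ?w x) < d + d" if "x \<in> S1" for x
    proof -
      have "dist (e j, x, u j x) (0, x, ?w x) \<le> \<bar>e j\<bar> + dist (u j x) (?w x)"
        using sqrt_sum_squares_le_sum_abs[of "e j" "dist (u j x) (?w x)"] by (simp add: dist_Pair_Pair)
      then show ?thesis using elim that by fastforce
    qed
    have inP: "(e j, x, u j x) \<in> ?P" if "x \<in> S1" for x
      using uj that by (auto simp: ode_domain_def loop_ode_def)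
    have cd1: "circ_deriv (\<lambda>x. u j x - ?w x) x = circ_deriv (u j) x - circ_deriv ?w x" if "x \<in> S1" for x
      using uj w that unfolding loop_ode_circ_deriv[OF uj that] loop_ode_circ_deriv[OF w that]
      by (intro circ_deriv_eq has_vector_derivative_diff) (auto simp: loop_ode_def)
    have cd2: "circ_deriv (circ_deriv (\<lambda>x. u j x - ?w x)) x =
        loop_accel k K gK (e j) x (u j x) - loop_accel k K gK 0 x (?w x)" if x: "x \<in> S1" for x
      using has_vector_derivative_diff[OF loop_ode_circ_deriv2[OF k K uj x] loop_ode_circ_deriv2[OF k K w x]]
      by (intro circ_deriv_eq) (simp add: cd1[OF circle_mult_cis[OF x]])
    have b0: "norm (u j x - ?w x) \<le> \<eta> / 4" if "x \<in> S1" for x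
      using elim(2) that d(4) by (fastforce simp: dist_norm)
    have b1: "norm (circ_deriv (\<lambda>x. u j x - ?w x) x) \<le> \<eta> / 4" if x: "x \<in> S1" for x
      using d1(2)[OF imageI[OF x] inP[OF x]] near[OF x] d(2)
      unfolding cd1[OF x] loop_ode_circ_deriv[OF uj x] loop_ode_circ_deriv[OF w x]
      by (simp add: dist_norm)
    have b2: "norm (circ_deriv (circ_deriv (\<lambda>x. u j x - ?w x)) x) \<le> \<eta> / 4" if x: "x \<in> S1" for x
      using d2(2)[OF imageI[OF x] inP[OF x]] near[OF x] d(3)
      unfolding cd2[OF x] by (simp add: dist_norm)
    show ?case
      using SUP_S1_bounds[where f = "\<lambda>x. norm (u j x - ?w x)", OF norm_ge_zero b0]
        SUP_S1_bounds[where f = "\<lambda>x. norm (circ_deriv (\<lambda>x. u j x - ?w x) x)", OF norm_ge_zero b1]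
        SUP_S1_bounds[where f = "\<lambda>x. norm (circ_deriv (circ_deriv (\<lambda>x. u j x - ?w x)) x)", OF norm_ge_zero b2] \<eta>
      unfolding C2_norm_def dist_real_def by linarith
  qed
qed

subsection \<open>Closed solutions with a multiplier\<close>

abbreviation (input) period :: "real set" where "period \<equiv> {0..2*pi}"

lemma period_0: "(0::real) \<in> period" and period_top: "2 * pi \<in> period"
  by simp_all

lemma norm_integral_period_le:
  fixes f :: "real \<Rightarrow> 'a::euclidean_space"
  assumes "continuous_on period f" "\<And>t. t \<in> period \<Longrightarrow> norm (f t) \<le> c" "s \<in> period"
  shows "norm (integral {0..s} f) \<le> c * (2 * pi)"
proof -
  have c: "0 \<le> c" by (rule order_trans[OF norm_ge_zero assms(2)[OF period_0]])
  have "norm (integral {0..s} f) \<le> c * (s - 0)"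
    by (rule integral_bound) (use assms in \<open>auto intro: continuous_on_subset\<close>)
  also have "\<dots> \<le> c * (2 * pi)" using c assms(3) by (intro mult_left_mono) auto
  finally show ?thesis .
qed

text \<open>The difference of the quotients is
  \<open>(I - I') / G - (G - G') * I' / (G * G')\<close> with \<open>G\<close> and \<open>G'\<close>
  at least \<open>2 * pi * s\<close>; the factors \<open>2 * pi\<close> cancel. It serves both for
  two curves under one field and for the field at \<epsilon> against the field at 0.\<close>

lemma quotient_of_integrals:
  fixes f f' :: "real \<Rightarrow> complex" and g g' :: "real \<Rightarrow> real"
  assumes cont: "continuous_on period f" "continuous_on period f'"
      "continuous_on period g" "continuous_on period g'"
    and M: "\<And>t. t \<in> period \<Longrightarrow> norm (f' t) \<le> M"
    and s: "0 < s" "\<And>t. t \<in> period \<Longrightarrow> s \<le> g t" "\<And>t. t \<in> period \<Longrightarrow> s \<le> g' t"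
    and a: "\<And>t. t \<in> period \<Longrightarrow> norm (f t - f' t) \<le> a" "\<And>t. t \<in> period \<Longrightarrow> norm (g t - g' t) \<le> a"
  shows "norm ((1 / integral period g) *\<^sub>R integral period f - (1 / integral period g') *\<^sub>R integral period f')
      \<le> a * (1 / s + M / s\<^sup>2)" (is "?lhs \<le> _")
    and "norm ((1 / integral period g') *\<^sub>R integral period f') \<le> M / s"
proof -
  have top: "2 * pi \<in> period" by simp
  have lower: "2 * pi * s \<le> integral period h" if "continuous_on period h" "\<And>t. t \<in> period \<Longrightarrow> s \<le> h t" for h
  proof -
    have "integral period (\<lambda>_. s) \<le> integral period h"
      by (rule integral_le) (use that in \<open>auto intro: integrable_continuous_interval\<close>)
    then show ?thesis by (simp add: mult.commute)
  qed
  define G G' where "G = integral period g" and "G' = integral period g'"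
  define I I' where "I = integral period f" and "I' = integral period f'"
  have G: "2 * pi * s \<le> G" and G': "2 * pi * s \<le> G'"
    unfolding G_def G'_def by (rule lower, fact, fact s)+
  have pos: "0 < 2 * pi * s" using s(1) by simp
  have a0: "0 \<le> a" by (rule order_trans[OF norm_ge_zero a(1)[OF period_0]])
  have M0: "0 \<le> M" by (rule order_trans[OF norm_ge_zero M[OF period_0]])
  have I': "norm I' \<le> M * (2 * pi)"
    unfolding I'_def by (rule norm_integral_period_le[OF cont(2) M top])
  have dI: "norm (I - I') \<le> a * (2 * pi)"
  proof -
    have "I - I' = integral period (\<lambda>t. f t - f' t)"
      unfolding I_def I'_def by (rule integral_diff[symmetric]) (use cont in \<open>auto intro: integrable_continuous_interval\<close>)
    then show ?thesis
      using norm_integral_period_le[OF continuous_on_diff[OF cont(1,2)] a(1) top] by simp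
  qed
  have dG: "\<bar>G - G'\<bar> \<le> a * (2 * pi)"
  proof -
    have "G - G' = integral period (\<lambda>t. g t - g' t)"
      unfolding G_def G'_def by (rule integral_diff[symmetric]) (use cont in \<open>auto intro: integrable_continuous_interval\<close>)
    then show ?thesis
      using norm_integral_period_le[OF continuous_on_diff[OF cont(3,4)] a(2) top] by simp
  qed
  have e: "(1 / G) *\<^sub>R I - (1 / G') *\<^sub>R I' = (1 / G) *\<^sub>R (I - I') - ((G - G') / (G * G')) *\<^sub>R I'"
  proof -
    have "G \<noteq> 0" "G' \<noteq> 0" using G G' pos by linarith+
    then have "(G - G') / (G * G') = 1 / G' - 1 / G" by (simp add: diff_divide_distrib)
    then show ?thesis by (simp add: scaleR_diff_left scaleR_diff_right)
  qed
  have "norm ((1 / G) *\<^sub>R (I - I')) \<le> a / s"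
  proof -
    have "norm ((1 / G) *\<^sub>R (I - I')) = norm (I - I') / G" using G pos by simp
    also have "\<dots> \<le> (a * (2 * pi)) / (2 * pi * s)"
      by (rule frac_le) (use dI G pos a0 in auto)
    finally show ?thesis by simp
  qed
  moreover have "norm (((G - G') / (G * G')) *\<^sub>R I') \<le> a * (M / s\<^sup>2)"
  proof -
    have "norm (((G - G') / (G * G')) *\<^sub>R I') = (\<bar>G - G'\<bar> * norm I') / (G * G')"
      using G G' pos by (simp add: abs_mult)
    also have "\<dots> \<le> ((a * (2 * pi)) * (M * (2 * pi))) / ((2 * pi * s) * (2 * pi * s))"
    proof (rule frac_le)
      show "\<bar>G - G'\<bar> * norm I' \<le> (a * (2 * pi)) * (M * (2 * pi))"
        by (rule mult_mono[OF dG I']) (use a0 in auto)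
      show "(2 * pi * s) * (2 * pi * s) \<le> G * G'"
        by (rule mult_mono[OF G G']) (use pos G in linarith)+
      show "0 < (2 * pi * s) * (2 * pi * s)" by (rule mult_pos_pos[OF pos pos])
      show "0 \<le> (a * (2 * pi)) * (M * (2 * pi))" using a0 M0 by simp
    qed
    also have "\<dots> = a * (M / s\<^sup>2)" using s(1) by (simp add: power2_eq_square)
    finally show ?thesis .
  qed
  ultimately have "norm ((1 / G) *\<^sub>R I - (1 / G') *\<^sub>R I') \<le> a / s + a * (M / s\<^sup>2)"
    unfolding e by (intro norm_triangle_le_diff) linarith
  then show "?lhs \<le> a * (1 / s + M / s\<^sup>2)"
    unfolding G_def G'_def I_def I'_def by (simp add: distrib_left)
  have "norm ((1 / G') *\<^sub>R I') = norm I' / G'" using G' pos by simp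
  also have "\<dots> \<le> (M * (2 * pi)) / (2 * pi * s)"
    by (rule frac_le) (use I' G' pos M0 in auto)
  finally show "norm ((1 / integral period g') *\<^sub>R integral period f') \<le> M / s"
    unfolding G'_def I'_def by simp
qed

text \<open>The bounds are global in the space variable, which lets the contraction run on all
  continuous functions. The lower bound \<open>s\<close> keeps the integral of
  \<open>\<sigma>\<close> away from 0, so that the multiplier can be computed from the
  curve.\<close>

locale closed_ode =
  fixes \<Phi> :: "real \<Rightarrow> complex \<Rightarrow> complex" and \<sigma> :: "real \<Rightarrow> complex \<Rightarrow> real" and M L s :: real
  assumes cont_\<Phi>: "\<And>v. continuous_on period v \<Longrightarrow> continuous_on period (\<lambda>t. \<Phi> t (v t))"
    and cont_\<sigma>: "\<And>v. continuous_on period v \<Longrightarrow> continuous_on period (\<lambda>t. \<sigma> t (v t))"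
    and bound_\<Phi>: "\<And>t z. t \<in> period \<Longrightarrow> norm (\<Phi> t z) \<le> M"
    and bound_\<sigma>: "\<And>t z. t \<in> period \<Longrightarrow> norm (\<sigma> t z) \<le> M"
    and lip_\<Phi>: "\<And>t z w. t \<in> period \<Longrightarrow> norm (\<Phi> t z - \<Phi> t w) \<le> L * norm (z - w)"
    and lip_\<sigma>: "\<And>t z w. t \<in> period \<Longrightarrow> norm (\<sigma> t z - \<sigma> t w) \<le> L * norm (z - w)"
    and s_pos: "0 < s" and s_le: "\<And>t z. t \<in> period \<Longrightarrow> s \<le> \<sigma> t z"
begin

text \<open>The multiplier is eliminated instead of being a further unknown: it is the constant for
  which \<open>rhs v\<close> has integral 0 over the period, so that every primitive of
  \<open>rhs v\<close> closes up. The equation becomes nonlocal in \<open>v\<close>, which a fixed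
  point argument tolerates.\<close>

definition mult :: "(real \<Rightarrow> complex) \<Rightarrow> complex" where
  "mult v = - ((1 / integral period (\<lambda>t. \<sigma> t (v t))) *\<^sub>R integral period (\<lambda>t. \<Phi> t (v t)))"

definition rhs :: "(real \<Rightarrow> complex) \<Rightarrow> real \<Rightarrow> complex" where
  "rhs v t = \<Phi> t (v t) + \<sigma> t (v t) *\<^sub>R mult v"

text \<open>\<open>rhs_bound\<close> and \<open>rhs_lip\<close> depend on \<open>M\<close>,
  \<open>L\<close> and \<open>s\<close> alone, so one pair of constants later serves all
  \<epsilon>.\<close>

definition rhs_bound :: real where "rhs_bound = M + M * (M / s)"
definition rhs_lip :: real where "rhs_lip = L + L * (M / s) + M * (L * (1 / s + M / s\<^sup>2))"

lemma M_nonneg: "0 \<le> M" by (rule order_trans[OF norm_ge_zero bound_\<Phi>[OF period_0]])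
lemma L_nonneg: "0 \<le> L" using order_trans[OF norm_ge_zero lip_\<Phi>[OF period_0, of 1 0]] by simp
lemma rhs_bound_nonneg: "0 \<le> rhs_bound" unfolding rhs_bound_def using M_nonneg s_pos by simp
lemma rhs_lip_nonneg: "0 \<le> rhs_lip" unfolding rhs_lip_def using M_nonneg L_nonneg s_pos by simp

lemma norm_mult_le: assumes "continuous_on period v" shows "norm (mult v) \<le> M / s"
  unfolding mult_def norm_minus_cancel
  by (rule quotient_of_integrals(2)[OF cont_\<Phi> cont_\<Phi> cont_\<sigma> cont_\<sigma>, OF assms assms assms assms _ s_pos,
        where a = 0])
     (use bound_\<Phi> s_le in auto)

lemma mult_lipschitz:
  assumes "continuous_on period v" "continuous_on period w" "\<And>t. t \<in> period \<Longrightarrow> norm (v t - w t) \<le> d"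
  shows "norm (mult v - mult w) \<le> L * (1 / s + M / s\<^sup>2) * d"
proof -
  have d: "L * norm (v t - w t) \<le> L * d" if "t \<in> period" for t
    using assms(3)[OF that] L_nonneg by (rule mult_left_mono)
  have "norm (mult v - mult w) \<le> (L * d) * (1 / s + M / s\<^sup>2)"
    unfolding mult_def minus_diff_minus norm_minus_cancel
    by (rule quotient_of_integrals(1)[OF cont_\<Phi> cont_\<Phi> cont_\<sigma> cont_\<sigma>, OF assms(1,2,1,2) _ s_pos])
       (rule bound_\<Phi> s_le order_trans[OF lip_\<Phi> d] order_trans[OF lip_\<sigma> d] | assumption)+
  then show ?thesis by (simp add: mult_ac)
qed

lemma continuous_on_rhs: "continuous_on period v \<Longrightarrow> continuous_on period (rhs v)"
  unfolding rhs_def by (intro continuous_intros cont_\<Phi> cont_\<sigma>)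

lemma norm_rhs_le:
  assumes "continuous_on period v" "t \<in> period" shows "norm (rhs v t) \<le> rhs_bound"
proof -
  have "norm (\<sigma> t (v t)) * norm (mult v) \<le> M * (M / s)"
    using norm_mult_le[OF assms(1)] bound_\<sigma>[OF assms(2)] M_nonneg by (intro mult_mono) auto
  then show ?thesis unfolding rhs_def rhs_bound_def
    using bound_\<Phi>[OF assms(2)] by (intro norm_triangle_le add_mono) auto
qed

lemma rhs_lipschitz:
  assumes v: "continuous_on period v" and w: "continuous_on period w"
    and d: "\<And>t. t \<in> period \<Longrightarrow> norm (v t - w t) \<le> d" and t: "t \<in> period"
  shows "norm (rhs v t - rhs w t) \<le> rhs_lip * d"
proof -
  have d0: "0 \<le> d" using order_trans[OF norm_ge_zero d[OF t]] .
  have Ld: "L * norm (v t - w t) \<le> L * d" using d[OF t] L_nonneg by (rule mult_left_mono)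
  have "rhs v t - rhs w t = (\<Phi> t (v t) - \<Phi> t (w t)) + (\<sigma> t (v t) - \<sigma> t (w t)) *\<^sub>R mult v
      + \<sigma> t (w t) *\<^sub>R (mult v - mult w)"
    by (simp add: rhs_def algebra_simps)
  also have "norm \<dots> \<le> L * d + (L * d) * (M / s) + M * (L * (1 / s + M / s\<^sup>2) * d)"
  proof (intro norm_triangle_le add_mono)
    show "norm (\<Phi> t (v t) - \<Phi> t (w t)) \<le> L * d" by (rule order_trans[OF lip_\<Phi>[OF t] Ld])
    show "norm ((\<sigma> t (v t) - \<sigma> t (w t)) *\<^sub>R mult v) \<le> (L * d) * (M / s)"
      unfolding norm_scaleR real_norm_def[symmetric]
      by (intro mult_mono order_trans[OF lip_\<sigma>[OF t] Ld] norm_mult_le v) (use L_nonneg d0 in auto)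
    show "norm (\<sigma> t (w t) *\<^sub>R (mult v - mult w)) \<le> M * (L * (1 / s + M / s\<^sup>2) * d)"
      unfolding norm_scaleR real_norm_def[symmetric]
      by (intro mult_mono bound_\<sigma> t mult_lipschitz v w d) (use M_nonneg in auto)
  qed
  finally show ?thesis by (simp add: rhs_lip_def algebra_simps)
qed

text \<open>Normalised to mean 0, so that in \<open>p + \<epsilon> *\<^sub>R prim v t\<close> the
  parameter \<open>p\<close> is the mean of the solution and not its initial value.\<close>

definition prim :: "(real \<Rightarrow> complex) \<Rightarrow> real \<Rightarrow> complex" where
  "prim v t = integral {0..t} (rhs v) - (1 / (2 * pi)) *\<^sub>R integral period (\<lambda>t. integral {0..t} (rhs v))"

lemma continuous_on_integral_rhs:
  "continuous_on period v \<Longrightarrow> continuous_on period (\<lambda>t. integral {0..t} (rhs v))"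
  by (rule indefinite_integral_continuous_1[OF integrable_continuous_interval[OF continuous_on_rhs]])

lemma continuous_on_prim: "continuous_on period v \<Longrightarrow> continuous_on period (prim v)"
  unfolding prim_def by (intro continuous_intros continuous_on_integral_rhs)

lemma norm_mean_le:
  fixes f :: "real \<Rightarrow> complex"
  assumes "continuous_on period f" "\<And>t. t \<in> period \<Longrightarrow> norm (f t) \<le> c"
  shows "norm ((1 / (2 * pi)) *\<^sub>R integral period f) \<le> c"
proof -
  have "norm (integral period f) \<le> c * (2 * pi)"
    by (rule norm_integral_period_le[OF assms period_top])
  then show ?thesis by (simp add: field_simps)
qed

lemma norm_prim_le:
  assumes v: "continuous_on period v" and t: "t \<in> period" shows "norm (prim v t) \<le> 4 * pi * rhs_bound"
proof -
  have 1: "norm (integral {0..t} (rhs v)) \<le> rhs_bound * (2 * pi)" if "t \<in> period" for t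
    by (rule norm_integral_period_le[OF continuous_on_rhs[OF v] norm_rhs_le[OF v] that])
  have 2: "norm ((1 / (2 * pi)) *\<^sub>R integral period (\<lambda>t. integral {0..t} (rhs v))) \<le> rhs_bound * (2 * pi)"
    by (rule norm_mean_le[OF continuous_on_integral_rhs[OF v] 1])
  show ?thesis unfolding prim_def
    using norm_triangle_ineq4[of "integral {0..t} (rhs v)"
        "(1 / (2 * pi)) *\<^sub>R integral period (\<lambda>t. integral {0..t} (rhs v))"] 1[OF t] 2
    by (simp only: algebra_simps)
qed

lemma prim_lipschitz:
  assumes v: "continuous_on period v" and w: "continuous_on period w"
    and d: "\<And>t. t \<in> period \<Longrightarrow> norm (v t - w t) \<le> d" and t: "t \<in> period"
  shows "norm (prim v t - prim w t) \<le> 4 * pi * rhs_lip * d"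
proof -
  let ?D = "\<lambda>t. integral {0..t} (rhs v) - integral {0..t} (rhs w)"
  have int: "rhs v integrable_on {0..t}" if "t \<in> period" "continuous_on period v" for t v
    by (rule integrable_continuous_interval, rule continuous_on_subset[OF continuous_on_rhs[OF that(2)]])
       (use that in auto)
  have 1: "norm (?D t) \<le> rhs_lip * d * (2 * pi)" if t: "t \<in> period" for t
  proof -
    have "?D t = integral {0..t} (\<lambda>t. rhs v t - rhs w t)"
      by (rule integral_diff[symmetric]) (use int t v w in auto)
    then show ?thesis
      using norm_integral_period_le[OF continuous_on_diff[OF continuous_on_rhs[OF v] continuous_on_rhs[OF w]]
          rhs_lipschitz[OF v w d] t] by simp
  qed
  have 2: "norm ((1 / (2 * pi)) *\<^sub>R integral period ?D) \<le> rhs_lip * d * (2 * pi)"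
    by (rule norm_mean_le[OF _ 1]) (intro continuous_intros continuous_on_integral_rhs v w)
  have eq: "prim v t - prim w t = ?D t - (1 / (2 * pi)) *\<^sub>R integral period ?D"
    unfolding prim_def
    by (subst integral_diff)
       (auto simp: scaleR_diff_right intro!: integrable_continuous_interval continuous_on_integral_rhs v w)
  have "norm (prim v t - prim w t) \<le> rhs_lip * d * (2 * pi) + rhs_lip * d * (2 * pi)"
    unfolding eq by (rule order_trans[OF norm_triangle_ineq4 add_mono[OF 1[OF t] 2]])
  then show ?thesis by (simp add: mult_ac)
qed

definition solves :: "real \<Rightarrow> complex \<Rightarrow> (real \<Rightarrow> complex) \<Rightarrow> bool" where
  "solves \<epsilon> p v \<longleftrightarrow> continuous_on period v \<and> (\<forall>t\<in>period. v t = p + \<epsilon> *\<^sub>R prim v t)"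

lemma prim_deriv:
  assumes v: "continuous_on period v"
  shows "t \<in> period \<Longrightarrow> (prim v has_vector_derivative rhs v t) (at t within period)"
    and "prim v 0 = prim v (2 * pi)" and "integral period (prim v) = 0"
proof -
  assume t: "t \<in> period"
  have "((\<lambda>t. integral {0..t} (rhs v)) has_vector_derivative rhs v t) (at t within period)"
    by (rule integral_has_vector_derivative[OF continuous_on_rhs[OF v] t])
  then show "(prim v has_vector_derivative rhs v t) (at t within period)"
    unfolding prim_def has_vector_derivative_diff_const .
next
  have c: "(\<lambda>t. \<Phi> t (v t)) integrable_on period" "(\<lambda>t. \<sigma> t (v t)) integrable_on period"
    by (intro integrable_continuous_interval cont_\<Phi> cont_\<sigma> v)+
  have "integral period (\<lambda>_. s) \<le> integral period (\<lambda>t. \<sigma> t (v t))"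
    by (rule integral_le) (use c s_le in auto)
  then have "2 * pi * s \<le> integral period (\<lambda>t. \<sigma> t (v t))" by simp
  moreover have "0 < 2 * pi * s" using s_pos by simp
  ultimately have pos: "integral period (\<lambda>t. \<sigma> t (v t)) \<noteq> 0" by linarith
  have lin: "integral period (\<lambda>t. \<sigma> t (v t) *\<^sub>R mult v) = integral period (\<lambda>t. \<sigma> t (v t)) *\<^sub>R mult v"
    using integral_linear[OF c(2) bounded_linear_scaleR_left[of "mult v"]] by (simp only: o_def)
  have int: "(\<lambda>t. \<sigma> t (v t) *\<^sub>R mult v) integrable_on period"
    using integrable_linear[OF c(2) bounded_linear_scaleR_left[of "mult v"]] by (simp only: o_def)
  have "integral period (rhs v) = integral period (\<lambda>t. \<Phi> t (v t)) + integral period (\<lambda>t. \<sigma> t (v t)) *\<^sub>R mult v"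
    unfolding rhs_def lin[symmetric] by (rule integral_add[OF c(1) int])
  also have "\<dots> = 0" unfolding mult_def using pos by simp
  finally have "integral period (rhs v) = 0" .
  then show "prim v 0 = prim v (2 * pi)" by (simp add: prim_def)
  have "integral period (prim v) = integral period (\<lambda>t. integral {0..t} (rhs v)) -
      integral period (\<lambda>_. (1 / (2 * pi)) *\<^sub>R integral period (\<lambda>t. integral {0..t} (rhs v)))"
    unfolding prim_def
    by (rule integral_diff) (auto intro!: integrable_continuous_interval continuous_on_integral_rhs v)
  then show "integral period (prim v) = 0" by simp
qed

lemma solves_props:
  assumes "solves \<epsilon> p v"
  shows "continuous_on period v"
    and "t \<in> period \<Longrightarrow> (v has_vector_derivative \<epsilon> *\<^sub>R rhs v t) (at t within period)"
    and "v 0 = v (2 * pi)" and "integral period v = (2 * pi) *\<^sub>R p"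
    and "t \<in> period \<Longrightarrow> norm (v t - p) \<le> \<bar>\<epsilon>\<bar> * (4 * pi * rhs_bound)"
proof -
  have v: "continuous_on period v" and eq: "\<And>t. t \<in> period \<Longrightarrow> v t = p + \<epsilon> *\<^sub>R prim v t"
    using assms by (auto simp: solves_def)
  show "continuous_on period v" by (rule v)
  show "(v has_vector_derivative \<epsilon> *\<^sub>R rhs v t) (at t within period)" if t: "t \<in> period"
  proof (rule has_vector_derivative_transform[OF t])
    show "v s = p + \<epsilon> *\<^sub>R prim v s" if "s \<in> period" for s using eq that .
    have "((\<lambda>s. p + \<epsilon> *\<^sub>R prim v s) has_vector_derivative 0 + \<epsilon> *\<^sub>R rhs v t) (at t within period)"
      by (intro has_vector_derivative_add has_vector_derivative_const
          bounded_linear.has_vector_derivative[OF bounded_linear_scaleR_right] prim_deriv(1)[OF v t])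
    then show "((\<lambda>s. p + \<epsilon> *\<^sub>R prim v s) has_vector_derivative \<epsilon> *\<^sub>R rhs v t) (at t within period)"
      by simp
  qed
  show "v 0 = v (2 * pi)" using eq[of 0] eq[of "2 * pi"] prim_deriv(2)[OF v] by simp
  have "integral period v = integral period (\<lambda>t. p + \<epsilon> *\<^sub>R prim v t)"
    by (rule integral_cong) (use eq in auto)
  also have "\<dots> = integral period (\<lambda>t. p) + integral period (\<lambda>t. \<epsilon> *\<^sub>R prim v t)"
    by (rule integral_add)
      (auto intro!: integrable_continuous_interval continuous_intros continuous_on_prim v)
  also have "\<dots> = (2 * pi) *\<^sub>R p" by (simp add: prim_deriv(3)[OF v])
  finally show "integral period v = (2 * pi) *\<^sub>R p" .
  show "norm (v t - p) \<le> \<bar>\<epsilon>\<bar> * (4 * pi * rhs_bound)" if t: "t \<in> period"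
    using mult_left_mono[OF norm_prim_le[OF v t], of "\<bar>\<epsilon>\<bar>"] by (simp add: eq[OF t])
qed

lemma solves_lipschitz:
  assumes sv: "solves \<epsilon> p v" and sw: "solves \<epsilon> q w" and small: "\<bar>\<epsilon>\<bar> * (4 * pi * rhs_lip) \<le> 1 / 2" and t: "t \<in> period"
  shows "norm (v t - w t) \<le> 2 * norm (p - q)"
    and "norm (rhs v t - rhs w t) \<le> rhs_lip * (2 * norm (p - q))"
proof -
  have v: "continuous_on period v" and w: "continuous_on period w" using sv sw by (auto simp: solves_def)
  \<comment> \<open>At a point \<open>t0\<close> where the distance attains its maximum
    \<open>d\<close>, the integral equation gives \<open>d \<le> norm (p - q) + d / 2\<close>, and
    the last term can be absorbed.\<close>
  have "continuous_on period (\<lambda>t. norm (v t - w t))" by (intro continuous_intros v w)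
  then obtain t0 where t0: "t0 \<in> period" and max: "\<And>t. t \<in> period \<Longrightarrow> norm (v t - w t) \<le> norm (v t0 - w t0)"
    using continuous_attains_sup[of period "\<lambda>t. norm (v t - w t)"] by auto
  define d where "d = norm (v t0 - w t0)"
  have "v t0 - w t0 = (p - q) + \<epsilon> *\<^sub>R (prim v t0 - prim w t0)"
    using sv sw t0 by (simp add: solves_def algebra_simps)
  then have "d \<le> norm (p - q) + \<bar>\<epsilon>\<bar> * norm (prim v t0 - prim w t0)"
    unfolding d_def using norm_triangle_ineq[of "p - q" "\<epsilon> *\<^sub>R (prim v t0 - prim w t0)"] by simp
  also have "\<bar>\<epsilon>\<bar> * norm (prim v t0 - prim w t0) \<le> \<bar>\<epsilon>\<bar> * (4 * pi * rhs_lip * d)"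
    by (intro mult_left_mono prim_lipschitz v w t0) (auto simp: d_def max)
  also have "\<dots> = (\<bar>\<epsilon>\<bar> * (4 * pi * rhs_lip)) * d" by simp
  also have "\<dots> \<le> 1 / 2 * d" by (rule mult_right_mono[OF small]) (simp add: d_def)
  finally have d: "d \<le> 2 * norm (p - q)" by simp
  have 1: "norm (v t - w t) \<le> 2 * norm (p - q)" if "t \<in> period" for t
    using max[OF that] d by (simp add: d_def)
  show "norm (v t - w t) \<le> 2 * norm (p - q)" by (rule 1[OF t])
  show "norm (rhs v t - rhs w t) \<le> rhs_lip * (2 * norm (p - q))"
    by (rule rhs_lipschitz[OF v w 1 t])
qed

lemma solves_exists:
  assumes small: "\<bar>\<epsilon>\<bar> * (4 * pi * rhs_lip) \<le> 1 / 2"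
  shows "\<exists>v. solves \<epsilon> p v"
proof -
  \<comment> \<open>The Banach space consists of bounded continuous functions on the whole line.
    Clamping the time extends \<open>prim\<close> by constants outside \<open>period\<close> and
    leaves the equation on \<open>period\<close> unchanged.\<close>
  define clamp where "clamp t = max 0 (min (2 * pi) t)" for t :: real
  have clamp: "clamp t \<in> period" for t unfolding clamp_def using pi_ge_zero by auto
  have clamp_id: "clamp t = t" if "t \<in> period" for t using that by (simp add: clamp_def)
  have cont_clamp: "continuous_on UNIV clamp" unfolding clamp_def by (intro continuous_intros)
  define T where "T f = (\<lambda>t. p + \<epsilon> *\<^sub>R prim (apply_bcontfun f) (clamp t))" for f :: "real \<Rightarrow>\<^sub>C complex"
  have cf: "continuous_on period (apply_bcontfun f)" for f :: "real \<Rightarrow>\<^sub>C complex"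
    by (rule continuous_on_apply_bcontfun)
  have T: "T f \<in> bcontfun" for f
  proof (rule bcontfun_normI)
    show "continuous_on UNIV (T f)" unfolding T_def
      by (intro continuous_intros continuous_on_compose2[OF continuous_on_prim[OF cf] cont_clamp])
        (use clamp in auto)
    show "norm (T f t) \<le> norm p + \<bar>\<epsilon>\<bar> * (4 * pi * rhs_bound)" for t unfolding T_def
      using mult_left_mono[OF norm_prim_le[OF cf clamp], of "\<bar>\<epsilon>\<bar>"]
      by (intro norm_triangle_le add_left_mono) simp
  qed
  have app: "apply_bcontfun (Bcontfun (T f)) = T f" for f by (rule Bcontfun_inverse[OF T])
  have "\<exists>!f. Bcontfun (T f) = f"
  proof (rule banach_fix_type[where c = "1 / 2"])
    show "\<forall>f g. dist (Bcontfun (T f)) (Bcontfun (T g)) \<le> 1 / 2 * dist f g"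
    proof (intro allI dist_bound)
      fix f g :: "real \<Rightarrow>\<^sub>C complex" and t :: real
      have d: "norm (apply_bcontfun f t - apply_bcontfun g t) \<le> dist f g" for t
        using dist_bounded[of f t g] by (simp add: dist_norm)
      have "dist (T f t) (T g t) = \<bar>\<epsilon>\<bar> * norm (prim (apply_bcontfun f) (clamp t) - prim (apply_bcontfun g) (clamp t))"
        by (simp add: T_def dist_norm scaleR_diff_right[symmetric])
      also have "\<dots> \<le> \<bar>\<epsilon>\<bar> * (4 * pi * rhs_lip * dist f g)"
        by (intro mult_left_mono prim_lipschitz cf clamp d) simp
      also have "\<dots> = (\<bar>\<epsilon>\<bar> * (4 * pi * rhs_lip)) * dist f g" by simp
      also have "\<dots> \<le> 1 / 2 * dist f g" by (rule mult_right_mono[OF small]) simp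
      finally show "dist (apply_bcontfun (Bcontfun (T f)) t) (apply_bcontfun (Bcontfun (T g)) t) \<le> 1 / 2 * dist f g"
        unfolding app .
    qed
  qed auto
  then obtain f where f: "Bcontfun (T f) = f" by blast
  have "apply_bcontfun f t = p + \<epsilon> *\<^sub>R prim (apply_bcontfun f) t" if "t \<in> period" for t
  proof -
    have "apply_bcontfun f t = T f t" by (rule fun_cong[OF app[of f, unfolded f]])
    then show ?thesis unfolding T_def clamp_id[OF that] .
  qed
  then show ?thesis unfolding solves_def using cf by blast
qed

end

subsection \<open>First variation of weighted areas\<close>

lemma open_H2: "open H2" unfolding H2_def by (rule open_halfspace_Im_gt)

lemma convex_H2: "convex H2" unfolding H2_def by (rule convex_halfspace_Im_gt)

text \<open>The gradient is uniformly continuous near \<open>C\<close> and small balls about points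
  of \<open>C\<close> stay in \<open>S\<close>, so the mean value inequality applies with one
  \<open>\<delta>\<close> for the whole set, later the trace of a curve.\<close>

lemma C1_uniform_linearization:
  fixes f :: "'a::euclidean_space \<Rightarrow> real"
  assumes f: "\<And>z. z \<in> S \<Longrightarrow> GDERIV f z :> g z" and g: "continuous_on S g"
    and S: "open S" and C: "compact C" "C \<subseteq> S" and \<eta>: "\<eta> > 0"
  shows "\<exists>\<delta>>0. \<forall>c\<in>C. \<forall>y. dist y c < \<delta> \<longrightarrow> \<bar>f y - f c - (y - c) \<bullet> g c\<bar> \<le> \<eta> * norm (y - c)"
proof -
  obtain d1 where d1: "d1 > 0" "\<And>c p. c \<in> C \<Longrightarrow> p \<in> S \<Longrightarrow> dist p c < d1 \<Longrightarrow> dist (g p) (g c) < \<eta>"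
    using continuous_on_uniform_nhd[OF g C \<eta>] by blast
  obtain d2 where d2: "d2 > 0" "(\<Union>c\<in>C. ball c d2) \<subseteq> S"
    using compact_subset_open_imp_ball_epsilon_subset[OF C(1) S C(2)] by blast
  show ?thesis
  proof (intro exI conjI ballI allI impI)
    show "min d1 d2 > 0" using d1(1) d2(1) by simp
    fix c y assume c: "c \<in> C" and y: "dist y c < min d1 d2"
    let ?T = "ball c (min d1 d2)"
    have T: "z \<in> S" "dist (g z) (g c) < \<eta>" if "z \<in> ?T" for z
    proof -
      have "dist z c < d1" "dist z c < d2" using that by (auto simp: dist_commute)
      then have "z \<in> (\<Union>c\<in>C. ball c d2)" using c by (auto simp: dist_commute)
      then show "z \<in> S" using d2(2) by blast
      then show "dist (g z) (g c) < \<eta>" using d1(2)[OF c] \<open>dist z c < d1\<close> by blast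
    qed
    have "norm (f y - f c - (y - c) \<bullet> g c) \<le> norm (y - c) * \<eta>"
    proof (rule differentiable_bound_linearization[where S = ?T and f' = "\<lambda>z h. h \<bullet> g z" and ?x0.0 = c])
      show "c + t *\<^sub>R (y - c) \<in> ?T" if "t \<in> {0..1}" for t
      proof -
        have "dist c (c + t *\<^sub>R (y - c)) = t * dist y c" using that by (simp add: dist_norm norm_minus_commute)
        also have "\<dots> \<le> 1 * dist y c" using that by (intro mult_right_mono) auto
        finally show ?thesis using y by simp
      qed
      show "(f has_derivative (\<lambda>h. h \<bullet> g z)) (at z within ?T)" if "z \<in> ?T" for z
        using f[OF T(1)[OF that]] unfolding gderiv_def by (rule has_derivative_at_withinI)
      show "onorm ((\<lambda>h. h \<bullet> g z) - (\<lambda>h. h \<bullet> g c)) \<le> \<eta>" if "z \<in> ?T" for z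
      proof (rule onorm_le)
        fix h
        have "norm (h \<bullet> (g z - g c)) \<le> norm h * norm (g z - g c)"
          unfolding real_norm_def by (rule Cauchy_Schwarz_ineq2)
        also have "\<dots> \<le> norm h * \<eta>"
          using T(2)[OF that] by (intro mult_left_mono) (auto simp: dist_norm)
        finally show "norm (((\<lambda>h. h \<bullet> g z) - (\<lambda>h. h \<bullet> g c)) h) \<le> \<eta> * norm h"
          by (simp add: inner_diff_right mult.commute)
      qed
      show "c \<in> ?T" using d1(1) d2(1) by simp
    qed
    then show "\<bar>f y - f c - (y - c) \<bullet> g c\<bar> \<le> \<eta> * norm (y - c)" by (simp add: mult.commute)
  qed
qed

text \<open>Integrating \<open>K z / (Im z)\<^sup>2\<close> in the real direction gives the coefficient \<open>B\<close> of a primitive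
  \<open>B d(Im z)\<close> of the weighted area form.\<close>

lemma area_primitive_exists:
  assumes K: "\<And>z. z \<in> H2 \<Longrightarrow> GDERIV K z :> gK z" and gK: "continuous_on H2 gK"
  shows "\<exists>B gB. (\<forall>z\<in>H2. GDERIV B z :> gB z) \<and> continuous_on H2 gB \<and> (\<forall>z\<in>H2. Re (gB z) = K z / (Im z)\<^sup>2)"
proof -
  define f where "f z = K z / (Im z)\<^sup>2" for z
  define gf where "gf z = (1 / (Im z)\<^sup>2) *\<^sub>R gK z - (2 * K z / (Im z) ^ 3) *\<^sub>R \<i>" for z
  have Im0: "Im z \<noteq> 0" if "z \<in> H2" for z using that by (auto simp: H2_def)
  have df: "(f has_derivative (\<lambda>h. h \<bullet> gf z)) (at z)" if z: "z \<in> H2" for z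
  proof -
    have dK: "(K has_derivative (\<lambda>h. h \<bullet> gK z)) (at z)" using K[OF z] by (simp add: gderiv_def)
    have "((\<lambda>y. 1 / y\<^sup>2) has_real_derivative - 2 / y ^ 3) (at y)" if "y \<noteq> 0" for y :: real
    proof -
      have "((\<lambda>y. inverse (y\<^sup>2)) has_real_derivative - (inverse (y\<^sup>2) * (2 * y) * inverse (y\<^sup>2))) (at y)"
        using that by (auto intro!: derivative_eq_intros)
      moreover have "- (inverse (y\<^sup>2) * (2 * y) * inverse (y\<^sup>2)) = - 2 / y ^ 3"
        using that by (simp add: power2_eq_square power3_eq_cube field_simps)
      ultimately show ?thesis by (simp add: divide_inverse)
    qed
    from this[OF Im0[OF z]]
    have dI: "((\<lambda>z. 1 / (Im z)\<^sup>2) has_derivative (\<lambda>h. - 2 / (Im z) ^ 3 * Im h)) (at z)"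
      unfolding has_field_derivative_def
      by (rule has_derivative_compose[OF bounded_linear_imp_has_derivative[OF bounded_linear_Im]])
    have "(\<lambda>h. K z * (- 2 / (Im z) ^ 3 * Im h) + (h \<bullet> gK z) * (1 / (Im z)\<^sup>2)) = (\<lambda>h. h \<bullet> gf z)"
      by (simp add: gf_def inner_diff_right inner_complex_def[of _ "\<i>"] mult_ac)
    then show ?thesis
      using has_derivative_mult[OF dK dI] unfolding f_def[abs_def] by simp
  qed
  have cK: "continuous_on H2 K" by (rule GDERIV_imp_continuous_on[OF K])
  have cf: "continuous_on H2 f" unfolding f_def using Im0 by (intro continuous_intros cK) auto
  have cgf: "continuous_on H2 gf" unfolding gf_def using Im0 by (intro continuous_intros cK gK) auto
  \<comment> \<open>\<open>l s\<close> scales the real part only. Writing the primitive from 0 to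
    \<open>Re z\<close> as \<open>Re z\<close> times an integral over the fixed interval from 0 to 1
    makes the Leibniz rule applicable in both variables.\<close>
  define l where "l s z = Complex (s * Re z) (Im z)" for s z
  have lH: "l s z \<in> H2" if "z \<in> H2" for s z using that by (simp add: H2_def l_def)
  have cl: "continuous_on T (\<lambda>p. l (snd p) (fst p))" for T unfolding l_def by (intro continuous_intros)
  have cfl: "continuous_on (H2 \<times> cbox 0 1) (\<lambda>p. f (l (snd p) (fst p)))"
    by (rule continuous_on_compose2[OF cf cl]) (auto intro: lH)
  have cgl: "continuous_on (H2 \<times> cbox 0 1) (\<lambda>p. l (snd p) (gf (l (snd p) (fst p))))"
  proof -
    have "continuous_on (H2 \<times> cbox 0 1) (\<lambda>p. gf (l (snd p) (fst p)))"
      by (rule continuous_on_compose2[OF cgf cl]) (auto intro: lH)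
    then show ?thesis unfolding l_def[of _ "gf _"] by (intro continuous_intros)
  qed
  define J where "J z = integral (cbox 0 1) (\<lambda>s. f (l s z))" for z
  define gJ where "gJ z = integral (cbox 0 1) (\<lambda>s. l s (gf (l s z)))" for z
  have slice: "continuous_on (cbox 0 1) (h z)" if "continuous_on (H2 \<times> cbox 0 1) (\<lambda>p. h (fst p) (snd p))" "z \<in> H2"
    for h :: "complex \<Rightarrow> real \<Rightarrow> 'b::topological_space" and z
  proof -
    have "continuous_on (cbox 0 1) (\<lambda>s. (z, s))" by (intro continuous_intros)
    from continuous_on_compose2[OF that(1) this] that(2) show ?thesis by auto
  qed
  have dJ: "(J has_derivative (\<lambda>h. h \<bullet> gJ z)) (at z)" if z: "z \<in> H2" for z
  proof -
    have "((\<lambda>z. integral (cbox 0 1) (\<lambda>s. f (l s z))) has_derivative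
        integral (cbox 0 1) (\<lambda>s. blinfun_inner_left (l s (gf (l s z))))) (at z within H2)"
    proof (rule leibniz_rule[OF _ _ _ z convex_H2])
      fix z s assume z: "z \<in> H2"
      have dl: "(l s has_derivative l s) (at z within H2)"
      proof (rule bounded_linear_imp_has_derivative)
        have "l s = (\<lambda>z. (s * Re z) *\<^sub>R 1 + Im z *\<^sub>R \<i>)" by (auto simp: l_def complex_eq_iff)
        moreover have "bounded_linear (\<lambda>z. (s * Re z) *\<^sub>R 1 + Im z *\<^sub>R \<i>)"
          by (intro bounded_linear_add bounded_linear_scaleR_left[THEN bounded_linear_compose]
              bounded_linear_mult_right[THEN bounded_linear_compose] bounded_linear_Re bounded_linear_Im)
        ultimately show "bounded_linear (l s)" by simp
      qed
      have "((\<lambda>z. f (l s z)) has_derivative (\<lambda>h. l s h \<bullet> gf (l s z))) (at z within H2)"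
        by (rule has_derivative_compose[OF dl df[OF lH[OF z]]])
      \<comment> \<open>\<open>l s\<close> is a symmetric linear map, so it can be moved to the
        gradient.\<close>
      moreover have "(\<lambda>h. l s h \<bullet> gf (l s z)) = blinfun_apply (blinfun_inner_left (l s (gf (l s z))))"
        by (auto simp: l_def inner_complex_def)
      ultimately show "((\<lambda>z. f (l s z)) has_derivative blinfun_apply (blinfun_inner_left (l s (gf (l s z))))) (at z within H2)"
        by simp
    next
      show "(\<lambda>s. f (l s z)) integrable_on cbox 0 1" if "z \<in> H2" for z
        by (rule integrable_continuous, rule slice[OF cfl that])
      show "continuous_on (H2 \<times> cbox 0 1) (\<lambda>(z, s). blinfun_inner_left (l s (gf (l s z))))"
        unfolding case_prod_unfold
        by (rule bounded_linear.continuous_on[OF bounded_linear_blinfun_inner_left cgl])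
    qed
    moreover have "integral (cbox 0 1) (\<lambda>s. blinfun_inner_left (l s (gf (l s z)))) = blinfun_inner_left (gJ z)"
      unfolding gJ_def
      using integral_linear[OF integrable_continuous[OF slice[OF cgl z]] bounded_linear_blinfun_inner_left]
      by (simp only: o_def)
    ultimately show ?thesis
      using at_within_open[OF z open_H2] unfolding J_def[abs_def] by simp
  qed
  define B where "B z = Re z * J z" for z
  define gB where "gB z = J z *\<^sub>R 1 + Re z *\<^sub>R gJ z" for z
  have "GDERIV B z :> gB z" if z: "z \<in> H2" for z
    unfolding gderiv_def B_def gB_def
    using has_derivative_mult[OF bounded_linear_imp_has_derivative[OF bounded_linear_Re] dJ[OF z]]
    by (simp add: inner_add_right inner_complex_def algebra_simps)
  moreover have "continuous_on H2 gB"
  proof -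
    have "continuous_on H2 gJ" unfolding gJ_def
      by (rule integral_continuous_on_param) (use cgl in \<open>simp add: case_prod_unfold\<close>)
    moreover have "continuous_on H2 J" unfolding J_def
      by (rule integral_continuous_on_param) (use cfl in \<open>simp add: case_prod_unfold\<close>)
    ultimately show ?thesis unfolding gB_def by (intro continuous_intros)
  qed
  moreover have "Re (gB z) = K z / (Im z)\<^sup>2" if z: "z \<in> H2" for z
  proof -
    \<comment> \<open>\<open>Re (gB z)\<close> is the integral over \<open>s\<close> of
      \<open>f (l s z) + Re z * Re (l s (gf (l s z)))\<close>, which is the derivative of
      \<open>s * f (l s z)\<close>; hence its value is \<open>f z\<close>.\<close>
    have d: "((\<lambda>s. s * f (l s z)) has_vector_derivative
        f (l s z) + Re z * Re (l s (gf (l s z)))) (at s within {0..1})" for s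
    proof -
      have "((\<lambda>s. l s z) has_vector_derivative Complex (Re z) 0) (at s within {0..1})"
        unfolding l_def by (rule has_vector_derivative_Complex) (auto intro!: derivative_eq_intros)
      from GDERIV_chain_curve[OF _ this, of f "gf (l s z)"] df[OF lH[OF z]]
      have "((\<lambda>s. f (l s z)) has_real_derivative Complex (Re z) 0 \<bullet> gf (l s z)) (at s within {0..1})"
        by (simp add: gderiv_def)
      from DERIV_mult[OF DERIV_ident this] show ?thesis
        unfolding has_real_derivative_iff_has_vector_derivative
        by (simp add: inner_complex_def l_def algebra_simps)
    qed
    have "((\<lambda>s. f (l s z) + Re z * Re (l s (gf (l s z)))) has_integral 1 * f (l 1 z) - 0 * f (l 0 z)) {0..1}"
      by (rule fundamental_theorem_of_calculus[OF _ d]) simp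
    then have 1: "integral {0..1} (\<lambda>s. f (l s z) + Re z * Re (l s (gf (l s z)))) = f z"
      by (simp add: integral_unique l_def)
    have i1: "(\<lambda>s. f (l s z)) integrable_on {0..1}"
      using integrable_continuous[OF slice[OF cfl z]] by simp
    have i2: "(\<lambda>s. l s (gf (l s z))) integrable_on {0..1}"
      using integrable_continuous[OF slice[OF cgl z]] by simp
    have i3: "(\<lambda>s. Re (l s (gf (l s z)))) integrable_on {0..1}"
      using integrable_linear[OF i2 bounded_linear_Re] by (simp add: o_def)
    have re: "integral {0..1} (\<lambda>s. Re (l s (gf (l s z)))) = Re (integral {0..1} (\<lambda>s. l s (gf (l s z))))"
      using integral_linear[OF i2 bounded_linear_Re] by (simp add: o_def)
    have i4: "(\<lambda>s. Re z * Re (l s (gf (l s z)))) integrable_on {0..1}"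
      using integrable_cmul[OF i3, of "Re z"] by simp
    have m: "integral {0..1} (\<lambda>s. Re z * Re (l s (gf (l s z)))) = Re z * Re (integral {0..1} (\<lambda>s. l s (gf (l s z))))"
      using integral_cmul[of "{0..1}" "Re z" "\<lambda>s. Re (l s (gf (l s z)))"] re by simp
    have "f z = integral {0..1} (\<lambda>s. f (l s z)) + integral {0..1} (\<lambda>s. Re z * Re (l s (gf (l s z))))"
      using 1 integral_add[OF i1 i4] by simp
    then have "f z = J z + Re z * Re (gJ z)" unfolding m by (simp add: J_def gJ_def)
    then show ?thesis by (simp add: gB_def f_def)
  qed
  ultimately show ?thesis by blast
qed

text \<open>The standard area form, equal to 1 on the pair \<open>1\<close>,
  \<open>\<i>\<close>.\<close>

definition cross :: "complex \<Rightarrow> complex \<Rightarrow> real" where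
  "cross v w = Re v * Im w - Im v * Re w"

text \<open>The line integral of \<open>B d(Im z)\<close> along \<open>V\<close>. The velocity is a
  separate argument, tied to \<open>V\<close> by \<open>closed_curve\<close>.\<close>

definition loop_integral :: "(complex \<Rightarrow> real) \<Rightarrow> (real \<Rightarrow> complex) \<Rightarrow> (real \<Rightarrow> complex) \<Rightarrow> real" where
  "loop_integral B V V' = integral period (\<lambda>t. B (V t) * Im (V' t))"

definition closed_curve :: "(real \<Rightarrow> complex) \<Rightarrow> (real \<Rightarrow> complex) \<Rightarrow> bool" where
  "closed_curve V V' \<longleftrightarrow> (\<forall>t\<in>period. (V has_vector_derivative V' t) (at t within period) \<and> V t \<in> H2)
     \<and> continuous_on period V' \<and> V 0 = V (2 * pi)"

lemma closed_curve_continuous_on: "closed_curve V V' \<Longrightarrow> continuous_on period V"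
  unfolding closed_curve_def
  by (meson continuous_on_eq_continuous_within has_vector_derivative_continuous)

lemma loop_integral_integrable:
  assumes "\<And>z. z \<in> H2 \<Longrightarrow> GDERIV B z :> gB z" "closed_curve V V'"
  shows "continuous_on period (\<lambda>t. B (V t) * Im (V' t))"
proof -
  have "continuous_on period (\<lambda>t. B (V t))"
    by (rule continuous_on_compose2[OF GDERIV_imp_continuous_on[OF assms(1)] closed_curve_continuous_on[OF assms(2)]])
      (use assms(2) in \<open>auto simp: closed_curve_def\<close>)
  then show ?thesis using assms(2) unfolding closed_curve_def by (intro continuous_intros) auto
qed

text \<open>After integration by parts only \<open>Re \<circ> gB\<close> enters the first variation.\<close>

lemma loop_integral_first_variation:
  assumes B: "\<And>z. z \<in> H2 \<Longrightarrow> GDERIV B z :> gB z" and gB: "continuous_on H2 gB"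
    and U: "closed_curve U U'" and \<eta>: "\<eta> > 0" and c: "0 \<le> c"
  shows "\<exists>\<delta>>0. \<forall>r V V'. 0 \<le> r \<and> r < \<delta> \<longrightarrow> closed_curve V V' \<longrightarrow>
     (\<forall>t\<in>period. norm (V t - U t) \<le> c * r \<and> norm (V' t - U' t) \<le> c * r) \<longrightarrow>
     \<bar>loop_integral B V V' - loop_integral B U U'
        - integral period (\<lambda>t. Re (gB (U t)) * cross (V t - U t) (U' t))\<bar> \<le> \<eta> * r"
proof -
  let ?C = "U ` period"
  have cU: "continuous_on period U" by (rule closed_curve_continuous_on[OF U])
  have cU': "continuous_on period U'" using U by (simp add: closed_curve_def)
  have UH: "U t \<in> H2" if "t \<in> period" for t using U that by (simp add: closed_curve_def)
  have C: "compact ?C" "?C \<subseteq> H2" using UH by (auto intro!: compact_continuous_image cU)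
  have cgU: "continuous_on period (\<lambda>t. gB (U t))"
    by (rule continuous_on_compose2[OF gB cU]) (use UH in auto)
  obtain m where m: "\<And>t. t \<in> period \<Longrightarrow> norm (U' t) \<le> m"
    using compact_imp_bounded[OF compact_continuous_image[OF cU' compact_Icc]] unfolding bounded_iff by blast
  obtain b where b: "\<And>t. t \<in> period \<Longrightarrow> norm (gB (U t)) \<le> b"
    using compact_imp_bounded[OF compact_continuous_image[OF cgU compact_Icc]] unfolding bounded_iff by blast
  have m0: "0 \<le> m" by (rule order_trans[OF norm_ge_zero m[OF period_0]])
  have b0: "0 \<le> b" by (rule order_trans[OF norm_ge_zero b[OF period_0]])
  \<comment> \<open>\<open>\<eta>1\<close> makes the part of the error that is linear in
    \<open>r\<close> at most \<open>\<eta> / 2 * r\<close>. The quadratic part is at most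
    \<open>2 * pi * e * r\<^sup>2\<close> and is absorbed by \<open>r < \<delta>\<close>; the
    minimum with 1 lets \<open>e\<close> be chosen independently of \<open>\<eta>1\<close>.\<close>
  define \<eta>1 where "\<eta>1 = min 1 (\<eta> / (4 * pi * (c * m + 1)))"
  have cm: "0 < c * m + 1" using c m0 by (simp add: add_nonneg_pos)
  have \<eta>1: "0 < \<eta>1" "\<eta>1 \<le> 1" "\<eta>1 * (c * m) \<le> \<eta> / (4 * pi)"
  proof -
    show "0 < \<eta>1" "\<eta>1 \<le> 1" using \<eta> cm unfolding \<eta>1_def by simp_all
    have "\<eta>1 * (c * m) \<le> \<eta> / (4 * pi * (c * m + 1)) * (c * m + 1)"
      using c m0 \<eta> cm by (intro mult_mono) (auto simp: \<eta>1_def)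
    then show "\<eta>1 * (c * m) \<le> \<eta> / (4 * pi)" using cm by simp
  qed
  obtain d where d: "d > 0" "\<And>x y. x \<in> ?C \<Longrightarrow> dist y x < d \<Longrightarrow> \<bar>B y - B x - (y - x) \<bullet> gB x\<bar> \<le> \<eta>1 * norm (y - x)"
    using C1_uniform_linearization[OF B gB open_H2 C \<eta>1(1)] by blast
  define e where "e = (1 + b) * c\<^sup>2 + 1"
  have e: "0 < e" using b0 unfolding e_def by (simp add: add_nonneg_pos)
  define \<delta> where "\<delta> = min (d / (c + 1)) (\<eta> / (4 * pi * e))"
  show ?thesis
  proof (intro exI conjI allI impI)
    show "\<delta> > 0" using d(1) c \<eta> e by (simp add: \<delta>_def)
    fix r V V' assume r: "0 \<le> r \<and> r < \<delta>" and V: "closed_curve V V'"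
      and near: "\<forall>t\<in>period. norm (V t - U t) \<le> c * r \<and> norm (V' t - U' t) \<le> c * r"
    define H H' where "H t = V t - U t" and "H' t = V' t - U' t" for t
    have H: "norm (H t) \<le> c * r" "norm (H' t) \<le> c * r" if "t \<in> period" for t
      using near that by (auto simp: H_def H'_def)
    have cr: "0 \<le> c * r" using c r by simp
    have cV: "continuous_on period V" by (rule closed_curve_continuous_on[OF V])
    have cV': "continuous_on period V'" using V by (simp add: closed_curve_def)
    have cB: "continuous_on period (\<lambda>t. B (W t))" if "closed_curve W W'" for W W'
      by (rule continuous_on_compose2[OF GDERIV_imp_continuous_on[OF B] closed_curve_continuous_on[OF that]])
        (use that in \<open>auto simp: closed_curve_def\<close>)
    note cont = cU cU' cV cV' cgU cB[OF U] cB[OF V]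
    define \<Delta> where "\<Delta> t = (B (V t) - B (U t) - H t \<bullet> gB (U t)) * Im (U' t)
        + (B (V t) - B (U t)) * Im (H' t)" for t
    \<comment> \<open>\<open>P\<close> is the derivative of \<open>B (U t) * Im (H t)\<close> and
      integrates to 0 along closed curves. The linear part
      \<open>(H t \<bullet> gB (U t)) * Im (U' t) + B (U t) * Im (H' t)\<close> of the increment is
      \<open>P t\<close> plus the claimed integrand, and \<open>\<Delta>\<close> is the
      remainder.\<close>
    define P where "P t = (U' t \<bullet> gB (U t)) * Im (H t) + B (U t) * Im (H' t)" for t
    have cP: "continuous_on period P" unfolding P_def H_def H'_def by (intro continuous_intros cont)
    have cv: "continuous_on period (\<lambda>t. Re (gB (U t)) * cross (V t - U t) (U' t))"
      unfolding cross_def by (intro continuous_intros cont)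
    have "(P has_integral B (U (2 * pi)) * Im (H (2 * pi)) - B (U 0) * Im (H 0)) period"
    proof (rule fundamental_theorem_of_calculus)
      fix t :: real assume t: "t \<in> period"
      have dU: "(U has_vector_derivative U' t) (at t within period)"
        and dV: "(V has_vector_derivative V' t) (at t within period)"
        using U V t by (auto simp: closed_curve_def)
      have 1: "((\<lambda>t. B (U t)) has_real_derivative U' t \<bullet> gB (U t)) (at t within period)"
        by (rule GDERIV_chain_curve[OF B[OF UH[OF t]] dU])
      have 2: "((\<lambda>t. Im (H t)) has_real_derivative Im (H' t)) (at t within period)"
        unfolding H_def H'_def by (rule has_real_derivative_Im[OF has_vector_derivative_diff[OF dV dU]])
      show "((\<lambda>t. B (U t) * Im (H t)) has_vector_derivative P t) (at t within period)"
        using DERIV_mult[OF 1 2] unfolding has_real_derivative_iff_has_vector_derivative P_def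
        by (simp add: mult.commute add.commute)
    qed simp
    moreover have "U (2 * pi) = U 0" "H (2 * pi) = H 0" using U V by (simp_all add: closed_curve_def H_def)
    ultimately have P0: "integral period P = 0" by (simp add: integral_unique)
    have "\<Delta> t = (B (V t) * Im (V' t) - B (U t) * Im (U' t)
        - Re (gB (U t)) * cross (V t - U t) (U' t)) - P t" for t
      by (simp add: \<Delta>_def P_def H_def H'_def cross_def inner_complex_def algebra_simps)
    then have \<Delta>_eq: "\<Delta> = (\<lambda>t. B (V t) * Im (V' t) - B (U t) * Im (U' t)
        - Re (gB (U t)) * cross (V t - U t) (U' t) - P t)" by (rule ext)
    have i1: "(\<lambda>t. B (V t) * Im (V' t)) integrable_on period"
      by (rule integrable_continuous_interval[OF loop_integral_integrable[OF B V]])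
    have i2: "(\<lambda>t. B (U t) * Im (U' t)) integrable_on period"
      by (rule integrable_continuous_interval[OF loop_integral_integrable[OF B U]])
    note i3 = integrable_continuous_interval[OF cv] and i4 = integrable_continuous_interval[OF cP]
    note i12 = integrable_diff[OF i1 i2]
    have "integral period \<Delta> = loop_integral B V V' - loop_integral B U U'
        - integral period (\<lambda>t. Re (gB (U t)) * cross (V t - U t) (U' t)) - integral period P"
      unfolding loop_integral_def \<Delta>_eq integral_diff[OF integrable_diff[OF i12 i3] i4]
        integral_diff[OF i12 i3] integral_diff[OF i1 i2] ..
    then have eq: "loop_integral B V V' - loop_integral B U U'
        - integral period (\<lambda>t. Re (gB (U t)) * cross (V t - U t) (U' t)) = integral period \<Delta>"
      using P0 by simp
    have "norm (integral {0..2 * pi} \<Delta>) \<le> (\<eta>1 * (c * r) * m + (\<eta>1 * (c * r) + c * r * b) * (c * r)) * (2 * pi)"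
    proof (rule norm_integral_period_le[OF _ _ period_top])
      show "continuous_on period \<Delta>" unfolding \<Delta>_def H_def H'_def by (intro continuous_intros cont)
      fix t :: real assume t: "t \<in> period"
      have "c * r \<le> (c + 1) * r" using r by (intro mult_right_mono) auto
      also have "\<dots> < d" using r c by (simp add: \<delta>_def pos_less_divide_eq mult.commute)
      finally have "c * r < d" .
      then have "dist (V t) (U t) < d" using H(1)[OF t] by (simp add: dist_norm H_def)
      from d(2)[OF imageI[OF t] this]
      have a1: "\<bar>B (V t) - B (U t) - H t \<bullet> gB (U t)\<bar> \<le> \<eta>1 * norm (H t)" by (simp add: H_def)
      have a2: "\<bar>B (V t) - B (U t) - H t \<bullet> gB (U t)\<bar> \<le> \<eta>1 * (c * r)"
        using a1 mult_left_mono[OF H(1)[OF t], of \<eta>1] \<eta>1(1) by linarith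
      have "\<bar>H t \<bullet> gB (U t)\<bar> \<le> norm (H t) * norm (gB (U t))" by (rule Cauchy_Schwarz_ineq2)
      also have "\<dots> \<le> c * r * b" by (intro mult_mono H t b cr) auto
      finally have a3: "\<bar>B (V t) - B (U t)\<bar> \<le> \<eta>1 * (c * r) + c * r * b" using a2 by linarith
      have "\<bar>Im (U' t)\<bar> \<le> m" "\<bar>Im (H' t)\<bar> \<le> c * r"
        using abs_Im_le_cmod[of "U' t"] abs_Im_le_cmod[of "H' t"] m[OF t] H(2)[OF t] by linarith+
      then have "\<bar>(B (V t) - B (U t) - H t \<bullet> gB (U t)) * Im (U' t)\<bar> \<le> \<eta>1 * (c * r) * m"
        "\<bar>(B (V t) - B (U t)) * Im (H' t)\<bar> \<le> (\<eta>1 * (c * r) + c * r * b) * (c * r)"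
        unfolding abs_mult using a2 a3 by (intro mult_mono; linarith)+
      then show "norm (\<Delta> t) \<le> \<eta>1 * (c * r) * m + (\<eta>1 * (c * r) + c * r * b) * (c * r)"
        unfolding \<Delta>_def real_norm_def by linarith
    qed
    also have "\<dots> = (2 * pi) * (\<eta>1 * (c * m)) * r + (2 * pi) * ((\<eta>1 + b) * c\<^sup>2 * r) * r"
      by (simp add: algebra_simps power2_eq_square)
    also have "\<dots> \<le> \<eta> / 2 * r + \<eta> / 2 * r"
    proof (intro add_mono mult_right_mono)
      have "(2 * pi) * (\<eta>1 * (c * m)) \<le> (2 * pi) * (\<eta> / (4 * pi))" by (rule mult_left_mono[OF \<eta>1(3)]) simp
      then show "(2 * pi) * (\<eta>1 * (c * m)) \<le> \<eta> / 2" by simp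
      have "(\<eta>1 + b) * c\<^sup>2 \<le> e" unfolding e_def
        using mult_right_mono[of "\<eta>1 + b" "1 + b" "c\<^sup>2"] \<eta>1(2) by simp
      then have "(\<eta>1 + b) * c\<^sup>2 * r \<le> e * (\<eta> / (4 * pi * e))"
        using r e \<eta> by (intro mult_mono) (auto simp: \<delta>_def)
      also have "\<dots> = \<eta> / (4 * pi)" using e by simp
      finally have "(2 * pi) * ((\<eta>1 + b) * c\<^sup>2 * r) \<le> (2 * pi) * (\<eta> / (4 * pi))" by (rule mult_left_mono) simp
      then show "(2 * pi) * ((\<eta>1 + b) * c\<^sup>2 * r) \<le> \<eta> / 2" by simp
    qed (use r in auto)
    finally show "\<bar>loop_integral B V V' - loop_integral B U U'
        - integral period (\<lambda>t. Re (gB (U t)) * cross (V t - U t) (U' t))\<bar> \<le> \<eta> * r"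
      unfolding eq by simp
  qed
qed

subsection \<open>Green's formula for hyperbolic disks\<close>

lemma less_iff_square_less: "0 \<le> a \<Longrightarrow> 0 \<le> b \<Longrightarrow> a < b \<longleftrightarrow> a\<^sup>2 < (b::real)\<^sup>2"
  by (meson power2_less_imp_less power_strict_mono zero_less_numeral)

text \<open>\<open>cosh\<close> is increasing, and in terms of the \<open>cosh\<close> of the
  distance the condition is a quadratic inequality, in which \<open>cosh (rho k) = k * R k\<close>
  becomes the height of the centre for \<open>Im z = 1\<close>. The ball lies above the real axis
  because \<open>k * R k > R k\<close>, so the restriction to \<open>H2\<close> cuts nothing
  off.\<close>

lemma hyp_disk_eq_ball:
  assumes k: "k > 1" and z: "z \<in> H2"
  shows "hyp_disk (rho k) z = ball (Complex (Re z) (Im z * (k * R k))) (Im z * R k)"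
proof (rule set_eqI)
  fix w
  define a q where "a = Im z" and "q = k * R k"
  have a: "a > 0" using z by (simp add: a_def H2_def)
  note R = R_identities[OF k]
  have q2: "q\<^sup>2 = 1 + (R k)\<^sup>2" using R(3) by (simp add: q_def power_mult_distrib algebra_simps)
  have qR: "q > R k" using mult_strict_right_mono[OF k R(1)] by (simp add: q_def)
  have rho: "rho k > 0" using R(1) unfolding R_def by simp
  have ball: "w \<in> ball (Complex (Re z) (a * q)) (a * R k) \<longleftrightarrow>
      (Re w - Re z)\<^sup>2 + (Im w - a * q)\<^sup>2 < (a * R k)\<^sup>2"
  proof -
    have "dist (Complex (Re z) (a * q)) w < a * R k \<longleftrightarrow> (dist (Complex (Re z) (a * q)) w)\<^sup>2 < (a * R k)\<^sup>2"
      by (rule less_iff_square_less) (use a R(1) in auto)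
    then show ?thesis by (simp add: dist_norm cmod_power2 power2_commute)
  qed
  show "w \<in> hyp_disk (rho k) z \<longleftrightarrow> w \<in> ball (Complex (Re z) (Im z * (k * R k))) (Im z * R k)"
  proof (cases "Im w > 0")
    case True
    define X where "X = (dist z w)\<^sup>2 / (2 * a * Im w)"
    have X: "X \<ge> 0" using a True by (simp add: X_def)
    have "arcosh (1 + X) < rho k \<longleftrightarrow> cosh (arcosh (1 + X)) < cosh (rho k)"
      using X rho by (subst cosh_real_nonneg_less_iff) auto
    also have "\<dots> \<longleftrightarrow> X < q - 1" using X R(2) by (auto simp: q_def)
    also have "\<dots> \<longleftrightarrow> (dist z w)\<^sup>2 < (q - 1) * (2 * a * Im w)"
      using a True by (simp add: X_def pos_divide_less_eq)
    also have "\<dots> \<longleftrightarrow> (Re w - Re z)\<^sup>2 + (Im w - a * q)\<^sup>2 < (a * R k)\<^sup>2"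
    proof -
      have "(dist z w)\<^sup>2 - (q - 1) * (2 * a * Im w) = (Re w - Re z)\<^sup>2 + (Im w)\<^sup>2 - 2 * a * Im w * q + a\<^sup>2"
        by (simp add: dist_norm cmod_power2 a_def[symmetric]) (simp add: power2_eq_square algebra_simps)
      also have "\<dots> = (Re w - Re z)\<^sup>2 + (Im w - a * q)\<^sup>2 - (a * R k)\<^sup>2"
      proof -
        have "(Im w - a * q)\<^sup>2 - (a * R k)\<^sup>2 = (Im w)\<^sup>2 - 2 * a * Im w * q + a\<^sup>2 * (q\<^sup>2 - (R k)\<^sup>2)"
          by (simp add: power2_eq_square algebra_simps)
        then show ?thesis unfolding q2 by simp
      qed
      finally show ?thesis by linarith
    qed
    finally show ?thesis using True unfolding ball[unfolded a_def q_def]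
      by (simp add: hyp_disk_def H2_def hyp_dist_def X_def a_def q_def)
  next
    case False
    have "\<not> (Re w - Re z)\<^sup>2 + (Im w - a * q)\<^sup>2 < (a * R k)\<^sup>2"
    proof
      assume "(Re w - Re z)\<^sup>2 + (Im w - a * q)\<^sup>2 < (a * R k)\<^sup>2"
      then have "(a * q - Im w)\<^sup>2 < (a * R k)\<^sup>2"
        using zero_le_power2[of "Re w - Re z"] power2_commute[of "Im w" "a * q"] by linarith
      then have "a * q - Im w < a * R k" by (rule power_less_imp_less_base) (use a R(1) in simp)
      moreover have "a * R k < a * q" using a qR by simp
      ultimately show False using False by simp
    qed
    then show ?thesis using False unfolding ball[unfolded a_def q_def]
      by (simp add: hyp_disk_def H2_def a_def q_def)
  qed
qed

text \<open>Lebesgue measure is determined by its values on boxes. As a push-forward from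
  \<open>real \<times> real\<close> it admits Fubini's theorem.\<close>

lemma lborel_complex: "(lborel :: complex measure) = distr lborel borel (\<lambda>p. Complex (fst p) (snd p))"
proof (rule lborel_eqI)
  have meas: "(\<lambda>p. Complex (fst p) (snd p)) \<in> measurable (lborel :: (real \<times> real) measure) borel"
    using borel_measurable_continuous_onI[of "\<lambda>p::real\<times>real. Complex (fst p) (snd p)"]
    by (simp add: continuous_intros)
  fix l u :: complex assume lu: "\<And>b. b \<in> Basis \<Longrightarrow> l \<bullet> b \<le> u \<bullet> b"
  have re: "Re l \<le> Re u" "Im l \<le> Im u" using lu[of 1] lu[of "\<i>"] by (auto simp: Basis_complex_def)
  have "emeasure (distr lborel borel (\<lambda>p. Complex (fst p) (snd p))) (box l u) =
      emeasure lborel ((\<lambda>p. Complex (fst p) (snd p)) -` box l u \<inter> space (lborel :: (real \<times> real) measure))"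
    by (rule emeasure_distr[OF meas]) simp
  also have "(\<lambda>p. Complex (fst p) (snd p)) -` box l u \<inter> space (lborel :: (real \<times> real) measure)
      = box (Re l, Im l) (Re u, Im u)"
  proof -
    have "p \<in> box (Re l, Im l) (Re u, Im u) \<longleftrightarrow>
        Re l < fst p \<and> fst p < Re u \<and> Im l < snd p \<and> snd p < Im u" for p :: "real \<times> real"
      by (cases p) (auto simp: box_def Basis_prod_def)
    then show ?thesis by (auto simp: in_box_complex_iff)
  qed
  also have "emeasure lborel (box (Re l, Im l) (Re u, Im u)) = (\<Prod>b\<in>Basis. ((Re u, Im u) - (Re l, Im l)) \<bullet> b)"
    by (rule emeasure_lborel_box) (use re in \<open>auto simp: Basis_prod_def\<close>)
  also have "(\<Prod>b\<in>Basis. ((Re u, Im u) - (Re l, Im l)) \<bullet> b) = (Re u - Re l) * (Im u - Im l)"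
    by (simp add: Basis_prod_def)
  also have "\<dots> = (\<Prod>b\<in>Basis. (u - l) \<bullet> b)" by (simp add: Basis_complex_def)
  finally show "emeasure (distr lborel borel (\<lambda>p. Complex (fst p) (snd p))) (box l u) = (\<Prod>b\<in>Basis. (u - l) \<bullet> b)" .
qed simp

lemma Complex_mem_cball_iff:
  assumes "r \<ge> 0"
  shows "Complex x y \<in> cball (Complex a c) r \<longleftrightarrow> (x - a)\<^sup>2 + (y - c)\<^sup>2 \<le> r\<^sup>2"
proof -
  have "dist (Complex a c) (Complex x y) \<le> r \<longleftrightarrow> (dist (Complex a c) (Complex x y))\<^sup>2 \<le> r\<^sup>2"
    using less_iff_square_less[of r "dist (Complex a c) (Complex x y)"] assms by auto
  then show ?thesis by (simp add: dist_norm cmod_power2 power2_commute)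
qed

lemma chord_difference_continuous:
  fixes B :: "complex \<Rightarrow> real"
  assumes sub: "cball (Complex a c) r \<subseteq> S" and B: "continuous_on S B" and r: "r > 0"
  defines "s \<equiv> \<lambda>y. sqrt (r\<^sup>2 - (y - c)\<^sup>2)"
  shows "continuous_on {c - r..c + r} (\<lambda>y. B (Complex (a + s y) y) - B (Complex (a - s y) y))"
proof -
  have cs: "continuous_on T s" for T unfolding s_def by (intro continuous_intros)
  have mem: "Complex (a + s y) y \<in> S" "Complex (a - s y) y \<in> S" if y: "y \<in> {c - r..c + r}" for y
  proof -
    have "\<bar>y - c\<bar> \<le> r" using y by auto
    then have "(y - c)\<^sup>2 \<le> r\<^sup>2" using r by (simp add: abs_le_square_iff[symmetric])
    then have "(s y)\<^sup>2 + (y - c)\<^sup>2 \<le> r\<^sup>2" by (simp add: s_def)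
    then have "Complex (a + s y) y \<in> cball (Complex a c) r" "Complex (a - s y) y \<in> cball (Complex a c) r"
      using r by (simp_all only: Complex_mem_cball_iff[OF less_imp_le] add_diff_cancel_left'
          diff_diff_eq2 diff_add_cancel) simp_all
    then show "Complex (a + s y) y \<in> S" "Complex (a - s y) y \<in> S" using sub by blast+
  qed
  have "continuous_on {c - r..c + r} (\<lambda>y. B (Complex (a + s y) y))"
    by (rule continuous_on_compose2[OF B]) (intro continuous_intros cs, use mem in blast)
  moreover have "continuous_on {c - r..c + r} (\<lambda>y. B (Complex (a - s y) y))"
    by (rule continuous_on_compose2[OF B]) (intro continuous_intros cs, use mem in blast)
  ultimately show ?thesis by (rule continuous_on_diff)
qed

text \<open>Fubini over horizontal chords, each evaluated by the primitive \<open>B\<close> in the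
  real direction. Integrability comes from continuity on the closed ball, which lies in
  \<open>S\<close>.\<close>

lemma integral_ball_complex:
  fixes f B :: "complex \<Rightarrow> real"
  assumes sub: "cball (Complex a c) r \<subseteq> S" and f: "continuous_on S f" and r: "r > 0"
    and B: "continuous_on S B"
    and dB: "\<And>x y. Complex x y \<in> S \<Longrightarrow> ((\<lambda>x. B (Complex x y)) has_real_derivative f (Complex x y)) (at x)"
  defines "s \<equiv> \<lambda>y. sqrt (r\<^sup>2 - (y - c)\<^sup>2)"
  shows "(LINT w:ball (Complex a c) r|lborel. f w) =
    integral {c - r..c + r} (\<lambda>y. B (Complex (a + s y) y) - B (Complex (a - s y) y))"
proof -
  define h where "h y = B (Complex (a + s y) y) - B (Complex (a - s y) y)" for y
  have mem: "Complex x y \<in> S" if "(x - a)\<^sup>2 + (y - c)\<^sup>2 \<le> r\<^sup>2" for x y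
    using that sub r Complex_mem_cball_iff[of r x y a c] by auto
  have iff: "Complex x y \<in> ball (Complex a c) r \<longleftrightarrow> (x - a)\<^sup>2 + (y - c)\<^sup>2 < r\<^sup>2" for x y
  proof -
    have "dist (Complex a c) (Complex x y) < r \<longleftrightarrow> (dist (Complex a c) (Complex x y))\<^sup>2 < r\<^sup>2"
      by (rule less_iff_square_less) (use r in auto)
    then show ?thesis by (simp add: dist_norm cmod_power2 power2_commute)
  qed
  have yr: "(y - c)\<^sup>2 \<le> r\<^sup>2 \<longleftrightarrow> y \<in> {c - r..c + r}" for y
    using r by (auto simp: abs_le_square_iff[symmetric])
  define g where "g w = indicator (ball (Complex a c) r) w *\<^sub>R f w" for w
  have "set_integrable lborel (cball (Complex a c) r) f"
    unfolding set_integrable_def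
    by (rule borel_integrable_compact) (use sub f in \<open>auto intro: continuous_on_subset\<close>)
  then have "set_integrable lborel (ball (Complex a c) r) f"
    by (rule set_integrable_subset) auto
  then have gint: "integrable lborel g" unfolding set_integrable_def g_def .
  have meas: "(\<lambda>p. Complex (fst p) (snd p)) \<in> measurable (lborel :: (real \<times> real) measure) borel"
    using borel_measurable_continuous_onI[of "\<lambda>p::real\<times>real. Complex (fst p) (snd p)"]
    by (simp add: continuous_intros)
  have gm: "g \<in> borel_measurable borel" using borel_measurable_integrable[OF gint] by simp
  have gint2: "integrable (lborel \<Otimes>\<^sub>M lborel) (\<lambda>(x, y). g (Complex x y))"
    using gint unfolding lborel_complex lborel_prod integrable_distr_eq[OF meas gm]
    by (simp add: case_prod_unfold)
  have "(LINT w:ball (Complex a c) r|lborel. f w) = integral\<^sup>L lborel g"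
    unfolding set_lebesgue_integral_def g_def ..
  also have "\<dots> = integral\<^sup>L lborel (\<lambda>p. g (Complex (fst p) (snd p)))"
    unfolding lborel_complex by (rule integral_distr[OF meas gm])
  also have "\<dots> = integral\<^sup>L (lborel \<Otimes>\<^sub>M lborel) (\<lambda>(x, y). g (Complex x y))"
    unfolding lborel_prod by (simp add: case_prod_unfold)
  also have "\<dots> = (LINT y|lborel. LINT x|lborel. g (Complex x y))"
    by (rule lborel_pair.integral_snd[OF gint2, symmetric])
  also have "\<dots> = (LINT y|lborel. indicator {c - r..c + r} y *\<^sub>R h y)"
  proof (rule arg_cong[where f = "integral\<^sup>L lborel"], rule ext)
    fix y
    show "(LINT x|lborel. g (Complex x y)) = indicator {c - r..c + r} y *\<^sub>R h y"
    proof (cases "(y - c)\<^sup>2 < r\<^sup>2")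
      case True
      then have s: "s y > 0" "(s y)\<^sup>2 = r\<^sup>2 - (y - c)\<^sup>2" by (auto simp: s_def)
      have sl: "(x - a)\<^sup>2 + (y - c)\<^sup>2 < r\<^sup>2 \<longleftrightarrow> x \<in> {a - s y<..<a + s y}" for x
      proof -
        have "(x - a)\<^sup>2 + (y - c)\<^sup>2 < r\<^sup>2 \<longleftrightarrow> \<bar>x - a\<bar>\<^sup>2 < (s y)\<^sup>2" using s(2) by auto
        also have "\<dots> \<longleftrightarrow> \<bar>x - a\<bar> < s y"
          by (rule less_iff_square_less[symmetric]) (use s(1) in auto)
        finally show ?thesis by auto
      qed
      have S: "Complex x y \<in> S" if "x \<in> {a - s y..a + s y}" for x
      proof (rule mem)
        have "\<bar>x - a\<bar> \<le> s y" using that by auto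
        then have "\<bar>x - a\<bar>\<^sup>2 \<le> (s y)\<^sup>2" by (rule power_mono) simp
        then show "(x - a)\<^sup>2 + (y - c)\<^sup>2 \<le> r\<^sup>2" using s(2) by simp
      qed
      have cf: "continuous_on {a - s y..a + s y} (\<lambda>x. f (Complex x y))"
        by (rule continuous_on_compose2[OF f]) (auto intro!: continuous_intros S)
      have "set_integrable lborel {a - s y..a + s y} (\<lambda>x. f (Complex x y))"
        unfolding set_integrable_def by (rule borel_integrable_compact[OF compact_Icc cf])
      then have si: "set_integrable lborel {a - s y<..<a + s y} (\<lambda>x. f (Complex x y))"
        by (rule set_integrable_subset) auto
      have "(LINT x|lborel. g (Complex x y)) = (LINT x:{a - s y<..<a + s y}|lborel. f (Complex x y))"
        unfolding set_lebesgue_integral_def g_def indicator_def iff sl ..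
      also have "\<dots> = integral {a - s y<..<a + s y} (\<lambda>x. f (Complex x y))"
        by (rule set_borel_integral_eq_integral(2)[OF si])
      also have "\<dots> = integral {a - s y..a + s y} (\<lambda>x. f (Complex x y))"
        by (rule integral_open_interval_real[symmetric])
      also have "\<dots> = h y" unfolding h_def
      proof (rule integral_unique, rule fundamental_theorem_of_calculus)
        show "a - s y \<le> a + s y" using s by simp
        show "((\<lambda>x. B (Complex x y)) has_vector_derivative f (Complex x y)) (at x within {a - s y..a + s y})"
          if "x \<in> {a - s y..a + s y}" for x
          using dB[OF S[OF that]] unfolding has_real_derivative_iff_has_vector_derivative
          by (rule has_vector_derivative_at_within)
      qed
      finally show ?thesis using True yr[of y] by simp
    next
      case False
      have "g (Complex x y) = 0" for x
      proof -
        have "\<not> (x - a)\<^sup>2 + (y - c)\<^sup>2 < r\<^sup>2" using False zero_le_power2[of "x - a"] by linarith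
        then have "Complex x y \<notin> ball (Complex a c) r" unfolding iff .
        then show ?thesis unfolding g_def by simp
      qed
      \<comment> \<open>At the top and the bottom of the disk the chord degenerates to a point and
        the two values of \<open>B\<close> cancel.\<close>
      moreover have "h y = 0" if "y \<in> {c - r..c + r}"
      proof -
        have "(y - c)\<^sup>2 = r\<^sup>2" using that False unfolding yr[symmetric] by simp
        then show ?thesis by (simp add: h_def s_def)
      qed
      ultimately show ?thesis by (simp add: indicator_def)
    qed
  qed
  also have "\<dots> = (LINT y:{c - r..c + r}|lborel. h y)" unfolding set_lebesgue_integral_def ..
  also have "\<dots> = integral {c - r..c + r} h"
  proof (rule set_borel_integral_eq_integral(2))
    have "continuous_on {c - r..c + r} h" unfolding h_def s_def
      by (rule chord_difference_continuous[OF sub B r])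
    then show "set_integrable lborel {c - r..c + r} h"
      unfolding set_integrable_def by (intro borel_integrable_compact compact_Icc)
  qed
  finally show ?thesis unfolding h_def .
qed

text \<open>Slicing turns the area integral into an integral over heights of \<open>B\<close> at the
  right end of the chord minus \<open>B\<close> at the left end. The substitution
  \<open>y = Y t\<close> between \<open>- pi / 2\<close> and \<open>pi / 2\<close>, where the height
  increases, parametrises the right half of the boundary; the reflection
  \<open>t \<mapsto> pi - t\<close> preserves the height and gives the left half.\<close>

lemma Green_hyp_disk:
  assumes k: "k > 1" and z: "z \<in> H2" and K: "\<And>z. z \<in> H2 \<Longrightarrow> GDERIV K z :> gK z"
    and B: "\<And>z. z \<in> H2 \<Longrightarrow> GDERIV B z :> gB z"
    and KB: "\<And>z. z \<in> H2 \<Longrightarrow> Re (gB z) = K z / (Im z)\<^sup>2"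
  shows "F K k z = loop_integral B (\<lambda>t. omega_at k z (cis t)) (\<lambda>t. Im z *\<^sub>R omega_dot k (cis t))"
proof -
  define a q r where "a = Im z" and "q = k * R k" and "r = Im z * R k"
  have a: "a > 0" using z by (simp add: a_def H2_def)
  note R = R_identities[OF k]
  have qR: "q > R k" using mult_strict_right_mono[OF k R(1)] by (simp add: q_def)
  have r: "r > 0" using a R(1) by (simp add: r_def a_def)
  have sub: "cball (Complex (Re z) (a * q)) r \<subseteq> H2"
  proof
    fix w assume "w \<in> cball (Complex (Re z) (a * q)) r"
    then have "\<bar>a * q - Im w\<bar> \<le> r"
      using abs_Im_le_cmod[of "Complex (Re z) (a * q) - w"] by (simp add: dist_norm)
    moreover have "r < a * q" using a qR by (simp add: r_def a_def)
    ultimately show "w \<in> H2" by (simp add: H2_def)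
  qed
  have cB: "continuous_on H2 B" by (rule GDERIV_imp_continuous_on[OF B])
  have cf: "continuous_on H2 (\<lambda>w. K w / (Im w)\<^sup>2)"
    by (intro continuous_intros GDERIV_imp_continuous_on[OF K]) (auto simp: H2_def)
  have dB: "((\<lambda>x. B (Complex x y)) has_real_derivative K (Complex x y) / (Im (Complex x y))\<^sup>2) (at x)"
    if "Complex x y \<in> H2" for x y
  proof -
    have "((\<lambda>x. Complex x y) has_vector_derivative Complex 1 0) (at x)"
      by (rule has_vector_derivative_Complex) (auto intro!: derivative_eq_intros)
    from GDERIV_chain_curve[where t = x and c = "\<lambda>x. Complex x y", OF B[OF that] this] show ?thesis
      using KB[OF that] by (simp add: inner_complex_def)
  qed
  define s where "s y = sqrt (r\<^sup>2 - (y - a * q)\<^sup>2)" for y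
  define h where "h y = B (Complex (Re z + s y) y) - B (Complex (Re z - s y) y)" for y
  have F1: "F K k z = integral {a * q - r..a * q + r} h"
    unfolding F_def hyp_disk_eq_ball[OF k z] h_def s_def a_def[symmetric] q_def[symmetric]
    using integral_ball_complex[OF sub cf r cB dB] by (simp add: a_def r_def)
  have D: "k - sin t > 0" for t using k sin_le_one[of t] by linarith
  define Y Y' where "Y t = a / (R k * (k - sin t))" and "Y' t = a * (cos t / (R k * (k - sin t)\<^sup>2))" for t
  define G where "G t = B (omega_at k z (cis t)) * Y' t" for t
  have U: "omega_at k z (cis t) = Complex (Re z + a * cos t / (k - sin t)) (Y t)" for t
    by (simp add: omega_at_def omega_eq complex_eq_iff Y_def a_def)
  have UH: "omega_at k z (cis t) \<in> H2" for t by (rule omega_at_in_H2[OF k z]) simp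
  have dY: "(Y has_real_derivative Y' t) (at t within T)" for t T
    unfolding Y_def Y'_def using D[of t] R(1)
    by (auto intro!: derivative_eq_intros simp: power2_eq_square)
  have cU: "continuous_on UNIV (\<lambda>t. omega_at k z (cis t))"
  proof -
    have "k - sin t \<noteq> 0" "R k \<noteq> 0" for t using D[of t] R(1) by simp_all
    then show ?thesis unfolding U Y_def by (intro continuous_intros) auto
  qed
  have cG: "continuous_on UNIV G"
  proof -
    have "k - sin t \<noteq> 0" "R k \<noteq> 0" for t using D[of t] R(1) by simp_all
    then show ?thesis unfolding G_def Y'_def
      by (intro continuous_intros continuous_on_compose2[OF cB cU]) (use UH in auto)
  qed
  \<comment> \<open>The interval contains all full turns used below in its interior, so
    \<open>P\<close> has a two-sided derivative at every parameter concerned.\<close>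
  obtain P where P0: "\<And>t. t \<in> {-2*pi..4*pi} \<Longrightarrow> (P has_vector_derivative G t) (at t within {-2*pi..4*pi})"
    using antiderivative_continuous[OF continuous_on_subset[OF cG subset_UNIV, of "{-2*pi..4*pi}"]] by blast
  have P: "(P has_real_derivative G t) (at t)" if "-2*pi < t" "t < 4*pi" for t
    using P0[of t] that at_within_interior[of t "{-2*pi..4*pi}"]
    by (simp add: has_real_derivative_iff_has_vector_derivative)
  have G_per: "G (t + 2 * pi) = G t" for t
    by (simp add: G_def U Y_def Y'_def)
  \<comment> \<open>The slicing starts at the lowest point, \<open>t = - pi / 2\<close>, but
    \<open>loop_integral\<close> starts at 0. As \<open>G\<close> has period \<open>2 * pi\<close>,
    both full turns give the same integral.\<close>
  have "P (2 * pi) - P 0 = P (3 * pi / 2) - P (- pi / 2)"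
  proof -
    have "((\<lambda>t. P (t + 2 * pi) - P t) has_real_derivative 0) (at t)" if "- pi \<le> t" "t \<le> pi / 2" for t
    proof -
      have "-2*pi < t + 2*pi" "t + 2*pi < 4*pi" "-2*pi < t" "t < 4*pi" using that pi_gt_zero by linarith+
      then have 1: "(P has_real_derivative G (t + 2*pi)) (at (t + 2*pi))" and 2: "(P has_real_derivative G t) (at t)"
        by (auto intro: P)
      have 3: "((\<lambda>t. P (t + 2*pi)) has_real_derivative G (t + 2*pi)) (at t)"
        using 1 by (simp add: DERIV_shift)
      from DERIV_diff[OF 3 2] show ?thesis unfolding G_per by simp
    qed
    then have "\<exists>c. \<forall>t\<in>{-pi..pi/2}. P (t + 2 * pi) - P t = c"
      by (intro has_field_derivative_zero_constant) (auto intro: has_field_derivative_at_within)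
    then obtain c where c: "\<And>t. t \<in> {-pi..pi/2} \<Longrightarrow> P (t + 2 * pi) - P t = c" by blast
    have "P (0 + 2 * pi) - P 0 = P (- pi / 2 + 2 * pi) - P (- pi / 2)"
      using c[of 0] c[of "- pi / 2"] pi_gt_zero by simp
    moreover have "- pi / 2 + 2 * pi = 3 * pi / 2" by simp
    ultimately show ?thesis by simp
  qed
  moreover have "integral period G = P (2 * pi) - P 0"
  proof (rule integral_unique, rule fundamental_theorem_of_calculus)
    show "(P has_vector_derivative G t) (at t within period)" if "t \<in> period" for t
    proof -
      have "0 \<le> t" "t \<le> 2 * pi" using that by auto
      then have "-2*pi < t" "t < 4*pi" using pi_gt_zero by linarith+
      from P[OF this] show ?thesis unfolding has_real_derivative_iff_has_vector_derivative
        by (rule has_vector_derivative_at_within)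
    qed
  qed simp
  moreover have "F K k z = P (3 * pi / 2) - P (- pi / 2)"
  proof -
    let ?I = "{- pi / 2..pi / 2}"
    have R2: "1 / (R k)\<^sup>2 = k\<^sup>2 - 1" using R(1,3) by (simp add: field_simps)
    have ends: "Y (- pi / 2) = a * q - r" "Y (pi / 2) = a * q + r"
    proof -
      have "1 = R k * (k - 1) * (R k * (k + 1))" "1 = R k * (k + 1) * (R k * (k - 1))"
        using R(3) by (simp_all add: power2_eq_square algebra_simps)
      then have "1 / (R k * (k - 1)) = R k * (k + 1)" "1 / (R k * (k + 1)) = R k * (k - 1)"
        using R(1) k by (simp_all add: divide_eq_eq mult.commute)
      then have "a * (1 / (R k * (k - 1))) = a * (R k * (k + 1))" "a * (1 / (R k * (k + 1))) = a * (R k * (k - 1))"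
        by (simp_all only:)
      then show "Y (- pi / 2) = a * q - r" "Y (pi / 2) = a * q + r"
        by (simp_all add: Y_def q_def r_def a_def algebra_simps)
    qed
    have Yr: "Y ` ?I \<subseteq> {a * q - r..a * q + r}"
    proof (rule image_subsetI)
      fix t
      have "Y t \<le> a / (R k * (k - 1))" "a / (R k * (k + 1)) \<le> Y t"
        unfolding Y_def using a R(1) k D[of t] sin_le_one[of t] sin_ge_minus_one[of t]
        by (intro divide_left_mono mult_left_mono mult_pos_pos; linarith)+
      then show "Y t \<in> {a * q - r..a * q + r}"
        unfolding ends[symmetric] by (simp add: Y_def)
    qed
    \<comment> \<open>The half-chord at height \<open>Y t\<close> is the horizontal offset of the
      boundary point, so \<open>Re z + s (Y t)\<close> and \<open>Re z - s (Y t)\<close> belong to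
      the parameters \<open>t\<close> and \<open>pi - t\<close>. The sign of the root is fixed by
      \<open>cos t \<ge> 0\<close>.\<close>
    have sY: "s (Y t) = a * cos t / (k - sin t)" if t: "t \<in> ?I" for t
    proof -
      have c0: "cos t \<ge> 0" using t by (intro cos_ge_zero) auto
      define d where "d = k - sin t"
      have d: "d > 0" using D by (simp add: d_def)
      have "r\<^sup>2 - (Y t - a * q)\<^sup>2 = a\<^sup>2 * (R k)\<^sup>2 - (a / (R k * d) - a * (k * R k))\<^sup>2"
        by (simp add: r_def Y_def d_def q_def a_def power_mult_distrib)
      also have "\<dots> = a\<^sup>2 * ((R k)\<^sup>2 * (1 - k\<^sup>2) + 2 * k / d - (1 / (R k)\<^sup>2) / d\<^sup>2)"
        using R(1) d by (simp add: field_simps power2_eq_square)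
      also have "\<dots> = a\<^sup>2 * (2 * k / d - 1 - (k\<^sup>2 - 1) / d\<^sup>2)"
        using R(3) unfolding R2 by (simp add: algebra_simps)
      also have "2 * k / d - 1 - (k\<^sup>2 - 1) / d\<^sup>2 = (2 * k * d - d\<^sup>2 - (k\<^sup>2 - 1)) / d\<^sup>2"
        using d by (simp add: field_simps power2_eq_square)
      also have "2 * k * d - d\<^sup>2 - (k\<^sup>2 - 1) = (cos t)\<^sup>2"
        unfolding d_def cos_squared_eq by (simp add: power2_eq_square algebra_simps)
      also have "a\<^sup>2 * ((cos t)\<^sup>2 / d\<^sup>2) = (a * cos t / d)\<^sup>2" by (simp add: power_divide power_mult_distrib)
      finally show ?thesis using c0 a d by (simp add: s_def d_def)
    qed
    have ch: "continuous_on {a * q - r..a * q + r} h" unfolding h_def s_def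
      by (rule chord_difference_continuous[OF sub cB r])
    have sub1: "((\<lambda>t. Y' t *\<^sub>R h (Y t)) has_integral integral {Y (- pi / 2)..Y (pi / 2)} h) ?I"
    proof (rule has_integral_substitution[OF _ _ Yr ch dY])
      show "- pi / 2 \<le> pi / 2" using pi_gt_zero by simp
      show "Y (- pi / 2) \<le> Y (pi / 2)" unfolding ends using r by simp
    qed
    have "((\<lambda>t. G t + G (pi - t)) has_integral
        (P (pi / 2) - P (pi - pi / 2)) - (P (- pi / 2) - P (pi - - pi / 2))) ?I"
    proof (rule fundamental_theorem_of_calculus)
      fix t assume t: "t \<in> ?I"
      have "-2*pi < t" "t < 4*pi" "-2*pi < pi - t" "pi - t < 4*pi"
        using t[THEN atLeastAtMost_iff[THEN iffD1]] pi_gt_zero by linarith+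
      then have 1: "(P has_real_derivative G t) (at t)" and 2: "(P has_real_derivative G (pi - t)) (at (pi - t))"
        by (auto intro: P)
      have 3: "((\<lambda>t. pi - t) has_real_derivative -1) (at t)" by (auto intro!: derivative_eq_intros)
      have "((\<lambda>t. P t - P (pi - t)) has_real_derivative G t - G (pi - t) * -1) (at t)"
        by (rule DERIV_diff[OF 1 DERIV_chain2[where f = P and g = "\<lambda>t. pi - t" and x = t, OF 2 3]])
      then
      show "((\<lambda>t. P t - P (pi - t)) has_vector_derivative G t + G (pi - t)) (at t within ?I)"
        unfolding has_real_derivative_iff_has_vector_derivative
        by (simp add: has_vector_derivative_at_within)
    qed (use pi_gt_zero in auto)
    moreover have "Y' t *\<^sub>R h (Y t) = G t + G (pi - t)" if "t \<in> ?I" for t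
    proof -
      have "Y (pi - t) = Y t" "Y' (pi - t) = - Y' t" by (simp_all add: Y_def Y'_def)
      then show ?thesis unfolding h_def sY[OF that] G_def U by (simp add: algebra_simps)
    qed
    ultimately have "((\<lambda>t. Y' t *\<^sub>R h (Y t)) has_integral
        (P (pi / 2) - P (pi - pi / 2)) - (P (- pi / 2) - P (pi - - pi / 2))) ?I"
      by (subst has_integral_cong) auto
    from has_integral_unique[OF sub1 this]
    have "integral {a * q - r..a * q + r} h = P (pi - - pi / 2) - P (- pi / 2)"
      unfolding ends by (simp add: field_simps)
    moreover have "pi - - pi / 2 = 3 * pi / 2" by simp
    ultimately show ?thesis unfolding F1 by simp
  qed
  moreover have "loop_integral B (\<lambda>t. omega_at k z (cis t)) (\<lambda>t. Im z *\<^sub>R omega_dot k (cis t)) = integral period G"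
    unfolding loop_integral_def G_def Y'_def by (simp add: omega_dot_def a_def)
  ultimately show ?thesis by linarith
qed

subsection \<open>Variation of constants\<close>

lemma Arg2pi_circle_unique: "0 \<le> a \<Longrightarrow> a < 2 * pi \<Longrightarrow> Arg2pi (cis a) = a"
  by (rule Arg2pi_unique[of 1]) (simp_all add: cis_conv_exp)

text \<open>Turns a closed solution on the interval into a map on the circle. \<open>Arg2pi\<close>
  is discontinuous at 1, where the one-sided derivatives at the two ends of the period are glued;
  this is why \<open>f'\<close> has to match there as well.\<close>

lemma periodic_has_vector_derivative:
  fixes f f' :: "real \<Rightarrow> complex"
  assumes f: "\<And>t. t \<in> period \<Longrightarrow> (f has_vector_derivative f' t) (at t within period)"
    and per: "f 0 = f (2 * pi)" "f' 0 = f' (2 * pi)" and x: "x \<in> S1"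
  shows "((\<lambda>t. f (Arg2pi (x * cis t))) has_vector_derivative f' (Arg2pi x)) (at 0)"
proof -
  define a where "a = Arg2pi x"
  have a: "0 \<le> a" "a < 2 * pi" by (auto simp: a_def Arg2pi_ge_0 Arg2pi_lt_2pi)
  have xa: "x = cis a" unfolding a_def by (rule circle_eq_cis[OF x])
  have arg: "Arg2pi (x * cis t) = a + t" if "0 \<le> a + t" "a + t < 2 * pi" for t
    unfolding xa cis_mult using that by (rule Arg2pi_circle_unique)
  show ?thesis
  proof (cases "a = 0")
    case False
    then have a0: "0 < a" using a by simp
    have "(f has_vector_derivative f' a) (at a within period)" using f a by simp
    then have fa: "(f has_vector_derivative f' a) (at (0 + a))"
      using at_within_interior[of a period] a0 a by simp
    have "((\<lambda>t. t + a) has_vector_derivative 1) (at 0)" by (auto intro!: derivative_eq_intros)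
    from vector_diff_chain_at[OF this fa] have "((\<lambda>t. f (t + a)) has_vector_derivative f' a) (at 0)"
      by (simp add: o_def)
    then show ?thesis unfolding a_def[symmetric]
    proof (rule has_vector_derivative_transform_within_open[where S = "{- a<..<2 * pi - a}"])
      show "f (t + a) = f (Arg2pi (x * cis t))" if "t \<in> {- a<..<2 * pi - a}" for t
        using arg[of t] that by (simp add: add.commute)
    qed (use a a0 in auto)
  next
    case True
    have "(f has_vector_derivative f' 0) (at 0 within {0..<2 * pi})"
      by (rule has_vector_derivative_within_subset[OF f]) auto
    then have r: "((\<lambda>t. f (Arg2pi (x * cis t))) has_vector_derivative f' 0) (at 0 within {0..<2 * pi})"
      by (rule has_vector_derivative_transform[rotated 2]) (use True arg in auto)
    \<comment> \<open>To the left of 0 the argument jumps to the end of the period, so the left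
      derivative is that of \<open>f\<close> at \<open>2 * pi\<close>.\<close>
    have "((\<lambda>t. t + 2 * pi) has_vector_derivative 1) (at 0 within {- pi..0})"
      by (auto intro!: derivative_eq_intros)
    moreover have "(f has_vector_derivative f' (2 * pi)) (at (0 + 2 * pi) within (\<lambda>t. t + 2 * pi) ` {- pi..0})"
      by (rule has_vector_derivative_within_subset[of _ _ _ period]) (use f[of "2 * pi"] in auto)
    ultimately have "((\<lambda>t. f (t + 2 * pi)) has_vector_derivative f' 0) (at 0 within {- pi..0})"
      using vector_diff_chain_within[of "\<lambda>t. t + 2 * pi" 1 0 "{- pi..0}" f "f' (2 * pi)"] per(2) by (simp add: o_def)
    then have l: "((\<lambda>t. f (Arg2pi (x * cis t))) has_vector_derivative f' 0) (at 0 within {- pi..0})"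
    proof (rule has_vector_derivative_transform[rotated 2])
      fix t assume t: "t \<in> {- pi..0}"
      show "f (Arg2pi (x * cis t)) = f (t + 2 * pi)"
      proof (cases "t = 0")
        case True
        then show ?thesis using arg[of 0] per(1) \<open>a = 0\<close> by simp
      next
        case False
        have "x * cis t = cis (t + 2 * pi)" unfolding xa True by (simp add: complex_eq_iff)
        moreover have "Arg2pi (cis (t + 2 * pi)) = t + 2 * pi"
          by (rule Arg2pi_circle_unique) (use t False pi_gt_zero in auto)
        ultimately show ?thesis by simp
      qed
    qed simp
    have "((\<lambda>t. f (Arg2pi (x * cis t))) has_derivative (\<lambda>h. h *\<^sub>R f' 0)) (at 0 within {0..<2 * pi} \<union> {- pi..0})"
      using r l unfolding has_vector_derivative_def has_derivative_within_alt2
      by (auto simp: at_within_union eventually_sup)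
    moreover have "at (0::real) within {0..<2 * pi} \<union> {- pi..0} = at 0"
    proof (rule at_within_interior)
      have "{- pi<..<2 * pi} \<subseteq> {0..<2 * pi} \<union> {- pi..0}" by auto
      then have "{- pi<..<2 * pi} \<subseteq> interior ({0..<2 * pi} \<union> {- pi..0})"
        by (intro interior_maximal) auto
      then show "0 \<in> interior ({0..<2 * pi} \<union> {- pi..0})" using pi_gt_zero by auto
    qed
    ultimately show ?thesis unfolding has_vector_derivative_def using True by (simp add: a_def)
  qed
qed

section \<open>The equation in the coordinate \<open>v\<close> and its variational identity\<close>

lemma omega_at_linear:
  "omega_at k (v + w) x = omega_at k v x + omega_at k w x"
  "omega_at k (v - w) x = omega_at k v x - omega_at k w x"
  "omega_at k (r *\<^sub>R v) x = r *\<^sub>R omega_at k v x"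
  by (simp_all add: omega_at_def algebra_simps)

lemma omega_cis_deriv:
  assumes "k > 1"
  shows "((\<lambda>t. omega k (cis t)) has_vector_derivative omega_dot k (cis t)) (at t within T)"
proof -
  have "((\<lambda>s. omega k (cis t * cis s)) has_vector_derivative omega_dot k (cis t)) (at 0)"
    by (rule omega_circle_deriv[OF assms]) simp
  from circle_deriv_imp_line_deriv[OF this] show ?thesis by (rule has_vector_derivative_at_within)
qed

lemma omega_at_curve_deriv:
  assumes k: "k > 1" and v: "(v has_vector_derivative v') (at t within T)"
  shows "((\<lambda>t. omega_at k (v t) (cis t)) has_vector_derivative
    omega_at k v' (cis t) + Im (v t) *\<^sub>R omega_dot k (cis t)) (at t within T)"
proof -
  have "((\<lambda>t. Re (v t) *\<^sub>R 1 + Im (v t) *\<^sub>R omega k (cis t)) has_vector_derivative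
      Re v' *\<^sub>R 1 + (Im (v t) *\<^sub>R omega_dot k (cis t) + Im v' *\<^sub>R omega k (cis t))) (at t within T)"
    by (intro has_vector_derivative_add has_vector_derivative_scaleR has_real_derivative_Im[OF v]
        bounded_linear.has_vector_derivative[OF bounded_linear_scaleR_left]
        has_real_derivative_Re[OF v, unfolded has_real_derivative_iff_has_vector_derivative]
        omega_cis_deriv[OF k])
  then show ?thesis by (simp add: omega_at_def algebra_simps)
qed

text \<open>In the coordinates \<open>v\<close> given by \<open>u x = omega_at k (v x) x\<close> the equation \<open>loop_ode\<close> reads
  \<open>v' = \<epsilon> field_\<Phi>\<close>. The term \<open>field_\<sigma>\<close> multiplies the Lagrange multiplier.\<close>

definition den :: "real \<Rightarrow> (complex \<Rightarrow> real) \<Rightarrow> real \<Rightarrow> real \<Rightarrow> complex \<Rightarrow> real" where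
  "den k K \<epsilon> t v = 1 + \<epsilon> * ((R k)\<^sup>2 * (k - sin t) * K (omega_at k v (cis t)))"

definition field_\<sigma> :: "real \<Rightarrow> (complex \<Rightarrow> real) \<Rightarrow> real \<Rightarrow> real \<Rightarrow> complex \<Rightarrow> real" where
  "field_\<sigma> k K \<epsilon> t v = (Im v)\<^sup>2 / den k K \<epsilon> t v"

definition field_\<Phi> :: "real \<Rightarrow> (complex \<Rightarrow> real) \<Rightarrow> real \<Rightarrow> real \<Rightarrow> complex \<Rightarrow> complex" where
  "field_\<Phi> k K \<epsilon> t v = (- ((R k)\<^sup>2 * Im v * K (omega_at k v (cis t)) / den k K \<epsilon> t v)) *\<^sub>R (\<i> * cis t)"

text \<open>This is why \<open>field_\<Phi>\<close> points along \<open>\<i> * cis t\<close>: the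
  map \<open>h \<mapsto> omega_at k h x\<close> is linear and invertible, and it carries the
  direction \<open>\<i> * x\<close> to the tangent direction of the reference loop.\<close>

lemma omega_at_rotated:
  assumes k: "k > 1" and x: "x \<in> S1"
  shows "omega_at k (\<i> * x) x = (k - Im x) *\<^sub>R omega_dot k x"
proof -
  have R: "R k > 0" and D: "k - Im x \<noteq> 0"
    using R_identities[OF k] circle_coords[OF x] k by auto
  have c: "Re x * Re x = 1 - Im x * Im x"
    using circle_coords(1)[OF x] by (simp add: power2_eq_square)
  have "- Im x + Re x * (Re x / (k - Im x)) = (1 - k * Im x) / (k - Im x)"
    using D c by (simp add: field_simps)
  moreover have "d * (e / d\<^sup>2) = e / d" if "d \<noteq> 0" for d e :: real
    using that by (simp add: power2_eq_square)
  ultimately show ?thesis using R D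
    by (simp add: complex_eq_iff omega_at_def omega_eq omega_dot_def power2_eq_square)
qed

text \<open>By \<open>omega_at_rotated\<close> both terms are multiples of \<open>omega_dot\<close>;
  the coefficients add up to \<open>Im v / den\<close>, which is \<open>speed\<close> written in
  terms of \<open>v\<close>.\<close>

lemma field_\<Phi>_velocity:
  assumes k: "k > 1" and v: "v \<in> H2" and den: "den k K \<epsilon> t v \<noteq> 0"
  shows "omega_at k (\<epsilon> *\<^sub>R field_\<Phi> k K \<epsilon> t v) (cis t) + Im v *\<^sub>R omega_dot k (cis t)
    = speed k K \<epsilon> (cis t) (omega_at k v (cis t)) *\<^sub>R omega_dot k (cis t)"
proof -
  have D: "k - sin t > 0" using k sin_le_one[of t] by linarith
  have R: "R k > 0" using R_identities[OF k] by simp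
  define m where "m = den k K \<epsilon> t v"
  define b where "b = (R k)\<^sup>2 * (k - sin t) * K (omega_at k v (cis t))"
  have m: "m \<noteq> 0" "m = 1 + \<epsilon> * b" using den by (simp_all add: m_def den_def b_def)
  have "omega_at k (\<epsilon> *\<^sub>R field_\<Phi> k K \<epsilon> t v) (cis t) =
      (\<epsilon> * - ((R k)\<^sup>2 * Im v * K (omega_at k v (cis t)) / m)) *\<^sub>R omega_at k (\<i> * cis t) (cis t)"
    by (simp only: field_\<Phi>_def omega_at_linear(3) m_def scaleR_scaleR)
  also have "\<dots> = (- (\<epsilon> * b * Im v / m)) *\<^sub>R omega_dot k (cis t)"
    using omega_at_rotated[OF k, of "cis t"] by (simp add: b_def mult_ac)
  finally have "omega_at k (\<epsilon> *\<^sub>R field_\<Phi> k K \<epsilon> t v) (cis t) + Im v *\<^sub>R omega_dot k (cis t)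
      = (Im v - \<epsilon> * b * Im v / m) *\<^sub>R omega_dot k (cis t)"
    by (simp add: scaleR_left_diff_distrib)
  also have "Im v - \<epsilon> * b * Im v / m = Im v / m" using m by (simp add: field_simps)
  also have "Im v / m = speed k K \<epsilon> (cis t) (omega_at k v (cis t))"
    using R D by (simp add: speed_def Im_omega_at m_def den_def mult_ac)
  finally show ?thesis .
qed

text \<open>The map \<open>h \<mapsto> omega_at k h x\<close> has determinant
  \<open>1 / (R k * (k - Im x))\<close>. In view of \<open>omega_at_rotated\<close>, the second
  identity says that only the component of \<open>h\<close> along \<open>x\<close> moves the
  reference loop across itself.\<close>

lemma cross_omega_at:
  assumes k: "k > 1" and x: "x \<in> S1"
  shows "cross (omega_at k h x) (omega_at k w x) = cross h w / (R k * (k - Im x))"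
    and "cross (omega_at k h x) (omega_dot k x) = (h \<bullet> x) / (R k * (k - Im x)\<^sup>2)"
proof -
  have R: "R k > 0" and D: "k - Im x > 0"
    using R_identities[OF k] circle_coords[OF x] k by auto
  have c: "Re x * Re x = 1 - Im x * Im x"
    using circle_coords(1)[OF x] by (simp add: power2_eq_square)
  show "cross (omega_at k h x) (omega_at k w x) = cross h w / (R k * (k - Im x))"
  proof -
    define p q where "p = Re x / (k - Im x)" and "q = 1 / (R k * (k - Im x))"
    have co: "Re (omega_at k h x) = Re h + Im h * p" "Im (omega_at k h x) = Im h * q" for h
      by (simp_all add: omega_at_def omega_eq p_def q_def)
    have "cross (omega_at k h x) (omega_at k w x) = cross h w * q"
      unfolding cross_def co by (simp add: algebra_simps)
    then show ?thesis by (simp add: q_def)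
  qed
  define d where "d = k - Im x"
  have "cross (omega_at k h x) (omega_dot k x) =
     (Re h + Im h * (Re x / d)) * (Re x / (R k * d\<^sup>2)) - Im h * (1 / (R k * d)) * ((1 - k * Im x) / d\<^sup>2)"
    by (simp add: cross_def omega_at_def omega_eq omega_dot_def d_def)
  also have "\<dots> = (Re h * Re x + Im h * ((Re x * Re x - (1 - k * Im x)) / d)) / (R k * d\<^sup>2)"
    using R D by (simp add: d_def[symmetric] field_simps power2_eq_square)
  also have "Re x * Re x - (1 - k * Im x) = Im x * d" unfolding c d_def by (simp add: algebra_simps)
  finally show "cross (omega_at k h x) (omega_dot k x) = (h \<bullet> x) / (R k * (k - Im x)\<^sup>2)"
    using D by (simp add: inner_complex_def d_def)
qed

text \<open>The powers of \<open>k - Im x\<close> in the hyperbolic density and in the normal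
  displacement cancel. For constant \<open>v\<close> this is the integrand of the derivative of the
  weighted area of a disk.\<close>

lemma variation_integrand_circle:
  assumes k: "k > 1" and v: "v \<in> H2" and x: "x \<in> S1"
  shows "K / (Im (omega_at k v x))\<^sup>2 * cross (omega_at k h x) (Im v *\<^sub>R omega_dot k x) = R k * K / Im v * (h \<bullet> x)"
proof -
  have R: "R k > 0" and D: "k - Im x > 0" and e: "Im v > 0"
    using R_identities[OF k] circle_coords[OF x] k v by (auto simp: H2_def)
  have "cross a (r *\<^sub>R b) = r * cross a b" for a b r by (simp add: cross_def algebra_simps)
  then have "K / (Im (omega_at k v x))\<^sup>2 * cross (omega_at k h x) (Im v *\<^sub>R omega_dot k x) =
     K / (Im v / (R k * (k - Im x)))\<^sup>2 * (Im v * ((h \<bullet> x) / (R k * (k - Im x)\<^sup>2)))"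
    by (simp add: cross_omega_at(2)[OF k x] Im_omega_at)
  also have "\<dots> = R k * K / Im v * (h \<bullet> x)"
  proof -
    have "K / (y / (r * d))\<^sup>2 * (y * (p / (r * d\<^sup>2))) = r * K / y * p" if "y > 0" "r > 0" "d > 0" for y r d p
      using that by (simp add: field_simps power2_eq_square)
    then show ?thesis using R D e by blast
  qed
  finally show ?thesis .
qed

text \<open>The left-hand side adds the integrands of the first variations of the weighted area and
  of the \<open>B1\<close> term. All terms in \<open>cross h v'\<close> combine into the area form
  with density \<open>den / (\<epsilon> * R k * (Im v)\<^sup>2)\<close>. The part
  \<open>\<epsilon> *\<^sub>R field_\<Phi>\<close> of \<open>v'\<close> cancels the forcing in
  \<open>h \<bullet> cis t\<close>: it is the Hamiltonian field of the action. Up to a constant,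
  \<open>field_\<sigma>\<close> is the inverse of the density, so \<open>\<gamma>\<close> survives
  with a coefficient independent of \<open>t\<close> and \<open>v\<close>.\<close>

lemma variation_integrand:
  assumes k: "k > 1" and v: "v \<in> H2" and \<epsilon>: "\<epsilon> \<noteq> 0" and den: "den k K \<epsilon> t v \<noteq> 0"
    and v': "v' = \<epsilon> *\<^sub>R (field_\<Phi> k K \<epsilon> t v + field_\<sigma> k K \<epsilon> t v *\<^sub>R \<gamma>)"
  shows "K (omega_at k v (cis t)) / (Im (omega_at k v (cis t)))\<^sup>2 *
      cross (omega_at k h (cis t)) (omega_at k v' (cis t) + Im v *\<^sub>R omega_dot k (cis t))
    + 1 / (\<epsilon> * R k) * (1 / (Im v)\<^sup>2 * cross h v') = cross h \<gamma> / R k"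
proof -
  define x where "x = cis t"
  have x: "x \<in> S1" by (simp add: x_def)
  define y r d \<kappa> m where "y = Im v" and "r = R k" and "d = k - Im x" and "\<kappa> = K (omega_at k v x)" and "m = den k K \<epsilon> t v"
  have pos: "y > 0" "r > 0" "d > 0" "m \<noteq> 0"
    using R_identities[OF k] circle_coords[OF x] k v den by (auto simp: H2_def y_def r_def d_def m_def)
  have m: "m = 1 + \<epsilon> * (r\<^sup>2 * d * \<kappa>)" by (simp add: m_def den_def r_def d_def \<kappa>_def x_def)
  have lin: "cross a (b + c) = cross a b + cross a c" "cross a (s *\<^sub>R b) = s * cross a b" for a b c s
    by (simp_all add: cross_def algebra_simps)
  have hx: "cross h (\<i> * x) = h \<bullet> x" by (simp add: cross_def inner_complex_def)
  have cv: "cross h v' = \<epsilon> * (- (r\<^sup>2 * y * \<kappa> / m) * (h \<bullet> x) + y\<^sup>2 / m * cross h \<gamma>)"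
    unfolding v' lin field_\<Phi>_def field_\<sigma>_def x_def[symmetric] hx
    by (simp add: r_def y_def \<kappa>_def m_def x_def)
  have "\<kappa> / (Im (omega_at k v x))\<^sup>2 * cross (omega_at k h x) (omega_at k v' x + Im v *\<^sub>R omega_dot k x)
      + 1 / (\<epsilon> * r) * (1 / y\<^sup>2 * cross h v')
    = \<kappa> / (y / (r * d))\<^sup>2 * (cross h v' / (r * d)) + r * \<kappa> / y * (h \<bullet> x) + 1 / (\<epsilon> * r) * (1 / y\<^sup>2 * cross h v')"
    unfolding lin(1) distrib_left variation_integrand_circle[OF k v x]
    unfolding cross_omega_at(1)[OF k x] Im_omega_at by (simp add: y_def r_def d_def)
  also have "\<dots> = cross h v' * (m / (\<epsilon> * r * y\<^sup>2)) + r * \<kappa> / y * (h \<bullet> x)"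
  proof -
    have "\<kappa> / (y / (r * d))\<^sup>2 * (c / (r * d)) + 1 / (\<epsilon> * r) * (1 / y\<^sup>2 * c) = c * ((1 + \<epsilon> * (r\<^sup>2 * d * \<kappa>)) / (\<epsilon> * r * y\<^sup>2))" for c
      using pos \<epsilon> by (simp add: field_simps power2_eq_square)
    from this[of "cross h v'"] show ?thesis unfolding m by linarith
  qed
  also have "\<dots> = cross h \<gamma> / r"
  proof -
    have "\<epsilon> * (- (r\<^sup>2 * y * \<kappa> / m) * p + y\<^sup>2 / m * g) * (m / (\<epsilon> * r * y\<^sup>2)) + r * \<kappa> / y * p = g / r" for p g
      using pos \<epsilon> by (simp add: field_simps power2_eq_square)
    then show ?thesis unfolding cv .
  qed
  finally show ?thesis by (simp add: \<kappa>_def x_def y_def r_def)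
qed

section \<open>Families that are bounded and Lipschitz uniformly in time\<close>

text \<open>A class closed under products, and under inverses of functions bounded below, so that
  the estimates for the fields follow from their formulas without explicit constants. The variable
  may be the pair of \<epsilon> and \<open>v\<close>.\<close>

definition uniformly_lipschitz :: "('a::real_normed_vector) set \<Rightarrow> (real \<Rightarrow> 'a \<Rightarrow> real) \<Rightarrow> bool" where
  "uniformly_lipschitz X f \<longleftrightarrow> (\<exists>M. \<forall>t\<in>period. \<forall>p\<in>X. \<bar>f t p\<bar> \<le> M) \<and>
     (\<exists>L. \<forall>t\<in>period. \<forall>p\<in>X. \<forall>q\<in>X. \<bar>f t p - f t q\<bar> \<le> L * norm (p - q))"

lemma uniformly_lipschitzE:
  assumes "uniformly_lipschitz X f"
  obtains M where "M \<ge> 0" "\<And>t p. t \<in> period \<Longrightarrow> p \<in> X \<Longrightarrow> \<bar>f t p\<bar> \<le> M"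
    "\<And>t p q. t \<in> period \<Longrightarrow> p \<in> X \<Longrightarrow> q \<in> X \<Longrightarrow> \<bar>f t p - f t q\<bar> \<le> M * norm (p - q)"
proof -
  obtain M L where M: "\<forall>t\<in>period. \<forall>p\<in>X. \<bar>f t p\<bar> \<le> M"
    and L: "\<forall>t\<in>period. \<forall>p\<in>X. \<forall>q\<in>X. \<bar>f t p - f t q\<bar> \<le> L * norm (p - q)"
    using assms unfolding uniformly_lipschitz_def by blast
  define N where "N = max 0 (max M L)"
  have "\<bar>f t p - f t q\<bar> \<le> N * norm (p - q)" if "t \<in> period" "p \<in> X" "q \<in> X" for t p q
  proof -
    have "L * norm (p - q) \<le> N * norm (p - q)" by (rule mult_right_mono) (auto simp: N_def)
    then show ?thesis using L that by (meson order_trans)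
  qed
  moreover have "\<bar>f t p\<bar> \<le> N" if "t \<in> period" "p \<in> X" for t p
    using M that unfolding N_def by (meson max.coboundedI2 max.cobounded1 order_trans)
  ultimately show ?thesis using that[of N] by (simp add: N_def)
qed

lemma uniformly_lipschitzI:
  assumes "\<And>t p. t \<in> period \<Longrightarrow> p \<in> X \<Longrightarrow> \<bar>f t p\<bar> \<le> M"
    "\<And>t p q. t \<in> period \<Longrightarrow> p \<in> X \<Longrightarrow> q \<in> X \<Longrightarrow> \<bar>f t p - f t q\<bar> \<le> L * norm (p - q)"
  shows "uniformly_lipschitz X f"
  using assms unfolding uniformly_lipschitz_def by blast

lemma uniformly_lipschitz_mult:
  assumes "uniformly_lipschitz X f" "uniformly_lipschitz X g"
  shows "uniformly_lipschitz X (\<lambda>t p. f t p * g t p)"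
proof -
  obtain M where M: "M \<ge> 0" "\<And>t p. t \<in> period \<Longrightarrow> p \<in> X \<Longrightarrow> \<bar>f t p\<bar> \<le> M"
    "\<And>t p q. t \<in> period \<Longrightarrow> p \<in> X \<Longrightarrow> q \<in> X \<Longrightarrow> \<bar>f t p - f t q\<bar> \<le> M * norm (p - q)"
    using uniformly_lipschitzE[OF assms(1)] by metis
  obtain N where N: "N \<ge> 0" "\<And>t p. t \<in> period \<Longrightarrow> p \<in> X \<Longrightarrow> \<bar>g t p\<bar> \<le> N"
    "\<And>t p q. t \<in> period \<Longrightarrow> p \<in> X \<Longrightarrow> q \<in> X \<Longrightarrow> \<bar>g t p - g t q\<bar> \<le> N * norm (p - q)"
    using uniformly_lipschitzE[OF assms(2)] by metis
  show ?thesis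
  proof (rule uniformly_lipschitzI)
    show "\<bar>f t p * g t p\<bar> \<le> M * N" if "t \<in> period" "p \<in> X" for t p
      unfolding abs_mult by (rule mult_mono) (use M N that in auto)
    fix t p q assume *: "t \<in> period" "p \<in> X" "q \<in> X"
    have "\<bar>f t p * g t p - f t q * g t q\<bar> = \<bar>(f t p - f t q) * g t p + f t q * (g t p - g t q)\<bar>"
      by (simp add: algebra_simps)
    also have "\<dots> \<le> \<bar>f t p - f t q\<bar> * \<bar>g t p\<bar> + \<bar>f t q\<bar> * \<bar>g t p - g t q\<bar>"
      using abs_triangle_ineq by (simp add: abs_mult[symmetric])
    also have "\<dots> \<le> (M * norm (p - q)) * N + M * (N * norm (p - q))"
      using * M N by (intro add_mono mult_mono) auto
    also have "\<dots> = (2 * M * N) * norm (p - q)" by simp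
    finally show "\<bar>f t p * g t p - f t q * g t q\<bar> \<le> (2 * M * N) * norm (p - q)" .
  qed
qed

lemma uniformly_lipschitz_inverse:
  assumes f: "uniformly_lipschitz X f" and c: "0 < c" and le: "\<And>t p. t \<in> period \<Longrightarrow> p \<in> X \<Longrightarrow> c \<le> f t p"
  shows "uniformly_lipschitz X (\<lambda>t p. 1 / f t p)"
proof -
  obtain M where M: "M \<ge> 0" "\<And>t p. t \<in> period \<Longrightarrow> p \<in> X \<Longrightarrow> \<bar>f t p\<bar> \<le> M"
    "\<And>t p q. t \<in> period \<Longrightarrow> p \<in> X \<Longrightarrow> q \<in> X \<Longrightarrow> \<bar>f t p - f t q\<bar> \<le> M * norm (p - q)"
    using uniformly_lipschitzE[OF f] by metis
  show ?thesis
  proof (rule uniformly_lipschitzI)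
    show "\<bar>1 / f t p\<bar> \<le> 1 / c" if "t \<in> period" "p \<in> X" for t p
      using le[OF that] c by (simp add: frac_le)
    fix t p q assume *: "t \<in> period" "p \<in> X" "q \<in> X"
    have fp: "c \<le> f t p" and fq: "c \<le> f t q" using le * by auto
    then have pos: "f t p > 0" "f t q > 0" using c by auto
    have "1 / f t p - 1 / f t q = (f t q - f t p) / (f t p * f t q)"
      using pos by (simp add: diff_divide_distrib)
    then have "\<bar>1 / f t p - 1 / f t q\<bar> = \<bar>f t p - f t q\<bar> / (f t p * f t q)"
      using pos by (simp add: abs_minus_commute)
    also have "\<dots> \<le> (M * norm (p - q)) / (c * c)"
      using fp fq c M(3)[OF *] M(1) pos by (intro frac_le mult_mono) auto
    finally show "\<bar>1 / f t p - 1 / f t q\<bar> \<le> (M / (c * c)) * norm (p - q)" by simp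
  qed
qed

subsection \<open>Uniform bounds\<close>

text \<open>\<open>Q\<close> is convex for the sake of the closest-point projection,
  \<open>D\<close> for that of mean value estimates. As \<open>H2\<close> is convex, the hull of
  \<open>A\<close> is still a compact subset of it; \<open>Q\<close> and \<open>D\<close> are its
  sums with balls of radii \<open>e\<close> and \<open>e / 2\<close>, which leaves
  \<open>\<delta> = e / 2\<close>.\<close>

lemma compact_tube_in_H2:
  assumes A: "compact A" "A \<subseteq> H2" "A \<noteq> {}"
  shows "\<exists>Q D \<delta>. compact Q \<and> convex Q \<and> Q \<subseteq> H2 \<and> open D \<and> convex D \<and> bounded D \<and> A \<subseteq> D
    \<and> 0 < \<delta> \<and> (\<forall>p\<in>D. cball p \<delta> \<subseteq> Q)"
proof -
  define C where "C = convex hull A"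
  have C: "compact C" "convex C" "A \<subseteq> C" "C \<subseteq> H2"
    using A by (auto simp: C_def compact_convex_hull hull_subset hull_minimal convex_H2 intro: hull_inc)
  obtain e where e: "e > 0" "(\<Union>x\<in>C. cball x e) \<subseteq> H2"
    using compact_subset_open_imp_cball_epsilon_subset[OF C(1) open_H2 C(4)] by blast
  define Q where "Q = (\<Union>x\<in>C. \<Union>y\<in>cball 0 e. {x + y})"
  define D where "D = (\<Union>x\<in>C. \<Union>y\<in>ball 0 (e / 2). {x + y})"
  have Q: "compact Q" "convex Q" unfolding Q_def
    by (rule compact_sums'[OF C(1) compact_cball], rule convex_sums[OF C(2) convex_cball])
  have QH: "Q \<subseteq> H2"
  proof
    fix w assume "w \<in> Q"
    then obtain x y where "x \<in> C" "norm y \<le> e" "w = x + y" by (auto simp: Q_def)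
    then have "w \<in> (\<Union>x\<in>C. cball x e)" by (auto simp: dist_norm intro!: bexI[of _ x])
    then show "w \<in> H2" using e(2) by blast
  qed
  have D: "open D" "convex D" unfolding D_def
    by (rule open_sums, simp, rule convex_sums[OF C(2) convex_ball])
  have tube: "cball p (e / 2) \<subseteq> Q" if pD: "p \<in> D" for p
  proof
    fix w assume w: "w \<in> cball p (e / 2)"
    obtain x y where xy: "x \<in> C" "norm y < e / 2" "p = x + y" using pD unfolding D_def by auto
    have "norm (w - x) \<le> norm (w - p) + norm y"
      using norm_triangle_ineq[of "w - p" y] xy(3) by simp
    then have "norm (w - x) \<le> e" using w xy(2) by (simp add: dist_norm norm_minus_commute)
    then show "w \<in> Q" unfolding Q_def using xy(1) by (intro UN_I[of x] UN_I[of "w - x"]) auto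
  qed
  have "D \<subseteq> Q"
  proof
    fix p assume "p \<in> D"
    from tube[OF this] show "p \<in> Q" using e(1) by (auto simp: subset_iff)
  qed
  then have "bounded D" using compact_imp_bounded[OF Q(1)] bounded_subset by blast
  moreover have "A \<subseteq> D"
  proof
    fix x assume "x \<in> A"
    then show "x \<in> D" unfolding D_def using C(3) e(1) by (intro UN_I[of x] UN_I[of 0]) auto
  qed
  ultimately show ?thesis using Q QH D tube e(1) by (intro exI[of _ Q] exI[of _ D] exI[of _ "e / 2"]) auto
qed

lemma omega_bounds:
  assumes k: "k > 1"
  shows "\<exists>c>0. \<forall>x\<in>S1. norm (omega_dot k x) \<le> c \<and> (\<forall>h. norm (omega_at k h x) \<le> c * norm h)"
proof -
  have co: "continuous_on S1 (omega k)"
    by (rule circ_differentiable_continuous_on[OF omega_circle_deriv[OF k]])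
  obtain c where c: "\<And>x. x \<in> S1 \<Longrightarrow> norm (omega k x) \<le> c"
    using compact_imp_bounded[OF compact_continuous_image[OF co compact_sphere]] unfolding bounded_iff by blast
  have c0: "0 \<le> c" using order_trans[OF norm_ge_zero c[of 1]] by simp
  define C where "C = 1 + c + 1 / (k - 1)"
  have C: "C > 0" "1 + c \<le> C" "1 / (k - 1) \<le> C" using k c0 by (auto simp: C_def add_nonneg_pos)
  show ?thesis
  proof (intro exI[of _ C] conjI ballI allI)
    fix x :: complex assume x: "x \<in> S1"
    have "1 / (k - Im x) \<le> 1 / (k - 1)" using circle_coords[OF x] k by (intro divide_left_mono) auto
    then show "norm (omega_dot k x) \<le> C" using norm_omega_dot[OF k x] C(3) by simp
    fix h
    have "norm (omega_at k h x) \<le> \<bar>Re h\<bar> + \<bar>Im h\<bar> * norm (omega k x)"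
      unfolding omega_at_def by (rule norm_triangle_le) simp
    also have "\<dots> \<le> norm h + norm h * c"
      using abs_Re_le_cmod[of h] abs_Im_le_cmod[of h] c[OF x] by (intro add_mono mult_mono) auto
    also have "\<dots> = (1 + c) * norm h" by (simp add: algebra_simps)
    also have "\<dots> \<le> C * norm h" using C(2) by (rule mult_right_mono) simp
    finally show "norm (omega_at k h x) \<le> C * norm h" .
  qed (rule C(1))
qed

lemma uniformly_lipschitz_const_t:
  assumes "continuous_on period c"
  shows "uniformly_lipschitz X (\<lambda>t p. c t)"
proof -
  obtain M where "\<And>t. t \<in> period \<Longrightarrow> norm (c t) \<le> M"
    using compact_imp_bounded[OF compact_continuous_image[OF assms compact_Icc]] unfolding bounded_iff by blast
  then show ?thesis by (intro uniformly_lipschitzI[where M = M and L = 0]) auto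
qed

lemma uniformly_lipschitz_linear:
  assumes "bounded X" "bounded_linear l"
  shows "uniformly_lipschitz X (\<lambda>t p. l p)"
proof -
  obtain b where b: "\<And>p. norm (l p) \<le> b * norm p"
    using bounded_linear.bounded[OF assms(2)] by (metis mult.commute)
  have "bounded (l ` X)" by (rule bounded_linear_image[OF assms])
  then obtain M where "\<And>p. p \<in> X \<Longrightarrow> norm (l p) \<le> M" unfolding bounded_iff by blast
  moreover have "\<bar>l p - l q\<bar> \<le> b * norm (p - q)" for p q
    using b[of "p - q"] by (simp add: linear_diff[OF bounded_linear.linear[OF assms(2)]])
  ultimately show ?thesis by (intro uniformly_lipschitzI[where M = M and L = b]) auto
qed

lemma uniformly_lipschitz_add_1:
  assumes "uniformly_lipschitz X f"
  shows "uniformly_lipschitz X (\<lambda>t p. 1 + f t p)"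
proof -
  obtain M where M: "M \<ge> 0" "\<And>t p. t \<in> period \<Longrightarrow> p \<in> X \<Longrightarrow> \<bar>f t p\<bar> \<le> M"
    "\<And>t p q. t \<in> period \<Longrightarrow> p \<in> X \<Longrightarrow> q \<in> X \<Longrightarrow> \<bar>f t p - f t q\<bar> \<le> M * norm (p - q)"
    using uniformly_lipschitzE[OF assms] by metis
  show ?thesis
  proof (rule uniformly_lipschitzI)
    show "\<bar>1 + f t p\<bar> \<le> 1 + M" if "t \<in> period" "p \<in> X" for t p
      using M(2)[OF that] by linarith
    show "\<bar>1 + f t p - (1 + f t q)\<bar> \<le> M * norm (p - q)" if "t \<in> period" "p \<in> X" "q \<in> X" for t p q
      using M(3)[OF that] by simp
  qed
qed

lemma continuous_on_omega_at:
  assumes "k > 1"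
  shows "continuous_on (UNIV \<times> S1) (\<lambda>p. omega_at k (fst p) (snd p))"
proof -
  have co: "continuous_on S1 (omega k)"
    by (rule circ_differentiable_continuous_on[OF omega_circle_deriv[OF assms]])
  have "continuous_on (UNIV \<times> S1) (\<lambda>p::complex\<times>complex. omega k (snd p))"
    by (rule continuous_on_compose2[OF co continuous_on_snd[OF continuous_on_id]]) auto
  then show ?thesis unfolding omega_at_def by (intro continuous_intros)
qed

lemma continuous_on_omega_at_period:
  assumes "k > 1" "continuous_on period v"
  shows "continuous_on period (\<lambda>t. omega_at k (v t) (cis t))"
proof -
  have "continuous_on period (\<lambda>t. (v t, cis t))" by (intro continuous_intros assms)
  moreover have "(\<lambda>t. (v t, cis t)) ` period \<subseteq> UNIV \<times> S1" by auto
  ultimately show ?thesis using continuous_on_compose2[OF continuous_on_omega_at[OF assms(1)]] by fastforce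
qed

lemma norm_Pair_le_add: "norm (a :: real, b :: complex) \<le> \<bar>a\<bar> + norm b"
  using sqrt_sum_squares_le_sum_abs[of a "norm b"] by (simp add: norm_prod_def)

text \<open>A single \<open>M\<close> bounds the sizes and the Lipschitz constants, so it can be
  passed to \<open>closed_ode\<close> in both roles.\<close>

definition field_bounds ::
  "real \<Rightarrow> (complex \<Rightarrow> real) \<Rightarrow> complex set \<Rightarrow> real \<Rightarrow> real \<Rightarrow> real \<Rightarrow> bool" where
  "field_bounds k K Q \<epsilon>1 M s \<longleftrightarrow> (\<forall>t\<in>period. \<forall>\<epsilon> v. \<bar>\<epsilon>\<bar> \<le> \<epsilon>1 \<and> v \<in> Q \<longrightarrow>
     den k K \<epsilon> t v > 0 \<and> norm (field_\<Phi> k K \<epsilon> t v) \<le> M \<and> norm (field_\<sigma> k K \<epsilon> t v) \<le> M \<and>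
     s \<le> field_\<sigma> k K \<epsilon> t v \<and> (\<forall>\<epsilon>' w. \<bar>\<epsilon>'\<bar> \<le> \<epsilon>1 \<and> w \<in> Q \<longrightarrow>
        norm (field_\<Phi> k K \<epsilon> t v - field_\<Phi> k K \<epsilon>' t w) \<le> M * (\<bar>\<epsilon> - \<epsilon>'\<bar> + norm (v - w)) \<and>
        norm (field_\<sigma> k K \<epsilon> t v - field_\<sigma> k K \<epsilon>' t w) \<le> M * (\<bar>\<epsilon> - \<epsilon>'\<bar> + norm (v - w))))"

locale half_plane_data =
  fixes k :: real and K :: "complex \<Rightarrow> real" and gK :: "complex \<Rightarrow> complex"
  assumes k: "k > 1" and K: "\<And>z. z \<in> H2 \<Longrightarrow> GDERIV K z :> gK z" and gK: "continuous_on H2 gK"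
begin

text \<open>A C^1 function is Lipschitz only on compact convex sets. The loops
  \<open>omega_at k v\<close> with \<open>v \<in> Q\<close> fill a compact set, whose hull
  \<open>S\<close> is compact and stays in the convex set \<open>H2\<close>; there the mean value
  inequality applies.\<close>

lemma curvature_uniformly_lipschitz:
  assumes Q: "compact Q" "Q \<subseteq> H2" and X: "\<And>p. p \<in> X \<Longrightarrow> snd p \<in> Q"
  shows "uniformly_lipschitz (X :: (real \<times> complex) set) (\<lambda>t p. K (omega_at k (snd p) (cis t)))"
proof -
  obtain c where c: "c > 0" "\<And>x h. x \<in> S1 \<Longrightarrow> norm (omega_at k h x) \<le> c * norm h"
    using omega_bounds[OF k] by blast
  define S where "S = convex hull ((\<lambda>p. omega_at k (fst p) (snd p)) ` (Q \<times> S1))"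
  have "compact ((\<lambda>p. omega_at k (fst p) (snd p)) ` (Q \<times> S1))"
    by (rule compact_continuous_image[OF continuous_on_subset[OF continuous_on_omega_at[OF k]]])
      (auto intro!: compact_Times Q)
  then have S: "compact S" "convex S" unfolding S_def by (auto intro: compact_convex_hull)
  have SH: "S \<subseteq> H2" unfolding S_def
    by (rule hull_minimal) (use Q(2) in \<open>auto intro!: omega_at_in_H2[OF k] convex_H2\<close>)
  have inS: "omega_at k v (cis t) \<in> S" if "v \<in> Q" for v t
    unfolding S_def by (rule hull_inc) (use that in \<open>auto intro!: image_eqI[of _ _ "(v, cis t)"]\<close>)
  obtain g where g: "\<And>z. z \<in> S \<Longrightarrow> norm (gK z) \<le> g"
    using compact_imp_bounded[OF compact_continuous_image[OF continuous_on_subset[OF gK SH] S(1)]]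
    unfolding bounded_iff by blast
  obtain M where M: "\<And>z. z \<in> S \<Longrightarrow> norm (K z) \<le> M"
    using compact_imp_bounded[OF compact_continuous_image[OF
        continuous_on_subset[OF GDERIV_imp_continuous_on[OF K] SH] S(1)]]
    unfolding bounded_iff by blast
  have lip: "norm (K z - K w) \<le> g * norm (z - w)" if "z \<in> S" "w \<in> S" for z w
  proof (rule differentiable_bound[OF S(2) _ _ that])
    show "(K has_derivative (\<lambda>h. h \<bullet> gK y)) (at y within S)" if "y \<in> S" for y
      using K[of y] SH that unfolding gderiv_def by (auto intro: has_derivative_at_withinI)
    show "onorm (\<lambda>h. h \<bullet> gK y) \<le> g" if "y \<in> S" for y
    proof (rule onorm_le)
      fix h
      have "norm (h \<bullet> gK y) \<le> norm h * norm (gK y)" unfolding real_norm_def by (rule Cauchy_Schwarz_ineq2)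
      also have "\<dots> \<le> norm h * g" by (rule mult_left_mono[OF g[OF that]]) simp
      finally show "norm (h \<bullet> gK y) \<le> g * norm h" by (simp add: mult.commute)
    qed
  qed
  show ?thesis
  proof (rule uniformly_lipschitzI)
    show "\<bar>K (omega_at k (snd p) (cis t))\<bar> \<le> M" if "p \<in> X" for p t
      using M[OF inS[OF X[OF that]]] by simp
    fix t p q assume pq: "p \<in> X" "q \<in> X"
    have g0: "0 \<le> g" by (rule order_trans[OF norm_ge_zero g[OF inS[OF X[OF pq(1)], of t]]])
    have "\<bar>K (omega_at k (snd p) (cis t)) - K (omega_at k (snd q) (cis t))\<bar>
        \<le> g * norm (omega_at k (snd p) (cis t) - omega_at k (snd q) (cis t))"
      using lip[OF inS[OF X[OF pq(1)]] inS[OF X[OF pq(2)]]] by simp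
    also have "\<dots> \<le> g * (c * norm (p - q))"
    proof (rule mult_left_mono[OF _ g0])
      have "norm (omega_at k (snd p) (cis t) - omega_at k (snd q) (cis t)) \<le> c * norm (snd (p - q))"
        unfolding omega_at_linear(2)[symmetric] snd_diff[symmetric] by (rule c(2)) simp
      also have "\<dots> \<le> c * norm (p - q)" using c(1) norm_snd_le[of "snd (p - q)" "fst (p - q)"]
        by (intro mult_left_mono) (simp_all only: prod.collapse less_imp_le)
      finally show "norm (omega_at k (snd p) (cis t) - omega_at k (snd q) (cis t)) \<le> c * norm (p - q)" .
    qed
    finally show "\<bar>K (omega_at k (snd p) (cis t)) - K (omega_at k (snd q) (cis t))\<bar> \<le> (g * c) * norm (p - q)"
      by (simp add: mult.assoc)
  qed
qed

text \<open>The estimates are Lipschitz in \<open>(\<epsilon>, v)\<close> jointly, so that the same bounds also control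
  the limit \<open>\<epsilon> \<rightarrow> 0\<close>.\<close>

lemma field_bounds_exist:
  assumes Q: "compact Q" "Q \<subseteq> H2" "Q \<noteq> {}"
  shows "\<exists>\<epsilon>1>0. \<exists>M\<ge>0. \<exists>s>0. field_bounds k K Q \<epsilon>1 M s"
proof -
  let ?\<kappa> = "\<lambda>t (p :: real \<times> complex). K (omega_at k (snd p) (cis t))"
  let ?\<tau> = "\<lambda>t (p :: real \<times> complex). (R k)\<^sup>2 * (k - sin t)"
  have \<tau>: "uniformly_lipschitz X ?\<tau>" for X
    by (rule uniformly_lipschitz_const_t) (intro continuous_intros)
  have \<tau>\<kappa>: "uniformly_lipschitz X (\<lambda>t p. ?\<tau> t p * ?\<kappa> t p)" if "\<And>p. p \<in> X \<Longrightarrow> snd p \<in> Q" for X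
    by (rule uniformly_lipschitz_mult[OF \<tau> curvature_uniformly_lipschitz[OF Q(1,2) that]])
  obtain N where N: "N \<ge> 0" "\<And>t p. t \<in> period \<Longrightarrow> p \<in> UNIV \<times> Q \<Longrightarrow> \<bar>?\<tau> t p * ?\<kappa> t p\<bar> \<le> N"
    using uniformly_lipschitzE[OF \<tau>\<kappa>[of "UNIV \<times> Q"]] by (metis mem_Sigma_iff prod.collapse)
  \<comment> \<open>The resulting \<open>\<epsilon>1 * N \<le> 1 / 2\<close> keeps
    \<open>den\<close> between \<open>1 / 2\<close> and 2.\<close>
  define \<epsilon>1 where "\<epsilon>1 = 1 / (2 * (N + 1))"
  have \<epsilon>1: "\<epsilon>1 > 0" "\<epsilon>1 * N \<le> 1 / 2" using N(1) by (auto simp: \<epsilon>1_def field_simps)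
  define X where "X = {- \<epsilon>1..\<epsilon>1} \<times> Q"
  have bX: "bounded X" unfolding X_def by (intro bounded_Times bounded_closed_interval compact_imp_bounded Q)
  have sX: "snd p \<in> Q" if "p \<in> X" for p using that by (auto simp: X_def)
  have fst: "uniformly_lipschitz X (\<lambda>t p. fst p)" by (rule uniformly_lipschitz_linear[OF bX bounded_linear_fst])
  have im: "uniformly_lipschitz X (\<lambda>t p. Im (snd p))"
    by (rule uniformly_lipschitz_linear[OF bX bounded_linear_compose[OF bounded_linear_Im bounded_linear_snd]])
  let ?den = "\<lambda>t p. den k K (fst p) t (snd p)"
  have den: "uniformly_lipschitz X ?den" unfolding den_def
    by (rule uniformly_lipschitz_add_1[OF uniformly_lipschitz_mult[OF fst \<tau>\<kappa>[OF sX]]])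
  have den_lower: "1 / 2 \<le> den k K \<epsilon> t v" "den k K \<epsilon> t v \<le> 2"
    if "t \<in> period" "\<bar>\<epsilon>\<bar> \<le> \<epsilon>1" "v \<in> Q" for \<epsilon> t v
  proof -
    have "\<bar>\<epsilon> * ((R k)\<^sup>2 * (k - sin t) * K (omega_at k v (cis t)))\<bar> \<le> \<epsilon>1 * N"
      unfolding abs_mult[of \<epsilon>] using N(2)[OF that(1), of "(\<epsilon>, v)"] that \<epsilon>1(1) by (intro mult_mono) auto
    then show "1 / 2 \<le> den k K \<epsilon> t v" "den k K \<epsilon> t v \<le> 2" using \<epsilon>1(2) unfolding den_def by linarith+
  qed
  have inv: "uniformly_lipschitz X (\<lambda>t p. 1 / ?den t p)"
  proof (rule uniformly_lipschitz_inverse[OF den, of "1 / 2"])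
    show "1 / 2 \<le> ?den t p" if "t \<in> period" "p \<in> X" for t p
      by (rule den_lower(1)[OF that(1)]) (use that(2) in \<open>auto simp: X_def abs_le_iff\<close>)
  qed simp
  have "uniformly_lipschitz X (\<lambda>t p. Im (snd p) * Im (snd p) * (1 / ?den t p))"
    by (rule uniformly_lipschitz_mult[OF uniformly_lipschitz_mult[OF im im] inv])
  then obtain M1 where M1: "M1 \<ge> 0"
    "\<And>t p. t \<in> period \<Longrightarrow> p \<in> X \<Longrightarrow> \<bar>field_\<sigma> k K (fst p) t (snd p)\<bar> \<le> M1"
    "\<And>t p q. t \<in> period \<Longrightarrow> p \<in> X \<Longrightarrow> q \<in> X \<Longrightarrow>
       \<bar>field_\<sigma> k K (fst p) t (snd p) - field_\<sigma> k K (fst q) t (snd q)\<bar> \<le> M1 * norm (p - q)"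
    unfolding field_\<sigma>_def power2_eq_square by (rule uniformly_lipschitzE) auto
  let ?\<phi> = "\<lambda>t p. (R k)\<^sup>2 * Im (snd p) * ?\<kappa> t p * (1 / ?den t p)"
  have "uniformly_lipschitz X ?\<phi>"
    by (rule uniformly_lipschitz_mult[OF uniformly_lipschitz_mult[OF uniformly_lipschitz_mult[OF
          uniformly_lipschitz_const_t im] curvature_uniformly_lipschitz[OF Q(1,2) sX]] inv]) simp_all
  then obtain M2 where M2: "M2 \<ge> 0"
    "\<And>t p. t \<in> period \<Longrightarrow> p \<in> X \<Longrightarrow> \<bar>?\<phi> t p\<bar> \<le> M2"
    "\<And>t p q. t \<in> period \<Longrightarrow> p \<in> X \<Longrightarrow> q \<in> X \<Longrightarrow> \<bar>?\<phi> t p - ?\<phi> t q\<bar> \<le> M2 * norm (p - q)"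
    by (rule uniformly_lipschitzE) auto
  have \<Phi>: "field_\<Phi> k K (fst p) t (snd p) = (- ?\<phi> t p) *\<^sub>R (\<i> * cis t)" for p t by (simp add: field_\<Phi>_def)
  have n1: "norm (\<i> * cis t) = 1" for t by (simp add: norm_mult)
  \<comment> \<open>The least height in \<open>Q\<close> yields the lower bound
    \<open>(Im z0)\<^sup>2 / 2\<close> of \<open>field_\<sigma>\<close>, the 2 coming from
    \<open>den \<le> 2\<close>.\<close>
  obtain z0 where z0: "z0 \<in> Q" "\<And>z. z \<in> Q \<Longrightarrow> Im z0 \<le> Im z"
    using continuous_attains_inf[OF Q(1,3) continuous_on_Im[OF continuous_on_id]] by blast
  have im0: "Im z0 > 0" using z0(1) Q(2) by (auto simp: H2_def)
  define M where "M = max M1 M2"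
  have M: "M1 \<le> M" "M2 \<le> M" "0 \<le> M" using M1(1) by (auto simp: M_def)
  show ?thesis unfolding field_bounds_def
  proof (rule exI[of _ \<epsilon>1], intro conjI \<epsilon>1(1), rule exI[of _ M], intro conjI M(3),
      rule exI[of _ "(Im z0)\<^sup>2 / 2"], intro conjI ballI allI impI; (elim conjE)?)
    show "0 < (Im z0)\<^sup>2 / 2" using im0 by simp
    fix t \<epsilon> v assume t: "t \<in> period" and \<epsilon>: "\<bar>\<epsilon>\<bar> \<le> \<epsilon>1" and v: "v \<in> Q"
    have p: "(\<epsilon>, v) \<in> X" using \<epsilon> v by (auto simp: X_def)
    show "0 < den k K \<epsilon> t v" using den_lower(1)[OF t \<epsilon> v] by simp
    have "norm (field_\<Phi> k K \<epsilon> t v) = \<bar>?\<phi> t (\<epsilon>, v)\<bar>" using \<Phi>[of "(\<epsilon>, v)" t] by (simp only: fst_conv snd_conv norm_scaleR n1 abs_minus_cancel mult_1_right)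
    then show "norm (field_\<Phi> k K \<epsilon> t v) \<le> M" using M2(2)[OF t p] M(2) by linarith
    show "norm (field_\<sigma> k K \<epsilon> t v) \<le> M" using M1(2)[OF t p] M(1) by simp
    show "(Im z0)\<^sup>2 / 2 \<le> field_\<sigma> k K \<epsilon> t v" unfolding field_\<sigma>_def
      by (rule frac_le) (use im0 z0(2)[OF v] den_lower[OF t \<epsilon> v] in \<open>auto intro: power_mono\<close>)
    fix \<epsilon>' w assume \<epsilon>': "\<bar>\<epsilon>'\<bar> \<le> \<epsilon>1" and w: "w \<in> Q"
    have q: "(\<epsilon>', w) \<in> X" using \<epsilon>' w by (auto simp: X_def)
    have n: "norm ((\<epsilon>, v) - (\<epsilon>', w)) \<le> \<bar>\<epsilon> - \<epsilon>'\<bar> + norm (v - w)"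
      using norm_Pair_le_add[of "\<epsilon> - \<epsilon>'" "v - w"] by simp
    have nM: "m * norm ((\<epsilon>, v) - (\<epsilon>', w)) \<le> M * (\<bar>\<epsilon> - \<epsilon>'\<bar> + norm (v - w))" if "m \<le> M" for m
      by (rule mult_mono[OF that n M(3)]) simp
    have "field_\<Phi> k K \<epsilon> t v - field_\<Phi> k K \<epsilon>' t w = (?\<phi> t (\<epsilon>', w) - ?\<phi> t (\<epsilon>, v)) *\<^sub>R (\<i> * cis t)"
      using \<Phi>[of "(\<epsilon>, v)" t] \<Phi>[of "(\<epsilon>', w)" t] by (simp only: fst_conv snd_conv scaleR_left_diff_distrib) simp
    then have "norm (field_\<Phi> k K \<epsilon> t v - field_\<Phi> k K \<epsilon>' t w) = \<bar>?\<phi> t (\<epsilon>, v) - ?\<phi> t (\<epsilon>', w)\<bar>"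
      by (simp only: norm_scaleR n1 mult_1_right abs_minus_commute)
    also have "\<dots> \<le> M2 * norm ((\<epsilon>, v) - (\<epsilon>', w))" by (rule M2(3)[OF t p q])
    also have "\<dots> \<le> M * (\<bar>\<epsilon> - \<epsilon>'\<bar> + norm (v - w))" by (rule nM[OF M(2)])
    finally show "norm (field_\<Phi> k K \<epsilon> t v - field_\<Phi> k K \<epsilon>' t w) \<le> M * (\<bar>\<epsilon> - \<epsilon>'\<bar> + norm (v - w))" .
    have "\<bar>field_\<sigma> k K \<epsilon> t v - field_\<sigma> k K \<epsilon>' t w\<bar> \<le> M1 * norm ((\<epsilon>, v) - (\<epsilon>', w))"
      using M1(3)[OF t p q] by simp
    also have "\<dots> \<le> M * (\<bar>\<epsilon> - \<epsilon>'\<bar> + norm (v - w))" by (rule nM[OF M(1)])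
    finally show "norm (field_\<sigma> k K \<epsilon> t v - field_\<sigma> k K \<epsilon>' t w) \<le> M * (\<bar>\<epsilon> - \<epsilon>'\<bar> + norm (v - w))" by simp
  qed
qed

lemma continuous_on_fields:
  assumes v: "continuous_on period v" and vH: "\<And>t. t \<in> period \<Longrightarrow> v t \<in> H2"
    and den: "\<And>t. t \<in> period \<Longrightarrow> den k K \<epsilon> t (v t) > 0"
  shows "continuous_on period (\<lambda>t. field_\<Phi> k K \<epsilon> t (v t))" "continuous_on period (\<lambda>t. field_\<sigma> k K \<epsilon> t (v t))"
proof -
  note cw = continuous_on_omega_at_period[OF k v]
  have cK: "continuous_on period (\<lambda>t. K (omega_at k (v t) (cis t)))"
    by (rule continuous_on_compose2[OF GDERIV_imp_continuous_on[OF K] cw])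
      (use vH omega_at_in_H2[OF k] in auto)
  have cd: "continuous_on period (\<lambda>t. den k K \<epsilon> t (v t))"
    unfolding den_def by (intro continuous_intros cK)
  have nz: "\<forall>t\<in>period. den k K \<epsilon> t (v t) \<noteq> 0" using den by force
  show "continuous_on period (\<lambda>t. field_\<Phi> k K \<epsilon> t (v t))"
    unfolding field_\<Phi>_def by (intro continuous_intros cK cd v nz)
  show "continuous_on period (\<lambda>t. field_\<sigma> k K \<epsilon> t (v t))"
    unfolding field_\<sigma>_def by (intro continuous_intros cd v nz)
qed

end

subsection \<open>The reduced function\<close>

lemma GDERIV_of_variation:
  assumes "open D" "p \<in> D"
    and var: "\<And>\<eta>. \<eta> > 0 \<Longrightarrow> \<exists>d>0. \<forall>q\<in>D. norm (q - p) < d \<longrightarrow>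
      \<bar>f q - f p - (q - p) \<bullet> g\<bar> \<le> \<eta> * norm (q - p)"
  shows "GDERIV f p :> g"
proof -
  have "(f has_derivative (\<lambda>h. h \<bullet> g)) (at p within D)"
    unfolding has_derivative_within_alt using var
    by (auto intro: bounded_linear_inner_left)
  then show ?thesis unfolding gderiv_def using at_within_open[OF assms(2,1)] by simp
qed

lemma GDERIV_unique: "GDERIV f z :> a \<Longrightarrow> GDERIV f z :> b \<Longrightarrow> a = b"
proof -
  assume "GDERIV f z :> a" "GDERIV f z :> b"
  then have "(\<lambda>h. h \<bullet> a) = (\<lambda>h. h \<bullet> b)" unfolding gderiv_def by (rule has_derivative_unique)
  then have "(a - b) \<bullet> a = (a - b) \<bullet> b" by metis
  then have "(a - b) \<bullet> (a - b) = 0" by (simp add: inner_diff_right)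
  then show "a = b" by simp
qed

lemma grad_eq: "GDERIV f z :> g \<Longrightarrow> grad f z = g"
  unfolding grad_def by (rule the_equality) (auto dest: GDERIV_unique)

lemma GDERIV_minus: "GDERIV f z :> a \<Longrightarrow> GDERIV g z :> b \<Longrightarrow> GDERIV (\<lambda>z. f z - g z) z :> a - b"
  unfolding gderiv_def by (drule (1) has_derivative_diff) (simp add: inner_diff_right)

text \<open>The mean values \<open>p\<close> range over \<open>D\<close>; solutions stay within
  \<open>\<delta>\<close> of them, hence in \<open>Q\<close>, where the field is controlled.
  \<open>B\<close> and \<open>B1\<close> are the coefficients of primitives of the area form
  weighted by \<open>K\<close> and by 1.\<close>

locale reduction = half_plane_data +
  fixes Q D :: "complex set" and \<delta> \<epsilon>1 M s :: real and B B1 :: "complex \<Rightarrow> real" and gB gB1 :: "complex \<Rightarrow> complex"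
  assumes Q: "compact Q" "convex Q" "Q \<subseteq> H2" "Q \<noteq> {}" and D: "open D" "convex D" "bounded D"
    and \<delta>: "\<delta> > 0" and tube: "\<And>p. p \<in> D \<Longrightarrow> cball p \<delta> \<subseteq> Q"
    and \<epsilon>1: "\<epsilon>1 > 0" and M0: "M \<ge> 0" and s: "s > 0"
    and bounds: "field_bounds k K Q \<epsilon>1 M s"
    and B: "\<And>z. z \<in> H2 \<Longrightarrow> GDERIV B z :> gB z" "continuous_on H2 gB" "\<And>z. z \<in> H2 \<Longrightarrow> Re (gB z) = K z / (Im z)\<^sup>2"
    and B1: "\<And>z. z \<in> H2 \<Longrightarrow> GDERIV B1 z :> gB1 z" "continuous_on H2 gB1" "\<And>z. z \<in> H2 \<Longrightarrow> Re (gB1 z) = 1 / (Im z)\<^sup>2"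
begin

lemma
  assumes "t \<in> period" "\<bar>\<epsilon>\<bar> \<le> \<epsilon>1" "v \<in> Q"
  shows den_pos: "den k K \<epsilon> t v > 0" and \<Phi>_le: "norm (field_\<Phi> k K \<epsilon> t v) \<le> M"
    and \<sigma>_le: "norm (field_\<sigma> k K \<epsilon> t v) \<le> M" and \<sigma>_ge: "s \<le> field_\<sigma> k K \<epsilon> t v"
  using bounds assms unfolding field_bounds_def by blast+

lemma
  assumes "t \<in> period" "\<bar>\<epsilon>\<bar> \<le> \<epsilon>1" "v \<in> Q" "\<bar>\<epsilon>'\<bar> \<le> \<epsilon>1" "w \<in> Q"
  shows \<Phi>_lip: "norm (field_\<Phi> k K \<epsilon> t v - field_\<Phi> k K \<epsilon>' t w) \<le> M * (\<bar>\<epsilon> - \<epsilon>'\<bar> + norm (v - w))"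
    and \<sigma>_lip: "norm (field_\<sigma> k K \<epsilon> t v - field_\<sigma> k K \<epsilon>' t w) \<le> M * (\<bar>\<epsilon> - \<epsilon>'\<bar> + norm (v - w))"
  using bounds assms unfolding field_bounds_def by blast+

text \<open>Composing with the projection onto \<open>Q\<close> extends the field to the whole plane without losing
  the Lipschitz bounds; solutions of interest stay in \<open>Q\<close>, where the projection is the identity.\<close>

definition \<Phi>c :: "real \<Rightarrow> real \<Rightarrow> complex \<Rightarrow> complex" where
  "\<Phi>c \<epsilon> t v = field_\<Phi> k K \<epsilon> t (closest_point Q v)"

definition \<sigma>c :: "real \<Rightarrow> real \<Rightarrow> complex \<Rightarrow> real" where
  "\<sigma>c \<epsilon> t v = field_\<sigma> k K \<epsilon> t (closest_point Q v)"

lemma cpQ: "closest_point Q v \<in> Q"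
  by (rule closest_point_in_set[OF compact_imp_closed[OF Q(1)] Q(4)])

lemma cpQ_lip: "norm (closest_point Q v - closest_point Q w) \<le> norm (v - w)"
  using closest_point_lipschitz[OF Q(2) compact_imp_closed[OF Q(1)] Q(4), of v w] by (simp add: dist_norm)

lemma cpQ_id: "v \<in> Q \<Longrightarrow> closest_point Q v = v" by (rule closest_point_self)

lemma clamped_ode:
  assumes e: "\<bar>\<epsilon>\<bar> \<le> \<epsilon>1"
  shows "closed_ode (\<Phi>c \<epsilon>) (\<sigma>c \<epsilon>) M M s"
proof
  have c: "continuous_on period (\<lambda>t. closest_point Q (v t))" if "continuous_on period v" for v :: "real \<Rightarrow> complex"
    by (rule continuous_on_compose2[OF continuous_on_closest_point[OF Q(2) compact_imp_closed[OF Q(1)] Q(4)] that subset_UNIV])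
  have H: "closest_point Q w \<in> H2" for w using cpQ Q(3) by blast
  show "continuous_on period (\<lambda>t. \<Phi>c \<epsilon> t (v t))" if "continuous_on period v" for v
    unfolding \<Phi>c_def by (rule continuous_on_fields(1)[OF c[OF that] H den_pos[OF _ e cpQ]])
  show "continuous_on period (\<lambda>t. \<sigma>c \<epsilon> t (v t))" if "continuous_on period v" for v
    unfolding \<sigma>c_def by (rule continuous_on_fields(2)[OF c[OF that] H den_pos[OF _ e cpQ]])
  fix t :: real and z w assume t: "t \<in> period"
  show "norm (\<Phi>c \<epsilon> t z) \<le> M" unfolding \<Phi>c_def by (rule \<Phi>_le[OF t e cpQ])
  show "norm (\<sigma>c \<epsilon> t z) \<le> M" unfolding \<sigma>c_def by (rule \<sigma>_le[OF t e cpQ])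
  show "s \<le> \<sigma>c \<epsilon> t z" unfolding \<sigma>c_def by (rule \<sigma>_ge[OF t e cpQ])
  show "norm (\<Phi>c \<epsilon> t z - \<Phi>c \<epsilon> t w) \<le> M * norm (z - w)" unfolding \<Phi>c_def
    using order_trans[OF \<Phi>_lip[OF t e cpQ e cpQ, of z w] mult_left_mono[OF _ M0]] cpQ_lip[of z w] by simp
  show "norm (\<sigma>c \<epsilon> t z - \<sigma>c \<epsilon> t w) \<le> M * norm (z - w)" unfolding \<sigma>c_def
    using order_trans[OF \<sigma>_lip[OF t e cpQ e cpQ, of z w] mult_left_mono[OF _ M0]] cpQ_lip[of z w] by simp
qed (rule s)

abbreviation "Bc \<equiv> closed_ode.rhs_bound M s"
abbreviation "Cc \<equiv> closed_ode.rhs_lip M M s"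

lemma Bc_Cc_nonneg: "0 \<le> Bc" "0 \<le> Cc"
proof -
  have "closed_ode (\<Phi>c 0) (\<sigma>c 0) M M s" using \<epsilon>1 by (intro clamped_ode) simp
  then show "0 \<le> Bc" "0 \<le> Cc" by (rule closed_ode.rhs_bound_nonneg closed_ode.rhs_lip_nonneg)+
qed

text \<open>Three demands: the field bounds hold, the integral equation contracts by the factor
  \<open>1 / 2\<close>, and the solution stays within \<open>\<delta>\<close> of its mean. The
  summands 1 keep the denominators positive.\<close>

definition \<epsilon>0 :: real where
  "\<epsilon>0 = min \<epsilon>1 (min (1 / (2 * (4 * pi * Cc + 1))) (\<delta> / (4 * pi * Bc + 1)))"

lemma \<epsilon>0: "0 < \<epsilon>0" "\<bar>\<epsilon>\<bar> \<le> \<epsilon>0 \<Longrightarrow> \<bar>\<epsilon>\<bar> \<le> \<epsilon>1"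
  "\<bar>\<epsilon>\<bar> \<le> \<epsilon>0 \<Longrightarrow> \<bar>\<epsilon>\<bar> * (4 * pi * Cc) \<le> 1 / 2" "\<bar>\<epsilon>\<bar> \<le> \<epsilon>0 \<Longrightarrow> \<bar>\<epsilon>\<bar> * (4 * pi * Bc) \<le> \<delta>"
proof -
  have c: "0 \<le> 4 * pi * Cc" "0 \<le> 4 * pi * Bc" using Bc_Cc_nonneg by simp_all
  then show "0 < \<epsilon>0" unfolding \<epsilon>0_def using \<epsilon>1 \<delta> by (simp add: add_nonneg_pos)
  assume e: "\<bar>\<epsilon>\<bar> \<le> \<epsilon>0"
  then show "\<bar>\<epsilon>\<bar> \<le> \<epsilon>1" unfolding \<epsilon>0_def by simp
  have "\<bar>\<epsilon>\<bar> * (4 * pi * Cc) \<le> 1 / (2 * (4 * pi * Cc + 1)) * (4 * pi * Cc + 1)"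
    using e c unfolding \<epsilon>0_def by (intro mult_mono) auto
  also have "\<dots> = 1 / 2"
  proof -
    have "1 / (2 * a) * a = 1 / 2" if "a > 0" for a :: real using that by simp
    then show ?thesis using c(1) by (meson add_nonneg_pos zero_less_one)
  qed
  finally show "\<bar>\<epsilon>\<bar> * (4 * pi * Cc) \<le> 1 / 2" .
  have "\<bar>\<epsilon>\<bar> * (4 * pi * Bc) \<le> \<delta> / (4 * pi * Bc + 1) * (4 * pi * Bc + 1)"
    using e c \<delta> unfolding \<epsilon>0_def by (intro mult_mono) auto
  also have "\<dots> = \<delta>"
  proof -
    have "\<delta> / a * a = \<delta>" if "a > 0" for a :: real using that by simp
    then show ?thesis using c(2) by (meson add_nonneg_pos zero_less_one)
  qed
  finally show "\<bar>\<epsilon>\<bar> * (4 * pi * Bc) \<le> \<delta>" .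
qed

text \<open>An arbitrary choice is harmless, as \<open>solves_lipschitz\<close> compares any two
  solutions.\<close>

definition sol :: "real \<Rightarrow> complex \<Rightarrow> real \<Rightarrow> complex" where
  "sol \<epsilon> p = (SOME v. closed_ode.solves (\<Phi>c \<epsilon>) (\<sigma>c \<epsilon>) \<epsilon> p v)"

definition \<gamma> :: "real \<Rightarrow> complex \<Rightarrow> complex" where
  "\<gamma> \<epsilon> p = closed_ode.mult (\<Phi>c \<epsilon>) (\<sigma>c \<epsilon>) (sol \<epsilon> p)"

definition vel :: "real \<Rightarrow> complex \<Rightarrow> real \<Rightarrow> complex" where
  "vel \<epsilon> p t = \<epsilon> *\<^sub>R closed_ode.rhs (\<Phi>c \<epsilon>) (\<sigma>c \<epsilon>) (sol \<epsilon> p) t"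

context
  fixes \<epsilon> :: real
  assumes e: "\<bar>\<epsilon>\<bar> \<le> \<epsilon>0"
begin

interpretation ode: closed_ode "\<Phi>c \<epsilon>" "\<sigma>c \<epsilon>" M M s
  by (rule clamped_ode[OF \<epsilon>0(2)[OF e]])

lemma sol_solves: "closed_ode.solves (\<Phi>c \<epsilon>) (\<sigma>c \<epsilon>) \<epsilon> p (sol \<epsilon> p)"
  unfolding sol_def by (rule someI_ex[OF ode.solves_exists[OF \<epsilon>0(3)[OF e]]])

lemma sol_continuous: "continuous_on period (sol \<epsilon> p)"
  by (rule ode.solves_props(1)[OF sol_solves])

lemma sol_deriv: "t \<in> period \<Longrightarrow> (sol \<epsilon> p has_vector_derivative vel \<epsilon> p t) (at t within period)"
  unfolding vel_def by (rule ode.solves_props(2)[OF sol_solves])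

lemma sol_closed: "sol \<epsilon> p 0 = sol \<epsilon> p (2 * pi)"
  by (rule ode.solves_props(3)[OF sol_solves])

lemma sol_mean: "integral period (sol \<epsilon> p) = (2 * pi) *\<^sub>R p"
  by (rule ode.solves_props(4)[OF sol_solves])

lemma sol_near: "t \<in> period \<Longrightarrow> norm (sol \<epsilon> p t - p) \<le> \<bar>\<epsilon>\<bar> * (4 * pi * Bc)"
  by (rule ode.solves_props(5)[OF sol_solves])

lemma sol_in_Q: assumes "p \<in> D" "t \<in> period" shows "sol \<epsilon> p t \<in> Q"
proof -
  have "sol \<epsilon> p t \<in> cball p \<delta>"
    using order_trans[OF sol_near[OF assms(2)] \<epsilon>0(4)[OF e], of p] by (simp add: dist_norm norm_minus_commute)
  then show ?thesis using tube[OF assms(1)] by blast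
qed

lemma sol_in_H2: "p \<in> D \<Longrightarrow> t \<in> period \<Longrightarrow> sol \<epsilon> p t \<in> H2"
  using sol_in_Q Q(3) by blast

lemma vel_eq:
  assumes "p \<in> D" "t \<in> period"
  shows "vel \<epsilon> p t = \<epsilon> *\<^sub>R (field_\<Phi> k K \<epsilon> t (sol \<epsilon> p t) + field_\<sigma> k K \<epsilon> t (sol \<epsilon> p t) *\<^sub>R \<gamma> \<epsilon> p)"
  unfolding vel_def ode.rhs_def \<gamma>_def[symmetric] \<Phi>c_def \<sigma>c_def cpQ_id[OF sol_in_Q[OF assms]] ..

lemma sol_den_pos: "p \<in> D \<Longrightarrow> t \<in> period \<Longrightarrow> den k K \<epsilon> t (sol \<epsilon> p t) > 0"
  by (rule den_pos[OF _ \<epsilon>0(2)[OF e] sol_in_Q])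

lemma vel_continuous: "continuous_on period (vel \<epsilon> p)"
  unfolding vel_def by (intro continuous_intros ode.continuous_on_rhs sol_continuous)

lemma sol_lipschitz:
  assumes "t \<in> period"
  shows "norm (sol \<epsilon> q t - sol \<epsilon> p t) \<le> 2 * norm (q - p)"
    and "norm (vel \<epsilon> q t - vel \<epsilon> p t) \<le> (\<epsilon>0 * (Cc * 2)) * norm (q - p)"
proof -
  note l = ode.solves_lipschitz[OF sol_solves sol_solves \<epsilon>0(3)[OF e] assms]
  show "norm (sol \<epsilon> q t - sol \<epsilon> p t) \<le> 2 * norm (q - p)" by (rule l(1))
  have "norm (vel \<epsilon> q t - vel \<epsilon> p t) = \<bar>\<epsilon>\<bar> * norm (ode.rhs (sol \<epsilon> q) t - ode.rhs (sol \<epsilon> p) t)"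
    unfolding vel_def scaleR_diff_right[symmetric] by simp
  also have "\<dots> \<le> \<epsilon>0 * (Cc * (2 * norm (q - p)))"
    by (rule mult_mono[OF e l(2)]) (use \<epsilon>0(1) in auto)
  finally show "norm (vel \<epsilon> q t - vel \<epsilon> p t) \<le> (\<epsilon>0 * (Cc * 2)) * norm (q - p)" by simp
qed

lemma \<gamma>_lipschitz: "norm (\<gamma> \<epsilon> q - \<gamma> \<epsilon> p) \<le> (M * (1 / s + M / s\<^sup>2) * 2) * norm (q - p)"
  unfolding \<gamma>_def
  using ode.mult_lipschitz[OF sol_continuous sol_continuous sol_lipschitz(1), of q p] by (simp only: mult.assoc)

text \<open>The solution for \<epsilon> = 0 is the constant \<open>p\<close>, and the one for
  \<epsilon> differs from it by a multiple of \<epsilon>. Joint Lipschitz bounds then bring both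
  integrands in the quotient defining \<open>\<gamma>\<close> within the same \<open>b\<close>, so
  the rate is linear and uniform in \<open>p\<close>.\<close>

lemma \<gamma>_near_0:
  assumes p: "p \<in> D"
  shows "norm (\<gamma> \<epsilon> p - \<gamma> 0 p) \<le> (M * (1 + 4 * pi * Bc) * (1 / s + M / s\<^sup>2)) * \<bar>\<epsilon>\<bar>"
proof -
  have e0: "\<bar>0\<bar> \<le> \<epsilon>0" using \<epsilon>0(1) by simp
  interpret o0: closed_ode "\<Phi>c 0" "\<sigma>c 0" M M s by (rule clamped_ode[OF \<epsilon>0(2)[OF e0]])
  have c0: "continuous_on period (sol 0 p)"
    unfolding sol_def by (rule o0.solves_props(1)[OF someI_ex[OF o0.solves_exists[OF \<epsilon>0(3)[OF e0]]]])
  have s0: "sol 0 p t = p" if "t \<in> period" for t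
    using o0.solves_props(5)[OF someI_ex[OF o0.solves_exists[OF \<epsilon>0(3)[OF e0]]], of t p] that
    unfolding sol_def by simp
  have pQ: "p \<in> Q" using tube[OF p] \<delta> by (auto simp: subset_iff)
  define b where "b = M * (1 + 4 * pi * Bc) * \<bar>\<epsilon>\<bar>"
  have mono: "M * (\<bar>\<epsilon> - 0\<bar> + norm (sol \<epsilon> p t - sol 0 p t)) \<le> b" if t: "t \<in> period" for t
  proof -
    have "\<bar>\<epsilon> - 0\<bar> + norm (sol \<epsilon> p t - sol 0 p t) \<le> (1 + 4 * pi * Bc) * \<bar>\<epsilon>\<bar>"
      using sol_near[OF t, of p] unfolding s0[OF t] by (simp add: algebra_simps)
    from mult_left_mono[OF this M0] show ?thesis by (simp add: b_def mult.assoc)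
  qed
  have "norm (\<gamma> \<epsilon> p - \<gamma> 0 p) \<le> b * (1 / s + M / s\<^sup>2)"
    unfolding \<gamma>_def ode.mult_def o0.mult_def minus_diff_minus norm_minus_cancel
  proof (rule quotient_of_integrals(1)[OF ode.cont_\<Phi>[OF sol_continuous] o0.cont_\<Phi>[OF c0]
        ode.cont_\<sigma>[OF sol_continuous] o0.cont_\<sigma>[OF c0] o0.bound_\<Phi> s ode.s_le o0.s_le])
    fix t :: real assume t: "t \<in> period"
    have q: "sol 0 p t \<in> Q" using s0[OF t] pQ by simp
    note m = mono[OF t] and i = cpQ_id[OF sol_in_Q[OF p t]] cpQ_id[OF q]
      and a = t \<epsilon>0(2)[OF e] sol_in_Q[OF p t] \<epsilon>0(2)[OF e0] q
    show "norm (\<Phi>c \<epsilon> t (sol \<epsilon> p t) - \<Phi>c 0 t (sol 0 p t)) \<le> b"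
      unfolding \<Phi>c_def i by (rule order_trans[OF \<Phi>_lip[OF a] m])
    show "norm (\<sigma>c \<epsilon> t (sol \<epsilon> p t) - \<sigma>c 0 t (sol 0 p t)) \<le> b"
      unfolding \<sigma>c_def i by (rule order_trans[OF \<sigma>_lip[OF a] m])
  qed
  then show ?thesis by (simp add: b_def mult_ac)
qed

end

lemma zero_le_\<epsilon>0: "\<bar>0\<bar> \<le> \<epsilon>0" using \<epsilon>0(1) by simp

lemma sol_0: "t \<in> period \<Longrightarrow> sol 0 p t = p"
  using sol_near[OF zero_le_\<epsilon>0, of t p] by simp

lemma D_in_Q: "p \<in> D \<Longrightarrow> p \<in> Q" using tube[of p] \<delta> by (auto simp: subset_iff)

lemma D_in_H2: "p \<in> D \<Longrightarrow> p \<in> H2" using D_in_Q Q(3) by blast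

definition loop_of :: "real \<Rightarrow> complex \<Rightarrow> real \<Rightarrow> complex" where
  "loop_of \<epsilon> p t = omega_at k (sol \<epsilon> p t) (cis t)"

definition loop_of' :: "real \<Rightarrow> complex \<Rightarrow> real \<Rightarrow> complex" where
  "loop_of' \<epsilon> p t = omega_at k (vel \<epsilon> p t) (cis t) + Im (sol \<epsilon> p t) *\<^sub>R omega_dot k (cis t)"

text \<open>The term with \<open>B1\<close> stands for \<open>k\<close> times hyperbolic area minus length: up to a constant, this is
  \<open>1 / R k\<close> times the hyperbolic area enclosed by the coordinate curve \<open>sol \<epsilon> p\<close>.\<close>

definition reduced :: "real \<Rightarrow> complex \<Rightarrow> real" where
  "reduced \<epsilon> p = loop_integral B (loop_of \<epsilon> p) (loop_of' \<epsilon> p)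
     + 1 / (\<epsilon> * R k) * loop_integral B1 (sol \<epsilon> p) (vel \<epsilon> p)"

text \<open>The factor \<open>- \<i>\<close> turns \<open>cross h \<gamma>\<close> into an inner
  product, and \<open>2 * pi\<close> is the length of the period over which \<open>h\<close> has
  mean \<open>q - p\<close>. Unlike \<open>reduced\<close>, the formula involves no division by
  \<epsilon>; at 0 it is the gradient of \<open>F K k\<close>.\<close>

definition grad_reduced :: "real \<Rightarrow> complex \<Rightarrow> complex" where
  "grad_reduced \<epsilon> p = (2 * pi / R k) *\<^sub>R (- \<i> * \<gamma> \<epsilon> p)"

lemma continuous_on_omega_dot_cis: "continuous_on T (\<lambda>t. omega_dot k (cis t))"
proof -
  have "k - sin t \<noteq> 0" for t using k sin_le_one[of t] by linarith
  then show ?thesis using R_identities(1)[OF k] unfolding omega_dot_def by (intro continuous_intros) auto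
qed

lemma closed_curve_sol: "\<bar>\<epsilon>\<bar> \<le> \<epsilon>0 \<Longrightarrow> p \<in> D \<Longrightarrow> closed_curve (sol \<epsilon> p) (vel \<epsilon> p)"
  unfolding closed_curve_def using sol_deriv sol_in_H2 vel_continuous sol_closed by blast

lemma closed_curve_loop:
  assumes e: "\<bar>\<epsilon>\<bar> \<le> \<epsilon>0" and p: "p \<in> D" shows "closed_curve (loop_of \<epsilon> p) (loop_of' \<epsilon> p)"
  unfolding closed_curve_def
proof (intro conjI ballI)
  fix t :: real assume t: "t \<in> period"
  show "(loop_of \<epsilon> p has_vector_derivative loop_of' \<epsilon> p t) (at t within period)"
    unfolding loop_of_def[abs_def] loop_of'_def
    by (rule omega_at_curve_deriv[OF k sol_deriv[OF e t]])
  show "loop_of \<epsilon> p t \<in> H2"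
    unfolding loop_of_def by (rule omega_at_in_H2[OF k sol_in_H2[OF e p t]]) simp
next
  show "continuous_on period (loop_of' \<epsilon> p)"
    unfolding loop_of'_def
    by (intro continuous_intros continuous_on_omega_at_period[OF k] vel_continuous sol_continuous e
        continuous_on_omega_dot_cis)
  show "loop_of \<epsilon> p 0 = loop_of \<epsilon> p (2 * pi)"
    unfolding loop_of_def sol_closed[OF e] by simp
qed

section \<open>The gradient of the reduced function and its limit\<close>

lemma cross_eq_inner: "cross h g = h \<bullet> (- \<i> * g)"
  by (simp add: cross_def inner_complex_def)

text \<open>Nothing is differentiated in \<open>p\<close>: passing to \<open>q\<close> changes the
  solution and its velocity by at most a multiple of \<open>norm (q - p)\<close>, so the first
  variation applies to both integrals. The linear parts together pair
  \<open>h = sol \<epsilon> q - sol \<epsilon> p\<close> with a constant vector, and the integral of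
  \<open>h\<close> is \<open>(2 * pi) *\<^sub>R (q - p)\<close> by the mean condition.\<close>

lemma GDERIV_reduced:
  assumes e: "\<bar>\<epsilon>\<bar> \<le> \<epsilon>0" "\<epsilon> \<noteq> 0" and p: "p \<in> D"
  shows "GDERIV (reduced \<epsilon>) p :> grad_reduced \<epsilon> p"
proof (rule GDERIV_of_variation[OF D(1) p])
  fix \<eta> :: real assume \<eta>: "\<eta> > 0"
  note R = R_identities(1)[OF k]
  obtain c where c: "c > 0" "\<And>x. x \<in> S1 \<Longrightarrow> norm (omega_dot k x) \<le> c" "\<And>x h. x \<in> S1 \<Longrightarrow> norm (omega_at k h x) \<le> c * norm h"
    using omega_bounds[OF k] by blast
  define l where "l = 2 + \<epsilon>0 * (Cc * 2)"
  have l: "l \<ge> 2" "\<epsilon>0 * (Cc * 2) \<le> l" using Bc_Cc_nonneg \<epsilon>0(1) by (auto simp: l_def)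
  \<comment> \<open>Dominates all Lipschitz constants at once: \<open>c * 2\<close> and
    \<open>c * l + 2 * c\<close> for the loop and its velocity, 2 and \<open>l\<close> for the
    coordinate curve and its velocity.\<close>
  define b where "b = c * l + 2 * c + l"
  have b: "0 \<le> b" "2 \<le> b" "l \<le> b" "c * 2 \<le> b"
  proof -
    have "0 \<le> c * l" using c(1) l(1) by simp
    then show "0 \<le> b" "2 \<le> b" "l \<le> b" "c * 2 \<le> b" using c(1) l(1) unfolding b_def by linarith+
  qed
  let ?U = "loop_of \<epsilon> p" and ?U' = "loop_of' \<epsilon> p" and ?v = "sol \<epsilon> p" and ?v' = "vel \<epsilon> p"
  let ?H = "\<lambda>q t. sol \<epsilon> q t - sol \<epsilon> p t"
  \<comment> \<open>The tolerance for the \<open>B1\<close> integral carries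
    \<open>\<bar>\<epsilon>\<bar> * R k\<close> to offset the prefactor
    \<open>1 / (\<epsilon> * R k)\<close> in \<open>reduced\<close>.\<close>
  have \<eta>1: "\<eta> / 2 > 0" "\<eta> / 2 * (\<bar>\<epsilon>\<bar> * R k) > 0" using \<eta> e(2) R by simp_all
  obtain d1 where d1: "d1 > 0" "\<And>r V V'. 0 \<le> r \<Longrightarrow> r < d1 \<Longrightarrow> closed_curve V V' \<Longrightarrow>
     (\<And>t. t\<in>period \<Longrightarrow> norm (V t - ?U t) \<le> b * r \<and> norm (V' t - ?U' t) \<le> b * r) \<Longrightarrow>
     \<bar>loop_integral B V V' - loop_integral B ?U ?U'
        - integral period (\<lambda>t. Re (gB (?U t)) * cross (V t - ?U t) (?U' t))\<bar> \<le> \<eta> / 2 * r"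
    using loop_integral_first_variation[OF B(1,2) closed_curve_loop[OF e(1) p] \<eta>1(1) b(1)] by blast
  obtain d2 where d2: "d2 > 0" "\<And>r V V'. 0 \<le> r \<Longrightarrow> r < d2 \<Longrightarrow> closed_curve V V' \<Longrightarrow>
     (\<And>t. t\<in>period \<Longrightarrow> norm (V t - ?v t) \<le> b * r \<and> norm (V' t - ?v' t) \<le> b * r) \<Longrightarrow>
     \<bar>loop_integral B1 V V' - loop_integral B1 ?v ?v'
        - integral period (\<lambda>t. Re (gB1 (?v t)) * cross (V t - ?v t) (?v' t))\<bar> \<le> \<eta> / 2 * (\<bar>\<epsilon>\<bar> * R k) * r"
    using loop_integral_first_variation[OF B1(1,2) closed_curve_sol[OF e(1) p] \<eta>1(2) b(1)] by blast
  show "\<exists>d>0. \<forall>q\<in>D. norm (q - p) < d \<longrightarrow>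
      \<bar>reduced \<epsilon> q - reduced \<epsilon> p - (q - p) \<bullet> grad_reduced \<epsilon> p\<bar> \<le> \<eta> * norm (q - p)"
  proof (intro exI conjI ballI impI)
    show "min d1 d2 > 0" using d1(1) d2(1) by simp
    fix q assume q: "q \<in> D" and n: "norm (q - p) < min d1 d2"
    define r where "r = norm (q - p)"
    have r: "0 \<le> r" "r < d1" "r < d2" using n by (auto simp: r_def)
    define I1 where "I1 t = Re (gB (?U t)) * cross (loop_of \<epsilon> q t - ?U t) (?U' t)" for t
    define I2 where "I2 t = Re (gB1 (?v t)) * cross (?H q t) (?v' t)" for t
    have lv: "norm (?H q t) \<le> 2 * r" "norm (vel \<epsilon> q t - vel \<epsilon> p t) \<le> l * r" if "t \<in> period" for t
    proof -
      note L = sol_lipschitz[OF e(1) that, of q p]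
      show "norm (?H q t) \<le> 2 * r" using L(1) by (simp add: r_def)
      have "(\<epsilon>0 * (Cc * 2)) * r \<le> l * r" by (rule mult_right_mono[OF l(2) r(1)])
      then show "norm (vel \<epsilon> q t - vel \<epsilon> p t) \<le> l * r" using L(2) by (simp add: r_def)
    qed
    have step1: "\<bar>loop_integral B (loop_of \<epsilon> q) (loop_of' \<epsilon> q) - loop_integral B ?U ?U' - integral period I1\<bar> \<le> \<eta> / 2 * r"
      unfolding I1_def
    proof (rule d1(2)[OF r(1,2) closed_curve_loop[OF e(1) q]], intro conjI)
      fix t :: real assume t: "t \<in> period"
      have "norm (loop_of \<epsilon> q t - ?U t) \<le> c * norm (?H q t)"
        unfolding loop_of_def omega_at_linear(2)[symmetric] by (rule c(3)) simp
      also have "\<dots> \<le> c * (2 * r)" by (rule mult_left_mono[OF lv(1)[OF t]]) (use c in simp)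
      also have "\<dots> \<le> b * r" using mult_right_mono[OF b(4) r(1)] by (simp add: mult.assoc)
      finally show "norm (loop_of \<epsilon> q t - ?U t) \<le> b * r" .
      have eq: "loop_of' \<epsilon> q t - ?U' t = omega_at k (vel \<epsilon> q t - vel \<epsilon> p t) (cis t) + Im (?H q t) *\<^sub>R omega_dot k (cis t)"
        by (simp add: loop_of'_def omega_at_linear(2) algebra_simps)
      have "norm (loop_of' \<epsilon> q t - ?U' t) \<le> c * norm (vel \<epsilon> q t - vel \<epsilon> p t) + norm (?H q t) * c"
        unfolding eq
      proof (intro norm_triangle_le add_mono)
        show "norm (omega_at k (vel \<epsilon> q t - vel \<epsilon> p t) (cis t)) \<le> c * norm (vel \<epsilon> q t - vel \<epsilon> p t)" by (rule c(3)) simp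
        show "norm (Im (?H q t) *\<^sub>R omega_dot k (cis t)) \<le> norm (?H q t) * c"
          unfolding norm_scaleR by (intro mult_mono abs_Im_le_cmod c(2)) auto
      qed
      also have "\<dots> \<le> c * (l * r) + (2 * r) * c"
        using lv[OF t] c(1) by (intro add_mono mult_left_mono mult_right_mono) auto
      also have "\<dots> = (c * l + 2 * c) * r" by (simp add: algebra_simps)
      also have "\<dots> \<le> b * r" by (rule mult_right_mono[OF _ r(1)]) (use l in \<open>simp add: b_def\<close>)
      finally show "norm (loop_of' \<epsilon> q t - ?U' t) \<le> b * r" .
    qed
    have step2: "\<bar>loop_integral B1 (sol \<epsilon> q) (vel \<epsilon> q) - loop_integral B1 ?v ?v' - integral period I2\<bar>
        \<le> \<eta> / 2 * (\<bar>\<epsilon>\<bar> * R k) * r"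
      unfolding I2_def
    proof (rule d2(2)[OF r(1,3) closed_curve_sol[OF e(1) q]], intro conjI)
      fix t :: real assume t: "t \<in> period"
      show "norm (?H q t) \<le> b * r" by (rule order_trans[OF lv(1)[OF t] mult_right_mono[OF b(2) r(1)]])
      show "norm (vel \<epsilon> q t - vel \<epsilon> p t) \<le> b * r" by (rule order_trans[OF lv(2)[OF t] mult_right_mono[OF b(3) r(1)]])
    qed
    have cH: "continuous_on period (?H q)" by (intro continuous_intros sol_continuous e)
    have cU: "continuous_on period ?U" by (rule closed_curve_continuous_on[OF closed_curve_loop[OF e(1) p]])
    have cU': "continuous_on period ?U'" using closed_curve_loop[OF e(1) p] by (simp add: closed_curve_def)
    have UH: "?U t \<in> H2" if "t \<in> period" for t using closed_curve_loop[OF e(1) p] that by (simp add: closed_curve_def)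
    have cI1: "continuous_on period I1" unfolding I1_def cross_def
      by (intro continuous_intros cU cU' continuous_on_compose2[OF B(2) cU]
          closed_curve_continuous_on[OF closed_curve_loop[OF e(1) q]]) (use UH in auto)
    have cI2: "continuous_on period I2" unfolding I2_def cross_def
      by (intro continuous_intros sol_continuous vel_continuous e
          continuous_on_compose2[OF B1(2) sol_continuous[OF e(1)]]) (use sol_in_H2[OF e(1) p] in auto)
    note int = integrable_continuous_interval[OF cI1] integrable_continuous_interval[OF cI2]
    have pointwise: "I1 t + 1 / (\<epsilon> * R k) * I2 t = ?H q t \<bullet> ((1 / R k) *\<^sub>R (- \<i> * \<gamma> \<epsilon> p))" if t: "t \<in> period" for t
    proof -
      have den: "den k K \<epsilon> t (sol \<epsilon> p t) \<noteq> 0" using sol_den_pos[OF e(1) p t] by simp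
      note vi = variation_integrand[OF k sol_in_H2[OF e(1) p t] e(2) den vel_eq[OF e(1) p t], of "?H q t"]
      have "I1 t + 1 / (\<epsilon> * R k) * I2 t = cross (?H q t) (\<gamma> \<epsilon> p) / R k"
        unfolding I1_def I2_def B(3)[OF UH[OF t]] B1(3)[OF sol_in_H2[OF e(1) p t]]
        unfolding loop_of_def loop_of'_def omega_at_linear(2)[symmetric] by (rule vi)
      then show ?thesis unfolding cross_eq_inner by (simp add: inner_commute)
    qed
    have "integral period I1 + 1 / (\<epsilon> * R k) * integral period I2 = integral period (\<lambda>t. I1 t + 1 / (\<epsilon> * R k) * I2 t)"
    proof -
      have i2: "(\<lambda>t. 1 / (\<epsilon> * R k) * I2 t) integrable_on period"
        using integrable_cmul[OF int(2), of "1 / (\<epsilon> * R k)"] by simp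
      have "integral period (\<lambda>t. 1 / (\<epsilon> * R k) * I2 t) = 1 / (\<epsilon> * R k) * integral period I2"
        using integral_cmul[of period "1 / (\<epsilon> * R k)" I2] by simp
      then show ?thesis using integral_add[OF int(1) i2] by simp
    qed
    also have "\<dots> = integral period (\<lambda>t. ?H q t \<bullet> ((1 / R k) *\<^sub>R (- \<i> * \<gamma> \<epsilon> p)))"
      by (rule integral_cong) (rule pointwise)
    also have "\<dots> = integral period (?H q) \<bullet> ((1 / R k) *\<^sub>R (- \<i> * \<gamma> \<epsilon> p))"
      using integral_linear[OF integrable_continuous_interval[OF cH] bounded_linear_inner_left] by (simp only: o_def)
    also have "integral period (?H q) = (2 * pi) *\<^sub>R (q - p)"
      using integral_diff[OF integrable_continuous_interval[OF sol_continuous[OF e(1), of q]]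
          integrable_continuous_interval[OF sol_continuous[OF e(1), of p]]]
      by (simp add: sol_mean[OF e(1)] scaleR_diff_right)
    also have "((2 * pi) *\<^sub>R (q - p)) \<bullet> ((1 / R k) *\<^sub>R (- \<i> * \<gamma> \<epsilon> p)) = (q - p) \<bullet> grad_reduced \<epsilon> p"
      by (simp add: grad_reduced_def)
    finally have lin: "integral period I1 + 1 / (\<epsilon> * R k) * integral period I2 = (q - p) \<bullet> grad_reduced \<epsilon> p" .
    define X where "X = loop_integral B (loop_of \<epsilon> q) (loop_of' \<epsilon> q) - loop_integral B ?U ?U' - integral period I1"
    define Y where "Y = loop_integral B1 (sol \<epsilon> q) (vel \<epsilon> q) - loop_integral B1 ?v ?v' - integral period I2"
    have "reduced \<epsilon> q - reduced \<epsilon> p - (q - p) \<bullet> grad_reduced \<epsilon> p = X + 1 / (\<epsilon> * R k) * Y"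
      unfolding lin[symmetric] reduced_def X_def Y_def by (simp add: algebra_simps)
    moreover have "\<bar>1 / (\<epsilon> * R k) * Y\<bar> \<le> \<eta> / 2 * r"
    proof -
      have "\<bar>1 / (\<epsilon> * R k) * Y\<bar> = \<bar>Y\<bar> / (\<bar>\<epsilon>\<bar> * R k)" using R by (simp add: abs_mult)
      also have "\<dots> \<le> (\<eta> / 2 * (\<bar>\<epsilon>\<bar> * R k) * r) / (\<bar>\<epsilon>\<bar> * R k)"
        using step2 R unfolding Y_def by (intro divide_right_mono) auto
      also have "\<dots> = \<eta> / 2 * r" using e(2) R by simp
      finally show ?thesis .
    qed
    ultimately show "\<bar>reduced \<epsilon> q - reduced \<epsilon> p - (q - p) \<bullet> grad_reduced \<epsilon> p\<bar> \<le> \<eta> * norm (q - p)"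
      using step1 unfolding X_def[symmetric] r_def[symmetric] by linarith
  qed
qed

lemma closed_curve_circle:
  assumes "p \<in> H2"
  shows "closed_curve (\<lambda>t. omega_at k p (cis t)) (\<lambda>t. Im p *\<^sub>R omega_dot k (cis t))"
  unfolding closed_curve_def
proof (intro conjI ballI)
  fix t :: real
  have "((\<lambda>t. omega_at k p (cis t)) has_vector_derivative
      omega_at k 0 (cis t) + Im p *\<^sub>R omega_dot k (cis t)) (at t within period)"
    by (rule omega_at_curve_deriv[OF k has_vector_derivative_const])
  then show "((\<lambda>t. omega_at k p (cis t)) has_vector_derivative Im p *\<^sub>R omega_dot k (cis t)) (at t within period)"
    by (simp add: omega_at_def)
  show "omega_at k p (cis t) \<in> H2" by (rule omega_at_in_H2[OF k assms]) simp
qed (auto intro!: continuous_intros continuous_on_omega_dot_cis)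

text \<open>At \<epsilon> = 0 the coordinate curve is constant and \<open>den\<close> is 1, so
  \<open>\<gamma>\<close> is an explicit quotient with denominator
  \<open>2 * pi * (Im p)\<^sup>2\<close>. The factors \<open>\<i>\<close> of
  \<open>field_\<Phi>\<close> and \<open>- \<i>\<close> of \<open>grad_reduced\<close> cancel and
  leave the vector that \<open>variation_integrand_circle\<close> pairs with
  \<open>h\<close>.\<close>

lemma grad_reduced_0:
  assumes p: "p \<in> D"
  shows "grad_reduced 0 p = integral period (\<lambda>t. (R k * K (omega_at k p (cis t)) / Im p) *\<^sub>R cis t)"
proof -
  interpret o0: closed_ode "\<Phi>c 0" "\<sigma>c 0" M M s by (rule clamped_ode[OF \<epsilon>0(2)[OF zero_le_\<epsilon>0]])
  define w where "w t = (R k * K (omega_at k p (cis t)) / Im p) *\<^sub>R cis t" for t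
  have R: "R k > 0" and y: "Im p > 0" using R_identities[OF k] D_in_H2[OF p] by (auto simp: H2_def)
  have "continuous_on period (\<lambda>t. K (omega_at k p (cis t)))"
    by (rule continuous_on_compose2[OF GDERIV_imp_continuous_on[OF K]
          closed_curve_continuous_on[OF closed_curve_circle[OF D_in_H2[OF p]]]])
      (use omega_at_in_H2[OF k D_in_H2[OF p]] in auto)
  then have "continuous_on period w" unfolding w_def using y by (intro continuous_intros) auto
  then have wi: "w integrable_on period" by (rule integrable_continuous_interval)
  have "integral period (\<lambda>t. \<sigma>c 0 t (sol 0 p t)) = integral period (\<lambda>t. (Im p)\<^sup>2)"
    by (rule integral_cong) (simp add: sol_0 \<sigma>c_def cpQ_id[OF D_in_Q[OF p]] field_\<sigma>_def den_def)
  then have I1: "integral period (\<lambda>t. \<sigma>c 0 t (sol 0 p t)) = 2 * pi * (Im p)\<^sup>2" by simp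
  have "integral period (\<lambda>t. \<Phi>c 0 t (sol 0 p t)) = integral period (\<lambda>t. - (R k * (Im p)\<^sup>2) *\<^sub>R (\<i> * w t))"
  proof (rule integral_cong)
    fix t :: real assume t: "t \<in> period"
    have "(R k)\<^sup>2 * Im p * c = R k * (Im p)\<^sup>2 * (R k * c / Im p)" for c
      using y by (simp add: power2_eq_square)
    then show "\<Phi>c 0 t (sol 0 p t) = - (R k * (Im p)\<^sup>2) *\<^sub>R (\<i> * w t)"
      by (simp add: sol_0[OF t] \<Phi>c_def cpQ_id[OF D_in_Q[OF p]] field_\<Phi>_def den_def w_def)
  qed
  also have "\<dots> = - (R k * (Im p)\<^sup>2) *\<^sub>R (\<i> * integral period w)"
    using integral_linear[OF wi bounded_linear_mult_right[of "\<i>"]] by (simp add: o_def)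
  finally have I2: "integral period (\<lambda>t. \<Phi>c 0 t (sol 0 p t)) = - (R k * (Im p)\<^sup>2) *\<^sub>R (\<i> * integral period w)" .
  have "\<gamma> 0 p = (R k / (2 * pi)) *\<^sub>R (\<i> * integral period w)"
    unfolding \<gamma>_def o0.mult_def I1 I2 using y by simp
  moreover have "- \<i> * (r *\<^sub>R (\<i> * c)) = r *\<^sub>R c" for r c by (simp add: complex_eq_iff)
  ultimately have "grad_reduced 0 p = (2 * pi / R k * (R k / (2 * pi))) *\<^sub>R integral period w"
    unfolding grad_reduced_def by (simp only: scaleR_scaleR)
  then show ?thesis using R unfolding w_def[abs_def] by simp
qed

text \<open>Green's formula replaces the moving disk by an integral over a fixed interval, to which
  the first variation applies; its linear part is the vector of
  \<open>grad_reduced_0\<close>.\<close>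

lemma GDERIV_F:
  assumes p: "p \<in> D"
  shows "GDERIV (F K k) p :> grad_reduced 0 p"
proof (rule GDERIV_of_variation[OF D(1) p])
  fix \<eta> :: real assume \<eta>: "\<eta> > 0"
  obtain c where c: "c > 0" "\<And>x. x \<in> S1 \<Longrightarrow> norm (omega_dot k x) \<le> c" "\<And>x h. x \<in> S1 \<Longrightarrow> norm (omega_at k h x) \<le> c * norm h"
    using omega_bounds[OF k] by blast
  let ?U = "\<lambda>q t. omega_at k q (cis t)" and ?U' = "\<lambda>q t. Im q *\<^sub>R omega_dot k (cis t)"
  have c0: "0 \<le> c" using c(1) by simp
  have Fq: "F K k q = loop_integral B (?U q) (?U' q)" if "q \<in> D" for q
    by (rule Green_hyp_disk[OF k D_in_H2[OF that] K B(1) B(3)])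
  obtain d where d: "d > 0" "\<And>r V V'. 0 \<le> r \<Longrightarrow> r < d \<Longrightarrow> closed_curve V V' \<Longrightarrow>
     (\<And>t. t\<in>period \<Longrightarrow> norm (V t - ?U p t) \<le> c * r \<and> norm (V' t - ?U' p t) \<le> c * r) \<Longrightarrow>
     \<bar>loop_integral B V V' - loop_integral B (?U p) (?U' p)
        - integral period (\<lambda>t. Re (gB (?U p t)) * cross (V t - ?U p t) (?U' p t))\<bar> \<le> \<eta> * r"
    using loop_integral_first_variation[OF B(1,2) closed_curve_circle[OF D_in_H2[OF p]] \<eta> c0] by blast
  define w where "w t = (R k * K (?U p t) / Im p) *\<^sub>R cis t" for t
  have y: "Im p > 0" using D_in_H2[OF p] by (simp add: H2_def)
  have UH: "?U p t \<in> H2" for t by (rule omega_at_in_H2[OF k D_in_H2[OF p]]) simp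
  have "continuous_on period (\<lambda>t. K (?U p t))"
    by (rule continuous_on_compose2[OF GDERIV_imp_continuous_on[OF K]
          closed_curve_continuous_on[OF closed_curve_circle[OF D_in_H2[OF p]]]]) (use UH in auto)
  then have "continuous_on period w" unfolding w_def using y by (intro continuous_intros) auto
  then have wi: "w integrable_on period" by (rule integrable_continuous_interval)
  show "\<exists>d>0. \<forall>q\<in>D. norm (q - p) < d \<longrightarrow>
      \<bar>F K k q - F K k p - (q - p) \<bullet> grad_reduced 0 p\<bar> \<le> \<eta> * norm (q - p)"
  proof (intro exI conjI ballI impI)
    show "d > 0" by (rule d(1))
    fix q assume q: "q \<in> D" and n: "norm (q - p) < d"
    have "integral period (\<lambda>t. Re (gB (?U p t)) * cross (?U q t - ?U p t) (?U' p t))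
        = integral period (\<lambda>t. (q - p) \<bullet> w t)"
    proof (rule integral_cong)
      fix t :: real
      show "Re (gB (?U p t)) * cross (?U q t - ?U p t) (?U' p t) = (q - p) \<bullet> w t"
        unfolding B(3)[OF UH] omega_at_linear(2)[symmetric]
        by (subst variation_integrand_circle[OF k D_in_H2[OF p]]) (simp_all add: w_def)
    qed
    also have "\<dots> = (q - p) \<bullet> integral period w"
      using integral_linear[OF wi bounded_linear_inner_right] by (simp only: o_def)
    also have "integral period w = grad_reduced 0 p"
      unfolding grad_reduced_0[OF p] w_def ..
    finally have lin: "integral period (\<lambda>t. Re (gB (?U p t)) * cross (?U q t - ?U p t) (?U' p t))
        = (q - p) \<bullet> grad_reduced 0 p" .
    show "\<bar>F K k q - F K k p - (q - p) \<bullet> grad_reduced 0 p\<bar> \<le> \<eta> * norm (q - p)"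
      unfolding Fq[OF p] Fq[OF q] lin[symmetric]
    proof (rule d(2)[OF norm_ge_zero n closed_curve_circle[OF D_in_H2[OF q]]], intro conjI)
      fix t :: real
      show "norm (?U q t - ?U p t) \<le> c * norm (q - p)"
        unfolding omega_at_linear(2)[symmetric] by (rule c(3)) simp
      have "norm (?U' q t - ?U' p t) = \<bar>Im (q - p)\<bar> * norm (omega_dot k (cis t))"
        by (simp add: scaleR_diff_left[symmetric])
      also have "\<dots> \<le> norm (q - p) * c" by (intro mult_mono abs_Im_le_cmod c(2)) auto
      finally show "norm (?U' q t - ?U' p t) \<le> c * norm (q - p)" by (simp add: mult.commute)
    qed
  qed
qed

lemma grad_reduced_continuous:
  assumes e: "\<bar>\<epsilon>\<bar> \<le> \<epsilon>0"
  shows "continuous_on T (grad_reduced \<epsilon>)"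
proof -
  have "(M * (1 / s + M / s\<^sup>2) * 2)-lipschitz_on T (\<gamma> \<epsilon>)"
    by (rule lipschitz_onI) (use \<gamma>_lipschitz[OF e] M0 s in \<open>auto simp: dist_norm\<close>)
  then have "continuous_on T (\<gamma> \<epsilon>)" by (rule lipschitz_on_continuous_on)
  then show ?thesis unfolding grad_reduced_def[abs_def] by (intro continuous_intros)
qed

lemma grad_reduced_near_0:
  "\<exists>c\<ge>0. \<forall>\<epsilon> p. \<bar>\<epsilon>\<bar> \<le> \<epsilon>0 \<and> p \<in> D \<longrightarrow> norm (grad_reduced \<epsilon> p - grad_reduced 0 p) \<le> c * \<bar>\<epsilon>\<bar>"
proof -
  define a where "a = M * (1 + 4 * pi * Bc) * (1 / s + M / s\<^sup>2)"
  have R: "R k > 0" using R_identities[OF k] by simp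
  have a: "0 \<le> a" unfolding a_def using M0 s Bc_Cc_nonneg by simp
  have "norm (grad_reduced \<epsilon> p - grad_reduced 0 p) \<le> (2 * pi / R k * a) * \<bar>\<epsilon>\<bar>" if "\<bar>\<epsilon>\<bar> \<le> \<epsilon>0" "p \<in> D" for \<epsilon> p
  proof -
    have "grad_reduced \<epsilon> p - grad_reduced 0 p = (2 * pi / R k) *\<^sub>R (- \<i> * (\<gamma> \<epsilon> p - \<gamma> 0 p))"
      by (simp add: grad_reduced_def algebra_simps)
    then have "norm (grad_reduced \<epsilon> p - grad_reduced 0 p) = 2 * pi / R k * norm (\<gamma> \<epsilon> p - \<gamma> 0 p)"
      using R by (simp add: norm_mult)
    also have "\<dots> \<le> 2 * pi / R k * (a * \<bar>\<epsilon>\<bar>)"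
      using \<gamma>_near_0[OF that] R unfolding a_def by (intro mult_left_mono) auto
    finally show ?thesis by simp
  qed
  moreover have "0 \<le> 2 * pi / R k * a" using R a by simp
  ultimately show ?thesis by blast
qed

section \<open>From zeros of the multiplier to loops\<close>

lemma loop_of_critical_point:
  assumes e: "\<bar>\<epsilon>\<bar> \<le> \<epsilon>0" and p: "p \<in> D" and crit: "grad_reduced \<epsilon> p = 0"
  shows "loop_ode k K \<epsilon> (\<lambda>x. omega_at k (sol \<epsilon> p (Arg2pi x)) x)"
  unfolding loop_ode_def
proof (intro ballI)
  fix x :: complex assume x: "x \<in> S1"
  define t where "t = Arg2pi x"
  have t: "t \<in> period" using Arg2pi_ge_0 Arg2pi_lt_2pi[of x] by (simp add: t_def less_imp_le)
  have xt: "x = cis t" unfolding t_def by (rule circle_eq_cis[OF x])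
  have \<gamma>: "\<gamma> \<epsilon> p = 0" using crit R_identities(1)[OF k] by (simp add: grad_reduced_def)
  have vel: "vel \<epsilon> p t = \<epsilon> *\<^sub>R field_\<Phi> k K \<epsilon> t (sol \<epsilon> p t)" if "t \<in> period" for t
    using vel_eq[OF e p that] \<gamma> by simp
  \<comment> \<open>\<open>field_\<Phi>\<close> depends on \<open>t\<close> only through
    \<open>cis t\<close> and \<open>sin t\<close>, and the solution is closed, so the velocities
    match at the ends; this permits the passage to the circle.\<close>
  have vel_closed: "vel \<epsilon> p 0 = vel \<epsilon> p (2 * pi)"
    unfolding vel[OF period_0] vel[OF period_top] sol_closed[OF e] by (simp add: field_\<Phi>_def den_def)
  define v where "v = (\<lambda>r. sol \<epsilon> p (Arg2pi (x * cis r)))"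
  have v0: "v 0 = sol \<epsilon> p t" by (simp add: v_def t_def)
  have dv: "(v has_vector_derivative vel \<epsilon> p t) (at 0)"
    unfolding v_def t_def
    by (rule periodic_has_vector_derivative[OF sol_deriv[OF e] sol_closed[OF e] vel_closed x])
  have "((\<lambda>r. Re (v r) *\<^sub>R 1 + Im (v r) *\<^sub>R omega k (x * cis r)) has_vector_derivative
      Re (vel \<epsilon> p t) *\<^sub>R 1 + (Im (v 0) *\<^sub>R omega_dot k x + Im (vel \<epsilon> p t) *\<^sub>R omega k (x * cis 0))) (at 0)"
    by (intro has_vector_derivative_add has_vector_derivative_scaleR has_real_derivative_Im[OF dv]
        bounded_linear.has_vector_derivative[OF bounded_linear_scaleR_left]
        has_real_derivative_Re[OF dv, unfolded has_real_derivative_iff_has_vector_derivative]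
        omega_circle_deriv[OF k x])
  then have "((\<lambda>r. omega_at k (v r) (x * cis r)) has_vector_derivative
      omega_at k (vel \<epsilon> p t) x + Im (sol \<epsilon> p t) *\<^sub>R omega_dot k x) (at 0)"
    unfolding v0 by (simp add: omega_at_def algebra_simps)
  moreover have "omega_at k (vel \<epsilon> p t) x + Im (sol \<epsilon> p t) *\<^sub>R omega_dot k x
      = speed k K \<epsilon> x (omega_at k (sol \<epsilon> p t) x) *\<^sub>R omega_dot k x"
    unfolding vel[OF t] xt
    by (rule field_\<Phi>_velocity[OF k sol_in_H2[OF e p t]]) (use sol_den_pos[OF e p t] in simp)
  ultimately have der: "((\<lambda>r. omega_at k (v r) (x * cis r)) has_vector_derivative
      speed k K \<epsilon> x (omega_at k (sol \<epsilon> p t) x) *\<^sub>R omega_dot k x) (at 0)" by simp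
  have "0 < 1 + \<epsilon> * ((R k)\<^sup>2 * (k - sin t) * K (omega_at k (sol \<epsilon> p t) (cis t)))"
    using sol_den_pos[OF e p t] unfolding den_def .
  then have "0 < 1 + \<epsilon> * (R k)\<^sup>2 * (k - Im x) * K (omega_at k (sol \<epsilon> p t) x)"
    unfolding xt by (simp add: mult.assoc)
  with der omega_at_in_H2[OF k sol_in_H2[OF e p t] x]
  show "omega_at k (sol \<epsilon> p (Arg2pi x)) x \<in> H2 \<and>
      0 < 1 + \<epsilon> * (R k)\<^sup>2 * (k - Im x) * K (omega_at k (sol \<epsilon> p (Arg2pi x)) x) \<and>
      ((\<lambda>r. omega_at k (sol \<epsilon> p (Arg2pi (x * cis r))) (x * cis r)) has_vector_derivative
        speed k K \<epsilon> x (omega_at k (sol \<epsilon> p (Arg2pi x)) x) *\<^sub>R omega_dot k x) (at 0)"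
    unfolding t_def v_def by blast
qed

text \<open>Stability is applied to a function \<open>G\<close> with gradient
  \<open>grad_reduced \<epsilon>\<close>, whose critical points are the zeros of
  \<open>\<gamma> \<epsilon>\<close>. By the linear rate of \<open>grad_reduced_near_0\<close>, such
  a point is almost critical for \<open>F K k\<close>; this last bound later identifies the
  limits.\<close>

lemma loops_near_stable_critical_point:
  assumes A: "open A" "closure A \<subseteq> D" and stable: "has_stable_critical_point (F K k) A"
  shows "\<exists>e>0. \<exists>C. \<forall>\<epsilon>. \<bar>\<epsilon>\<bar> < e \<longrightarrow> (\<exists>p\<in>A. \<exists>u. loop_ode k K \<epsilon> u \<and>
     (\<forall>x\<in>S1. norm (u x - omega_at k p x) \<le> C * \<bar>\<epsilon>\<bar>) \<and> norm (grad_reduced 0 p) \<le> C * \<bar>\<epsilon>\<bar>)"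
proof -
  obtain r where Ane: "A \<noteq> {}" and r: "r > 0"
    and st: "\<And>G. C1_closure A G \<Longrightarrow> C1_norm A (\<lambda>z. G z - F K k z) < r \<Longrightarrow> \<exists>z\<in>A. critical_point G z"
    using stable unfolding has_stable_critical_point_def by blast
  have AD: "z \<in> D" if "z \<in> A" for z using that A(2) closure_subset by blast
  obtain p0 where p0: "p0 \<in> A" using Ane by blast
  obtain cg where cg: "cg \<ge> 0"
    "\<And>\<epsilon> p. \<bar>\<epsilon>\<bar> \<le> \<epsilon>0 \<Longrightarrow> p \<in> D \<Longrightarrow> norm (grad_reduced \<epsilon> p - grad_reduced 0 p) \<le> cg * \<bar>\<epsilon>\<bar>"
    using grad_reduced_near_0 by blast
  obtain b0 where b0: "\<And>z. z \<in> D \<Longrightarrow> norm z \<le> b0" using D(3) unfolding bounded_iff by blast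
  define b where "b = 2 * b0"
  have b: "norm (z - p0) \<le> b" if "z \<in> D" for z
    using norm_triangle_ineq4[of z p0] b0[OF that] b0[OF AD[OF p0]] by (simp add: b_def)
  have b_nonneg: "0 \<le> b" using order_trans[OF norm_ge_zero b[OF AD[OF p0]]] .
  obtain c where c: "c > 0" "\<And>x h. x \<in> S1 \<Longrightarrow> norm (omega_at k h x) \<le> c * norm h"
    using omega_bounds[OF k] by blast
  \<comment> \<open>On \<open>closure A\<close> the values of \<open>G - F K k\<close> are at most
    \<open>cg * \<bar>\<epsilon>\<bar> * b\<close>, and on \<open>A\<close> its gradient is at most
    \<open>cg * \<bar>\<epsilon>\<bar>\<close>; this choice makes the sum less than
    \<open>r\<close>.\<close>
  define e where "e = min \<epsilon>0 (r / (cg * (b + 1) + 1))"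
  have pos: "0 < cg * (b + 1) + 1" using cg(1) b_nonneg by (simp add: add_nonneg_pos)
  have e: "e > 0" unfolding e_def using \<epsilon>0(1) r pos by simp
  define C where "C = max cg (c * (4 * pi * Bc))"
  show ?thesis
  proof (rule exI[of _ e], intro conjI e, rule exI[of _ C], intro allI impI)
    fix \<epsilon> :: real assume "\<bar>\<epsilon>\<bar> < e"
    then have \<epsilon>: "\<bar>\<epsilon>\<bar> \<le> \<epsilon>0" and \<epsilon>r: "\<bar>\<epsilon>\<bar> * (cg * (b + 1) + 1) < r"
      using pos by (auto simp: e_def pos_less_divide_eq)
    \<comment> \<open>Only the gradients are known to be close, so an additive constant makes
      \<open>G\<close> agree with \<open>F K k\<close> at \<open>p0\<close>; convexity of
      \<open>D\<close> then bounds the values. At \<epsilon> = 0 the prefactor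
      \<open>1 / (\<epsilon> * R k)\<close> degenerates and \<open>F K k\<close> itself is
      taken.\<close>
    define G where "G = (if \<epsilon> = 0 then F K k else (\<lambda>p. reduced \<epsilon> p - (reduced \<epsilon> p0 - F K k p0)))"
    have dG: "GDERIV G p :> grad_reduced \<epsilon> p" if "p \<in> D" for p
    proof (cases "\<epsilon> = 0")
      case True
      then show ?thesis using GDERIV_F[OF that] by (simp add: G_def)
    next
      case False
      from GDERIV_minus[OF GDERIV_reduced[OF \<epsilon> False that] GDERIV_const]
      show ?thesis using False by (simp add: G_def)
    qed
    have dH: "GDERIV (\<lambda>z. G z - F K k z) p :> grad_reduced \<epsilon> p - grad_reduced 0 p" if "p \<in> D" for p
      by (rule GDERIV_minus[OF dG[OF that] GDERIV_F[OF that]])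
    have H0: "G p0 - F K k p0 = 0" by (simp add: G_def)
    have H: "\<bar>G z - F K k z\<bar> \<le> cg * \<bar>\<epsilon>\<bar> * b" if z: "z \<in> D" for z
    proof -
      have "norm ((G z - F K k z) - (G p0 - F K k p0)) \<le> (cg * \<bar>\<epsilon>\<bar>) * norm (z - p0)"
      proof (rule differentiable_bound[where f = "\<lambda>z. G z - F K k z", OF D(2) _ _ z AD[OF p0]])
        fix y assume y: "y \<in> D"
        show "((\<lambda>z. G z - F K k z) has_derivative (\<lambda>h. h \<bullet> (grad_reduced \<epsilon> y - grad_reduced 0 y))) (at y within D)"
          using dH[OF y] unfolding gderiv_def by (rule has_derivative_at_withinI)
        show "onorm (\<lambda>h. h \<bullet> (grad_reduced \<epsilon> y - grad_reduced 0 y)) \<le> cg * \<bar>\<epsilon>\<bar>"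
        proof (rule onorm_le)
          fix h
          have "norm (h \<bullet> (grad_reduced \<epsilon> y - grad_reduced 0 y)) \<le> norm h * norm (grad_reduced \<epsilon> y - grad_reduced 0 y)"
            unfolding real_norm_def by (rule Cauchy_Schwarz_ineq2)
          also have "\<dots> \<le> norm h * (cg * \<bar>\<epsilon>\<bar>)" by (rule mult_left_mono[OF cg(2)[OF \<epsilon> y]]) simp
          finally show "norm (h \<bullet> (grad_reduced \<epsilon> y - grad_reduced 0 y)) \<le> cg * \<bar>\<epsilon>\<bar> * norm h"
            by (simp add: mult.commute)
        qed
      qed
      also have "\<dots> \<le> (cg * \<bar>\<epsilon>\<bar>) * b" by (rule mult_left_mono[OF b[OF z]]) (use cg in simp)
      finally show ?thesis unfolding H0 by simp
    qed
    have C1: "C1_closure A G" unfolding C1_closure_def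
    proof (intro conjI exI[of _ "grad_reduced \<epsilon>"] ballI grad_reduced_continuous \<epsilon>)
      show "continuous_on (closure A) G"
        by (rule GDERIV_imp_continuous_on[OF dG]) (use A(2) in blast)
      show "GDERIV G z :> grad_reduced \<epsilon> z" if "z \<in> A" for z by (rule dG[OF AD[OF that]])
    qed
    have "C1_norm A (\<lambda>z. G z - F K k z) \<le> cg * \<bar>\<epsilon>\<bar> * b + cg * \<bar>\<epsilon>\<bar>"
      unfolding C1_norm_def
    proof (intro add_mono cSUP_least)
      show "closure A \<noteq> {}" using Ane closure_subset by blast
      show "\<bar>G z - F K k z\<bar> \<le> cg * \<bar>\<epsilon>\<bar> * b" if "z \<in> closure A" for z using H A(2) that by blast
      show "norm (grad (\<lambda>z. G z - F K k z) z) \<le> cg * \<bar>\<epsilon>\<bar>" if "z \<in> A" for z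
        unfolding grad_eq[OF dH[OF AD[OF that]]] by (rule cg(2)[OF \<epsilon> AD[OF that]])
    qed (rule Ane)
    also have "\<dots> = \<bar>\<epsilon>\<bar> * (cg * (b + 1) + 1) - \<bar>\<epsilon>\<bar>" by (simp add: algebra_simps)
    also have "\<dots> < r" using \<epsilon>r by simp
    finally obtain p where p: "p \<in> A" "critical_point G p" using st[OF C1] by blast
    have pD: "p \<in> D" by (rule AD[OF p(1)])
    have crit: "grad_reduced \<epsilon> p = 0"
      using GDERIV_unique[OF dG[OF pD]] p(2) unfolding critical_point_def by blast
    show "\<exists>p\<in>A. \<exists>u. loop_ode k K \<epsilon> u \<and>
     (\<forall>x\<in>S1. norm (u x - omega_at k p x) \<le> C * \<bar>\<epsilon>\<bar>) \<and> norm (grad_reduced 0 p) \<le> C * \<bar>\<epsilon>\<bar>"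
    proof (intro bexI[OF _ p(1)] exI conjI ballI)
      show "loop_ode k K \<epsilon> (\<lambda>x. omega_at k (sol \<epsilon> p (Arg2pi x)) x)"
        by (rule loop_of_critical_point[OF \<epsilon> pD crit])
      fix x :: complex assume x: "x \<in> S1"
      have t: "Arg2pi x \<in> period" using Arg2pi_ge_0 Arg2pi_lt_2pi[of x] by (simp add: less_imp_le)
      have "norm (omega_at k (sol \<epsilon> p (Arg2pi x)) x - omega_at k p x) \<le> c * norm (sol \<epsilon> p (Arg2pi x) - p)"
        unfolding omega_at_linear(2)[symmetric] by (rule c(2)[OF x])
      also have "\<dots> \<le> c * (\<bar>\<epsilon>\<bar> * (4 * pi * Bc))"
        by (rule mult_left_mono[OF sol_near[OF \<epsilon> t]]) (use c in simp)
      also have "\<dots> = (c * (4 * pi * Bc)) * \<bar>\<epsilon>\<bar>" by simp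
      also have "\<dots> \<le> C * \<bar>\<epsilon>\<bar>" by (rule mult_right_mono) (simp_all add: C_def)
      finally show "norm (omega_at k (sol \<epsilon> p (Arg2pi x)) x - omega_at k p x) \<le> C * \<bar>\<epsilon>\<bar>" .
    next
      have "norm (grad_reduced 0 p) \<le> cg * \<bar>\<epsilon>\<bar>" using cg(2)[OF \<epsilon> pD] crit by simp
      also have "\<dots> \<le> C * \<bar>\<epsilon>\<bar>" by (rule mult_right_mono) (simp_all add: C_def)
      finally show "norm (grad_reduced 0 p) \<le> C * \<bar>\<epsilon>\<bar>" .
    qed
  qed
qed

end

section \<open>Existence of the family and identification of its limits\<close>

text \<open>Discharges the auxiliary data of the reduction. The gradient \<open>g\<close> is
  exported on all of \<open>closure A\<close> because limits of the mean values may lie on the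
  boundary, where criticality is read off from the continuity of \<open>g\<close>.\<close>

lemma loops_near_stable_critical_points:
  assumes k: "k > 1" and K: "\<And>z. z \<in> H2 \<Longrightarrow> GDERIV K z :> gK z" and gK: "continuous_on H2 gK"
    and A: "open A" "compactly_in_H2 A" and stable: "has_stable_critical_point (F K k) A"
  shows "\<exists>e>0. \<exists>C g. continuous_on (closure A) g \<and> (\<forall>z\<in>closure A. GDERIV (F K k) z :> g z) \<and>
    (\<forall>\<epsilon>. \<bar>\<epsilon>\<bar> < e \<longrightarrow> (\<exists>p\<in>A. \<exists>u. loop_ode k K \<epsilon> u \<and>
      (\<forall>x\<in>S1. norm (u x - omega_at k p x) \<le> C * \<bar>\<epsilon>\<bar>) \<and> norm (g p) \<le> C * \<bar>\<epsilon>\<bar>))"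
proof -
  interpret half_plane_data k K gK by unfold_locales (fact k, fact K, fact gK)
  have A': "compact (closure A)" "closure A \<subseteq> H2" "closure A \<noteq> {}"
    using A(2) stable unfolding compactly_in_H2_def has_stable_critical_point_def by auto
  obtain Q D \<delta> where Q: "compact Q" "convex Q" "Q \<subseteq> H2" and D: "open D" "convex D" "bounded D"
    and AD: "closure A \<subseteq> D" and \<delta>: "0 < \<delta>" and tube: "\<And>p. p \<in> D \<Longrightarrow> cball p \<delta> \<subseteq> Q"
    using compact_tube_in_H2[OF A'] by blast
  have Qne: "Q \<noteq> {}"
  proof -
    obtain p where "p \<in> closure A" using A'(3) by (auto simp only: ex_in_conv[symmetric])
    then have "p \<in> D" by (rule subsetD[OF AD])
    moreover have "p \<in> cball p \<delta>" using \<delta> by simp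
    ultimately show ?thesis using tube by blast
  qed
  obtain \<epsilon>1 M s where est: "\<epsilon>1 > 0" "M \<ge> 0" "s > 0" "field_bounds k K Q \<epsilon>1 M s"
    using field_bounds_exist[OF Q(1,3) Qne] by blast
  obtain B gB where B: "\<And>z. z \<in> H2 \<Longrightarrow> GDERIV B z :> gB z" "continuous_on H2 gB"
      "\<And>z. z \<in> H2 \<Longrightarrow> Re (gB z) = K z / (Im z)\<^sup>2"
    using area_primitive_exists[OF K gK] by blast
  obtain B1 gB1 where B1: "\<And>z. z \<in> H2 \<Longrightarrow> GDERIV B1 z :> gB1 z" "continuous_on H2 gB1"
      "\<And>z. z \<in> H2 \<Longrightarrow> Re (gB1 z) = 1 / (Im z)\<^sup>2"
    using area_primitive_exists[of "\<lambda>_. 1" "\<lambda>_. 0", OF GDERIV_const continuous_on_const] by blast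
  interpret reduction k K gK Q D \<delta> \<epsilon>1 M s B B1 gB gB1
    by unfold_locales (use Q Qne D \<delta> tube est B B1 in \<open>blast+\<close>)
  obtain e C where eC: "e > 0" "\<forall>\<epsilon>. \<bar>\<epsilon>\<bar> < e \<longrightarrow> (\<exists>p\<in>A. \<exists>u. loop_ode k K \<epsilon> u \<and>
     (\<forall>x\<in>S1. norm (u x - omega_at k p x) \<le> C * \<bar>\<epsilon>\<bar>) \<and> norm (grad_reduced 0 p) \<le> C * \<bar>\<epsilon>\<bar>)"
    using loops_near_stable_critical_point[OF A(1) AD stable] by blast
  show ?thesis
  proof (rule exI[of _ e], intro conjI eC(1), rule exI[of _ C], rule exI[of _ "grad_reduced 0"], intro conjI)
    show "continuous_on (closure A) (grad_reduced 0)" by (rule grad_reduced_continuous[OF zero_le_\<epsilon>0])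
    show "\<forall>z\<in>closure A. GDERIV (F K k) z :> grad_reduced 0 z" using GDERIV_F AD by blast
  qed (rule eC(2))
qed

theorem theorem1p1:
  fixes k :: real and K :: "complex \<Rightarrow> real" and A :: "complex set"
  assumes "k > 1"
    and "C1_on H2 K"
    and "open A" and "compactly_in_H2 A"
    and "has_stable_critical_point (F K k) A"
  shows "\<exists>\<epsilon>\<^sub>0>0. \<exists>u :: real \<Rightarrow> complex \<Rightarrow> complex.
    (\<forall>\<epsilon>. \<bar>\<epsilon>\<bar> < \<epsilon>\<^sub>0 \<longrightarrow> is_H_loop (\<lambda>z. k + \<epsilon> * K z) (u \<epsilon>) \<and> embedded (u \<epsilon>)) \<and>
    (\<forall>e :: nat \<Rightarrow> real. e \<longlonglongrightarrow> 0 \<longrightarrow>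
       (\<exists>s :: nat \<Rightarrow> nat. strict_mono s \<and>
          (\<exists>z\<^sub>0\<in>closure A. critical_point (F K k) z\<^sub>0 \<and>
             C2_tendsto (\<lambda>j. u (e (s j))) (omega_at k z\<^sub>0) sequentially))) \<and>
    (\<forall>z\<^sub>0\<in>A. critical_point (F K k) z\<^sub>0 \<and>
          (\<forall>z\<in>closure A. critical_point (F K k) z \<longrightarrow> z = z\<^sub>0) \<longrightarrow>
       C2_tendsto u (omega_at k z\<^sub>0) (at 0))"
proof -
  note k = assms(1)
  obtain gK where K: "\<And>z. z \<in> H2 \<Longrightarrow> GDERIV K z :> gK z" and gK: "continuous_on H2 gK"
    using assms(2) unfolding C1_on_def by blast
  obtain \<epsilon>0 C g where \<epsilon>0: "\<epsilon>0 > 0" and cg: "continuous_on (closure A) g"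
    and g: "\<And>z. z \<in> closure A \<Longrightarrow> GDERIV (F K k) z :> g z"
    and ex: "\<And>\<epsilon>. \<bar>\<epsilon>\<bar> < \<epsilon>0 \<Longrightarrow> \<exists>p\<in>A. \<exists>u. loop_ode k K \<epsilon> u \<and>
      (\<forall>x\<in>S1. norm (u x - omega_at k p x) \<le> C * \<bar>\<epsilon>\<bar>) \<and> norm (g p) \<le> C * \<bar>\<epsilon>\<bar>"
    using loops_near_stable_critical_points[OF k K gK assms(3-5)] by metis
  have clA: "compact (closure A)" "closure A \<subseteq> H2" using assms(4) by (auto simp: compactly_in_H2_def)
  obtain a where a: "a \<in> A" using assms(5) by (auto simp: has_stable_critical_point_def)
  \<comment> \<open>A default point of \<open>A\<close> is used when
    \<open>\<bar>\<epsilon>\<bar> \<ge> \<epsilon>0\<close>, so that compactness applies to a whole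
    sequence \<open>P (e n)\<close>, including its first terms.\<close>
  have "\<forall>\<epsilon>. \<exists>p u. p \<in> A \<and> (\<bar>\<epsilon>\<bar> < \<epsilon>0 \<longrightarrow> loop_ode k K \<epsilon> u \<and>
      (\<forall>x\<in>S1. norm (u x - omega_at k p x) \<le> C * \<bar>\<epsilon>\<bar>) \<and> norm (g p) \<le> C * \<bar>\<epsilon>\<bar>)"
    using ex a by blast
  then obtain P u where P: "\<And>\<epsilon>. P \<epsilon> \<in> A" and u: "\<And>\<epsilon>. \<bar>\<epsilon>\<bar> < \<epsilon>0 \<Longrightarrow> loop_ode k K \<epsilon> (u \<epsilon>)"
    and near: "\<And>\<epsilon> x. \<bar>\<epsilon>\<bar> < \<epsilon>0 \<Longrightarrow> x \<in> S1 \<Longrightarrow> norm (u \<epsilon> x - omega_at k (P \<epsilon>) x) \<le> C * \<bar>\<epsilon>\<bar>"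
    and small: "\<And>\<epsilon>. \<bar>\<epsilon>\<bar> < \<epsilon>0 \<Longrightarrow> norm (g (P \<epsilon>)) \<le> C * \<bar>\<epsilon>\<bar>"
    by metis
  have Pc: "P \<epsilon> \<in> closure A" for \<epsilon> using P closure_subset by blast
  obtain c where c: "c > 0" "\<And>x h. x \<in> S1 \<Longrightarrow> norm (omega_at k h x) \<le> c * norm h"
    using omega_bounds[OF k] by blast
  have subseq: "\<exists>s :: nat \<Rightarrow> nat. strict_mono s \<and> (\<exists>z\<^sub>0\<in>closure A. critical_point (F K k) z\<^sub>0 \<and>
      C2_tendsto (\<lambda>j. u (e (s j))) (omega_at k z\<^sub>0) sequentially)" if e: "e \<longlonglongrightarrow> 0" for e :: "nat \<Rightarrow> real"
  proof -
    have "\<forall>n. P (e n) \<in> closure A" using Pc by simp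
    then have "\<exists>z\<in>closure A. \<exists>s. strict_mono s \<and> ((\<lambda>n. P (e n)) \<circ> s) \<longlonglongrightarrow> z"
      using clA(1)[unfolded compact_def, THEN spec, of "\<lambda>n. P (e n)"] by blast
    then obtain z s where z: "z \<in> closure A" and s: "strict_mono s" and lim: "(\<lambda>j. P (e (s j))) \<longlonglongrightarrow> z"
      unfolding o_def by blast
    have es: "(\<lambda>j. e (s j)) \<longlonglongrightarrow> 0" using LIMSEQ_subseq_LIMSEQ[OF e s] by (simp add: o_def)
    have ev: "\<forall>\<^sub>F j in sequentially. \<bar>e (s j)\<bar> < \<epsilon>0"
      using tendstoD[OF es \<epsilon>0] by (simp add: dist_real_def)
    have C0: "(\<lambda>j. C * \<bar>e (s j)\<bar>) \<longlonglongrightarrow> 0" using tendsto_mult_right_zero[OF tendsto_rabs_zero[OF es]] .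
    \<comment> \<open>The mean values are almost critical with an error of order \<epsilon>, so
      their limit is critical.\<close>
    have "(\<lambda>j. g (P (e (s j)))) \<longlonglongrightarrow> g z"
      by (rule continuous_on_tendsto_compose[OF cg lim z]) (simp add: Pc)
    moreover have "(\<lambda>j. g (P (e (s j)))) \<longlonglongrightarrow> 0"
      by (rule Lim_null_comparison[OF _ C0]) (use ev small in \<open>auto elim: eventually_mono\<close>)
    ultimately have "g z = 0" by (rule LIMSEQ_unique)
    then have crit: "critical_point (F K k) z" using g[OF z] by (simp add: critical_point_def)
    have "(\<lambda>j. norm (P (e (s j)) - z)) \<longlonglongrightarrow> 0" using lim by (simp add: LIM_zero tendsto_norm_zero)
    then have "(\<lambda>j. C * \<bar>e (s j)\<bar> + c * norm (P (e (s j)) - z)) \<longlonglongrightarrow> 0"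
      using tendsto_add_zero[OF C0 tendsto_mult_right_zero] by blast
    then have bound: "\<forall>\<^sub>F j in sequentially. C * \<bar>e (s j)\<bar> + c * norm (P (e (s j)) - z) < \<eta>" if "\<eta> > 0" for \<eta>
      using order_tendstoD(2) that by blast
    have "C2_tendsto (\<lambda>j. u (e (s j))) (omega_at k z) sequentially"
    proof (rule loop_ode_C2_tendsto[OF k K gK _ es])
      show "z \<in> H2" using z clA(2) by blast
      show "\<forall>\<^sub>F j in sequentially. loop_ode k K (e (s j)) (u (e (s j)))"
        using ev by (rule eventually_mono) (rule u)
      fix \<eta> :: real assume "\<eta> > 0"
      from ev bound[OF this]
      show "\<forall>\<^sub>F j in sequentially. \<forall>x\<in>S1. dist (u (e (s j)) x) (omega_at k z x) < \<eta>"
      proof eventually_elim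
        case (elim j)
        show ?case
        proof
          fix x :: complex assume x: "x \<in> S1"
          have "dist (u (e (s j)) x) (omega_at k z x) \<le>
              norm (u (e (s j)) x - omega_at k (P (e (s j))) x) + norm (omega_at k (P (e (s j)) - z) x)"
            unfolding omega_at_linear(2) dist_norm by norm
          also have "\<dots> \<le> C * \<bar>e (s j)\<bar> + c * norm (P (e (s j)) - z)"
            by (rule add_mono[OF near[OF elim(1) x] c(2)[OF x]])
          finally show "dist (u (e (s j)) x) (omega_at k z x) < \<eta>" using elim(2) by simp
        qed
      qed
    qed
    then show ?thesis using s z crit by blast
  qed
  \<comment> \<open>If the family did not converge, some sequence would stay at distance at least
    \<open>\<eta>\<close>; but it has a subsequence converging to the loop of a critical point in
    \<open>closure A\<close>, which is \<open>z0\<close>.\<close>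
  have unique: "C2_tendsto u (omega_at k z0) (at 0)"
    if uniq: "\<And>z. z \<in> closure A \<Longrightarrow> critical_point (F K k) z \<Longrightarrow> z = z0" for z0
    unfolding C2_tendsto_def tendsto_at_iff_sequentially
  proof (intro allI impI)
    fix X :: "nat \<Rightarrow> real" assume X: "X \<longlonglongrightarrow> 0"
    let ?N = "\<lambda>\<epsilon>. C2_norm (\<lambda>x. u \<epsilon> x - omega_at k z0 x)"
    show "(?N \<circ> X) \<longlonglongrightarrow> 0"
    proof (rule ccontr)
      assume "\<not> (?N \<circ> X) \<longlonglongrightarrow> 0"
      then obtain \<eta> where \<eta>: "\<eta> > 0" "\<not> (\<forall>\<^sub>F n in sequentially. dist ((?N \<circ> X) n) 0 < \<eta>)"
        unfolding tendsto_iff by blast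
      from \<eta>(2) have "infinite {n. \<not> dist ((?N \<circ> X) n) 0 < \<eta>}"
        unfolding eventually_cofinite[symmetric] cofinite_eq_sequentially .
      then obtain r :: "nat \<Rightarrow> nat" where r: "strict_mono r" "\<And>n. r n \<in> {n. \<not> dist ((?N \<circ> X) n) 0 < \<eta>}"
        using infinite_enumerate by blast
      have Xr: "(\<lambda>n. X (r n)) \<longlonglongrightarrow> 0" using LIMSEQ_subseq_LIMSEQ[OF X r(1)] by (simp add: o_def)
      obtain s z where "strict_mono (s :: nat \<Rightarrow> nat)" and z: "z \<in> closure A" "critical_point (F K k) z"
        and lim: "C2_tendsto (\<lambda>j. u (X (r (s j)))) (omega_at k z) sequentially"
        using subseq[OF Xr] by blast
      have "(\<lambda>j. ?N (X (r (s j)))) \<longlonglongrightarrow> 0"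
        using lim unfolding uniq[OF z] C2_tendsto_def .
      from tendstoD[OF this \<eta>(1)] have "\<forall>\<^sub>F j in sequentially. dist (?N (X (r (s j)))) 0 < \<eta>" .
      then obtain j where "dist (?N (X (r (s j)))) 0 < \<eta>" by (auto simp: eventually_sequentially)
      then show False using r(2)[of "s j"] by simp
    qed
  qed
  show ?thesis
  proof (intro exI[of _ \<epsilon>0] exI[of _ u] conjI \<epsilon>0 allI impI ballI)
    fix \<epsilon> :: real assume "\<bar>\<epsilon>\<bar> < \<epsilon>0"
    then have ode: "loop_ode k K \<epsilon> (u \<epsilon>)" by (rule u)
    show "is_H_loop (\<lambda>z. k + \<epsilon> * K z) (u \<epsilon>)" by (rule loop_ode_is_H_loop[OF k K gK ode])
    show "embedded (u \<epsilon>)" by (rule loop_ode_embedded[OF k ode])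
  qed (use subseq unique in blast)+
qed

end
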